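(* Let $\mathsf E$ be an essentially small abelian category and let $f:\mathbb R\to\mathsf E$ be a constructible functor such that $\mathrm{Sub}(f_a)$ has finite length for each $a\in\mathbb R$. Then the type-$\mathsf B$ generalized persistence diagram $\mathrm{PD}^{\mathsf B}_f$ and the saecular persistence diagram $\mathrm{PD}^{\mathrm{sae}}_f$ are well defined, and $$\mathrm{PD}^{\mathsf B}_f(J)=\mathrm{JH}\big(\mathrm{PD}^{\mathrm{sae}}_f(J)\big)$$ for each nonempty interval $J\in\mathbb I(\mathbb R)$.
   Context: Constructible: there are reals $s_1<\dots<s_n$ (put $s_{n+1}=\infty$) such that $f(p\le q)=\mathrm{id}_0$ for $p\le q<s_1$, and $f(p\le q)$ is an isomorphism whenever $s_i\le p\le q<s_{i+1}$; $f$ is then called $S$-constructible for $S=\{s_1<\dots<s_n<\infty\}$. Jordan–Hölder vectors: $V$ is the set of isomorphism classes of simple objects of $\mathsf E$. If $X$ is an object of finite length, $\mathrm{JH}(X)\in\mathbb Z^V$ counts the composition factors of $X$: $\mathrm{JH}(X)_C=\#\{i: X_i/X_{i-1}\cong C\}$ for any maximal chain $0=X_0<\dots<X_k=X$ of subobjects. Interval diagrams: $h:\mathbb R\to\mathsf E$ is an interval diagram of support type $J$ if $h_a=0$ for $a\notin J$ and $h(a\le b)$ is an isomorphism for all $a\le b$ in $J$. For such $h$, with $J\neq\emptyset$, $\mathrm{JH}(h):=\mathrm{JH}(h_a)$ for any $a\in J$. Type-$\mathsf B$ generalized persistence diagram: let $\mathrm{Dgm}$ be the set of intervals $[a,b)$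 with $a<b$, $a\in\mathbb R$, $b\in\mathbb R\cup\{\infty\}$. The rank function assigns to $[a,b)$ the vector $\mathrm{JH}(\mathrm{Im}\, f(a\le c))\in\mathbb Z^V$ for $c\in[a,b)$ sufficiently close to $b$ (sufficiently large if $b=\infty$). $\mathrm{PD}^{\mathsf B}_f$ is its Möbius inversion: the unique function $X:\mathrm{Dgm}\to\mathbb Z^V$ supported on finitely many intervals, all of the form $[s,s')$ with $s,s'\in S$ (for $S$ as in the definition of constructibility), such that the rank function at $L$ equals $\sum_{L'\in\mathrm{Dgm},\,L'\supseteq L}X(L')$ for all $L\in\mathrm{Dgm}$. Extend $\mathrm{PD}^{\mathsf B}_f$ by zero to intervals of $\mathbb R$ not in $\mathrm{Dgm}$. Saecular persistence diagram: for a poset $P$, $\mathbb A(P)$ is the lattice of down-closed subsets. $\mathbb I(\mathbb R)$ is the set of nonempty intervals of $\mathbb R$; each has the form $J=T\setminus S$ for a unique pair of down-closed sets $S\subsetneq T\subseteq\mathbb R$, written $J\sim(S,T)$; $J\le J'$ iff $S\subseteq S'$ and $T\subseteq T'$. Put $\downarrow J=\{L:L\le J\}$, $\mathring\downarrow J=\{L:L<J\}$. For $a\in\mathbb R$ let $\hat K(a)$ be the smallest subobject of $f$ (in $[\mathbb R,\mathsf E]$) that equals $f$ at every $b\le a$, and $K(a)$ the largest subobject of $f$ that vanishes at every $b\ge a$. The saecular CDI homomorphism is the (unique, if it exists) lattice homomorphism $\Omega:\mathbb A(\mathbb I(\mathbb R))\to\mathrm{Sub}(f)$ preserving arbitrary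 (including empty) joins and meets with $\Omega\{J\sim(S,T):a\notin S\}=\hat K(a)$ and $\Omega\{J\sim(S,T):a\notin T\}=K(a)$ for all $a$. Then $\mathrm{PD}^{\mathrm{sae}}_f(J)=\Omega(\downarrow J)/\Omega(\mathring\downarrow J)$; it is well defined if $\Omega$ exists. *)

theory Defs
  imports
    "HOL-Analysis.Analysis"
    "HOL-Library.Extended_Real"
    "HOL-Library.FuncSet"
    "HOL-Algebra.Group"
begin

section \<open>Categories\<close>

record ('o, 'm) cat =
  cobj :: "'o set"
  carr :: "'m set"
  cdom :: "'m \<Rightarrow> 'o"
  ccod :: "'m \<Rightarrow> 'o"
  cid :: "'o \<Rightarrow> 'm"
  ccomp :: "'m \<Rightarrow> 'm \<Rightarrow> 'm"  (infixr \<open>\<odot>\<index>\<close> 70)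

text \<open>Composition is in applicative order: \<open>g \<odot> f\<close> is first \<open>f\<close>, then \<open>g\<close>.\<close>

definition homs :: "('o, 'm) cat \<Rightarrow> 'o \<Rightarrow> 'o \<Rightarrow> 'm set" where
  "homs C X Y = {g \<in> carr C. cdom C g = X \<and> ccod C g = Y}"

locale category =
  fixes C :: "('o, 'm) cat" (structure)
  assumes dom_obj: "g \<in> carr C \<Longrightarrow> cdom C g \<in> cobj C"
    and cod_obj: "g \<in> carr C \<Longrightarrow> ccod C g \<in> cobj C"
    and id_homs: "X \<in> cobj C \<Longrightarrow> cid C X \<in> homs C X X"
    and comp_homs: "\<lbrakk>g \<in> homs C X Y; h \<in> homs C Y Z\<rbrakk> \<Longrightarrow> h \<odot> g \<in> homs C X Z"
    and comp_assoc:
      "\<lbrakk>g \<in> homs C W X; h \<in> homs C X Y; k \<in> homs C Y Z\<rbrakk> \<Longrightarrow> (k \<odot> h) \<odot> g = k \<odot> (h \<odot> g)"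
    and id_right: "g \<in> homs C X Y \<Longrightarrow> g \<odot> cid C X = g"
    and id_left: "g \<in> homs C X Y \<Longrightarrow> cid C Y \<odot> g = g"

definition iso_arr :: "('o, 'm) cat \<Rightarrow> 'm \<Rightarrow> bool" where
  "iso_arr C g \<longleftrightarrow> g \<in> carr C \<and>
     (\<exists>h \<in> homs C (ccod C g) (cdom C g).
        h \<odot>\<^bsub>C\<^esub> g = cid C (cdom C g) \<and> g \<odot>\<^bsub>C\<^esub> h = cid C (ccod C g))"

definition isomorphic :: "('o, 'm) cat \<Rightarrow> 'o \<Rightarrow> 'o \<Rightarrow> bool" where
  "isomorphic C X Y \<longleftrightarrow> (\<exists>g \<in> homs C X Y. iso_arr C g)"

definition monic :: "('o, 'm) cat \<Rightarrow> 'm \<Rightarrow> bool" where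
  "monic C g \<longleftrightarrow> g \<in> carr C \<and>
     (\<forall>W \<in> cobj C. \<forall>u \<in> homs C W (cdom C g). \<forall>v \<in> homs C W (cdom C g).
        g \<odot>\<^bsub>C\<^esub> u = g \<odot>\<^bsub>C\<^esub> v \<longrightarrow> u = v)"

definition epic :: "('o, 'm) cat \<Rightarrow> 'm \<Rightarrow> bool" where
  "epic C g \<longleftrightarrow> g \<in> carr C \<and>
     (\<forall>W \<in> cobj C. \<forall>u \<in> homs C (ccod C g) W. \<forall>v \<in> homs C (ccod C g) W.
        u \<odot>\<^bsub>C\<^esub> g = v \<odot>\<^bsub>C\<^esub> g \<longrightarrow> u = v)"

definition zero_object :: "('o, 'm) cat \<Rightarrow> 'o \<Rightarrow> bool" where
  "zero_object C Z \<longleftrightarrow> Z \<in> cobj C \<and>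
     (\<forall>X \<in> cobj C. (\<exists>!g. g \<in> homs C X Z) \<and> (\<exists>!g. g \<in> homs C Z X))"

definition zero_arr :: "('o, 'm) cat \<Rightarrow> 'm \<Rightarrow> bool" where
  "zero_arr C g \<longleftrightarrow> g \<in> carr C \<and>
     (\<exists>Z u v. zero_object C Z \<and> u \<in> homs C (cdom C g) Z \<and> v \<in> homs C Z (ccod C g) \<and>
        g = v \<odot>\<^bsub>C\<^esub> u)"

definition is_kernel :: "('o, 'm) cat \<Rightarrow> 'm \<Rightarrow> 'm \<Rightarrow> bool" where
  "is_kernel C k g \<longleftrightarrow> g \<in> carr C \<and> k \<in> carr C \<and> ccod C k = cdom C g \<and>
     zero_arr C (g \<odot>\<^bsub>C\<^esub> k) \<and>
     (\<forall>h \<in> carr C. ccod C h = cdom C g \<and> zero_arr C (g \<odot>\<^bsub>C\<^esub> h) \<longrightarrow>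
        (\<exists>!u. u \<in> homs C (cdom C h) (cdom C k) \<and> k \<odot>\<^bsub>C\<^esub> u = h))"

definition is_cokernel :: "('o, 'm) cat \<Rightarrow> 'm \<Rightarrow> 'm \<Rightarrow> bool" where
  "is_cokernel C q g \<longleftrightarrow> g \<in> carr C \<and> q \<in> carr C \<and> cdom C q = ccod C g \<and>
     zero_arr C (q \<odot>\<^bsub>C\<^esub> g) \<and>
     (\<forall>h \<in> carr C. cdom C h = ccod C g \<and> zero_arr C (h \<odot>\<^bsub>C\<^esub> g) \<longrightarrow>
        (\<exists>!u. u \<in> homs C (ccod C q) (ccod C h) \<and> u \<odot>\<^bsub>C\<^esub> q = h))"

definition preadditive_structure ::
    "('o, 'm) cat \<Rightarrow> ('m \<Rightarrow> 'm \<Rightarrow> 'm) \<Rightarrow> ('o \<Rightarrow> 'o \<Rightarrow> 'm) \<Rightarrow> bool" where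
  "preadditive_structure C add nul \<longleftrightarrow>
     (\<forall>X \<in> cobj C. \<forall>Y \<in> cobj C.
        comm_group \<lparr>carrier = homs C X Y, monoid.mult = add, one = nul X Y\<rparr>) \<and>
     (\<forall>X \<in> cobj C. \<forall>Y \<in> cobj C. \<forall>Z \<in> cobj C.
        \<forall>g \<in> homs C X Y. \<forall>g' \<in> homs C X Y. \<forall>h \<in> homs C Y Z. \<forall>h' \<in> homs C Y Z.
          h \<odot>\<^bsub>C\<^esub> add g g' = add (h \<odot>\<^bsub>C\<^esub> g) (h \<odot>\<^bsub>C\<^esub> g') \<and>
          add h h' \<odot>\<^bsub>C\<^esub> g = add (h \<odot>\<^bsub>C\<^esub> g) (h' \<odot>\<^bsub>C\<^esub> g))"

definition is_biproduct ::
    "('o, 'm) cat \<Rightarrow> ('m \<Rightarrow> 'm \<Rightarrow> 'm) \<Rightarrow> ('o \<Rightarrow> 'o \<Rightarrow> 'm) \<Rightarrow> 'o \<Rightarrow> 'o \<Rightarrow> 'o \<Rightarrow> bool" where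
  "is_biproduct C add nul X Y B \<longleftrightarrow> B \<in> cobj C \<and>
     (\<exists>i \<in> homs C X B. \<exists>j \<in> homs C Y B. \<exists>p \<in> homs C B X. \<exists>q \<in> homs C B Y.
        p \<odot>\<^bsub>C\<^esub> i = cid C X \<and> q \<odot>\<^bsub>C\<^esub> j = cid C Y \<and>
        p \<odot>\<^bsub>C\<^esub> j = nul Y X \<and> q \<odot>\<^bsub>C\<^esub> i = nul X Y \<and>
        add (i \<odot>\<^bsub>C\<^esub> p) (j \<odot>\<^bsub>C\<^esub> q) = cid C B)"

text \<open>
  The additive structure of an abelian category is determined by the underlying category,
  so being abelian is a property of the category.
\<close>

locale abelian_category = category C for C :: "('o, 'm) cat" (structure) +
  assumes zero_ex: "\<exists>Z. zero_object C Z"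
    and additive: "\<exists>add nul. preadditive_structure C add nul \<and>
          (\<forall>X \<in> cobj C. \<forall>Y \<in> cobj C. \<exists>B. is_biproduct C add nul X Y B)"
    and kernel_ex: "g \<in> carr C \<Longrightarrow> \<exists>k. is_kernel C k g"
    and cokernel_ex: "g \<in> carr C \<Longrightarrow> \<exists>q. is_cokernel C q g"
    and monic_normal: "monic C g \<Longrightarrow> \<exists>h. is_kernel C g h"
    and epic_normal: "epic C g \<Longrightarrow> \<exists>h. is_cokernel C g h"

definition is_image :: "('o, 'm) cat \<Rightarrow> 'm \<Rightarrow> 'm \<Rightarrow> bool" where
  "is_image C m g \<longleftrightarrow> (\<exists>q. is_cokernel C q g \<and> is_kernel C m q)"

definition image_obj :: "('o, 'm) cat \<Rightarrow> 'm \<Rightarrow> 'o" where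
  "image_obj C g = cdom C (SOME m. is_image C m g)"


section \<open>Subobjects and quotients\<close>

text \<open>A subobject of \<open>X\<close> is an equivalence class of monomorphisms into \<open>X\<close>.\<close>

definition factors_through :: "('o, 'm) cat \<Rightarrow> 'm \<Rightarrow> 'm \<Rightarrow> bool" where
  "factors_through C m n \<longleftrightarrow> (\<exists>h \<in> homs C (cdom C m) (cdom C n). m = n \<odot>\<^bsub>C\<^esub> h)"

definition monos_into :: "('o, 'm) cat \<Rightarrow> 'o \<Rightarrow> 'm set" where
  "monos_into C X = {m. monic C m \<and> ccod C m = X}"

definition Sub :: "('o, 'm) cat \<Rightarrow> 'o \<Rightarrow> 'm set gorder" where
  "Sub C X =
     \<lparr>carrier = monos_into C X //
        {(m, n). m \<in> monos_into C X \<and> n \<in> monos_into C X \<and>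
                 factors_through C m n \<and> factors_through C n m},
      eq = (=),
      le = (\<lambda>M N. \<exists>m \<in> M. \<exists>n \<in> N. factors_through C m n)\<rparr>"

definition is_quotient :: "('o, 'm) cat \<Rightarrow> 'm set \<Rightarrow> 'm set \<Rightarrow> 'o \<Rightarrow> bool" where
  "is_quotient C M N Q \<longleftrightarrow>
     (\<exists>m \<in> M. \<exists>n \<in> N. \<exists>h \<in> homs C (cdom C n) (cdom C m). n = m \<odot>\<^bsub>C\<^esub> h \<and>
        (\<exists>q. is_cokernel C q h \<and> Q = ccod C q))"

definition quotient_obj :: "('o, 'm) cat \<Rightarrow> 'm set \<Rightarrow> 'm set \<Rightarrow> 'o" where
  "quotient_obj C M N = (SOME Q. is_quotient C M N Q)"

text \<open>Finite length of the lattice of subobjects: the lengths of its chains are bounded.\<close>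

definition finite_length :: "('o, 'm) cat \<Rightarrow> 'o \<Rightarrow> bool" where
  "finite_length C X \<longleftrightarrow> X \<in> cobj C \<and>
     (\<exists>n::nat. \<forall>K \<subseteq> carrier (Sub C X).
        (\<forall>M \<in> K. \<forall>N \<in> K. M \<sqsubseteq>\<^bsub>Sub C X\<^esub> N \<or> N \<sqsubseteq>\<^bsub>Sub C X\<^esub> M) \<longrightarrow> finite K \<and> card K \<le> n)"


section \<open>Jordan--Hoelder vectors\<close>

definition simple_object :: "('o, 'm) cat \<Rightarrow> 'o \<Rightarrow> bool" where
  "simple_object C X \<longleftrightarrow> X \<in> cobj C \<and> \<not> zero_object C X \<and>
     (\<forall>m \<in> monos_into C X. zero_object C (cdom C m) \<or> iso_arr C m)"

definition simple_classes :: "('o, 'm) cat \<Rightarrow> 'o set set" where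
  "simple_classes C = {{Y \<in> cobj C. isomorphic C X Y} | X. simple_object C X}"

text \<open>
  Integer vectors indexed by the isomorphism classes of simple objects are functions on
  \<^typ>\<open>'o set\<close> that vanish outside these classes.
\<close>

definition simple_vectors :: "('o, 'm) cat \<Rightarrow> ('o set \<Rightarrow> int) set" where
  "simple_vectors C = {v. \<forall>K. K \<notin> simple_classes C \<longrightarrow> v K = 0}"

text \<open>
  A finite maximal chain of subobjects, listed in strictly increasing order.  By maximality
  its first entry is the zero subobject and its last entry is the whole object.
\<close>

definition composition_series :: "('o, 'm) cat \<Rightarrow> 'o \<Rightarrow> 'm set list \<Rightarrow> bool" where
  "composition_series C X Ms \<longleftrightarrow>
     set Ms \<subseteq> carrier (Sub C X) \<and>
     sorted_wrt (\<lambda>M N. M \<sqsubset>\<^bsub>Sub C X\<^esub> N) Ms \<and>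
     (\<forall>N \<in> carrier (Sub C X).
        (\<forall>M \<in> set Ms. M \<sqsubseteq>\<^bsub>Sub C X\<^esub> N \<or> N \<sqsubseteq>\<^bsub>Sub C X\<^esub> M) \<longrightarrow> N \<in> set Ms)"

definition factor_count :: "('o, 'm) cat \<Rightarrow> 'm set list \<Rightarrow> 'o set \<Rightarrow> int" where
  "factor_count C Ms K =
     (if K \<in> simple_classes C
      then int (card {i. 0 < i \<and> i < length Ms \<and> quotient_obj C (Ms ! i) (Ms ! (i - 1)) \<in> K})
      else 0)"

definition JH :: "('o, 'm) cat \<Rightarrow> 'o \<Rightarrow> 'o set \<Rightarrow> int" where
  "JH C X = (THE v. (\<exists>Ms. composition_series C X Ms) \<and>
                    (\<forall>Ms. composition_series C X Ms \<longrightarrow> factor_count C Ms = v))"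


section \<open>Diagrams over a poset\<close>

datatype ('p, 'o, 'm) diagram =
  Diagram (on_obj: "'p \<Rightarrow> 'o") (on_le: "'p \<Rightarrow> 'p \<Rightarrow> 'm")

definition is_functor :: "('o, 'm) cat \<Rightarrow> ('p::order, 'o, 'm) diagram \<Rightarrow> bool" where
  "is_functor C F \<longleftrightarrow>
     (\<forall>p. on_obj F p \<in> cobj C) \<and>
     (\<forall>p q. p \<le> q \<longrightarrow> on_le F p q \<in> homs C (on_obj F p) (on_obj F q)) \<and>
     (\<forall>p q. \<not> p \<le> q \<longrightarrow> on_le F p q = undefined) \<and>
     (\<forall>p. on_le F p p = cid C (on_obj F p)) \<and>
     (\<forall>p q r. p \<le> q \<and> q \<le> r \<longrightarrow> on_le F p r = on_le F q r \<odot>\<^bsub>C\<^esub> on_le F p q)"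

datatype ('p, 'o, 'm) nattrans =
  NatTrans (nt_dom: "('p, 'o, 'm) diagram") (nt_at: "'p \<Rightarrow> 'm") (nt_cod: "('p, 'o, 'm) diagram")

definition is_nattrans :: "('o, 'm) cat \<Rightarrow> ('p::order, 'o, 'm) nattrans \<Rightarrow> bool" where
  "is_nattrans C t \<longleftrightarrow> is_functor C (nt_dom t) \<and> is_functor C (nt_cod t) \<and>
     (\<forall>p. nt_at t p \<in> homs C (on_obj (nt_dom t) p) (on_obj (nt_cod t) p)) \<and>
     (\<forall>p q. p \<le> q \<longrightarrow>
        nt_at t q \<odot>\<^bsub>C\<^esub> on_le (nt_dom t) p q = on_le (nt_cod t) p q \<odot>\<^bsub>C\<^esub> nt_at t p)"

definition functor_cat ::
    "('o, 'm) cat \<Rightarrow> (('p::order, 'o, 'm) diagram, ('p, 'o, 'm) nattrans) cat" where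
  "functor_cat C =
     \<lparr>cobj = {F. is_functor C F},
      carr = {t. is_nattrans C t},
      cdom = nt_dom,
      ccod = nt_cod,
      cid = (\<lambda>F. NatTrans F (\<lambda>p. cid C (on_obj F p)) F),
      ccomp = (\<lambda>t s. NatTrans (nt_dom s) (\<lambda>p. nt_at t p \<odot>\<^bsub>C\<^esub> nt_at s p) (nt_cod t))\<rparr>"

text \<open>
  The sequence \<open>s 1 < \<dots> < s n < s (n + 1) = \<infinity>\<close> takes values in the extended reals.
\<close>

definition constructible_wrt ::
    "('o, 'm) cat \<Rightarrow> (real, 'o, 'm) diagram \<Rightarrow> ereal set \<Rightarrow> bool" where
  "constructible_wrt C f S \<longleftrightarrow>
     (\<exists>(n::nat) (s::nat \<Rightarrow> ereal). 1 \<le> n \<and> s ` {1..n} \<subseteq> range ereal \<and> s (n + 1) = \<infinity> \<and>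
        strict_mono_on {1..n + 1} s \<and> S = s ` {1..n + 1} \<and>
        (\<exists>Z. zero_object C Z \<and>
             (\<forall>p q. p \<le> q \<and> ereal q < s 1 \<longrightarrow> on_le f p q = cid C Z)) \<and>
        (\<forall>i \<in> {1..n}. \<forall>p q. s i \<le> ereal p \<and> p \<le> q \<and> ereal q < s (i + 1) \<longrightarrow>
             iso_arr C (on_le f p q)))"

definition constructible :: "('o, 'm) cat \<Rightarrow> (real, 'o, 'm) diagram \<Rightarrow> bool" where
  "constructible C f \<longleftrightarrow> (\<exists>S. constructible_wrt C f S)"

definition interval_diagram ::
    "('o, 'm) cat \<Rightarrow> real set \<Rightarrow> (real, 'o, 'm) diagram \<Rightarrow> bool" where
  "interval_diagram C J h \<longleftrightarrow> is_functor C h \<and>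
     (\<forall>a. a \<notin> J \<longrightarrow> zero_object C (on_obj h a)) \<and>
     (\<forall>a \<in> J. \<forall>b \<in> J. a \<le> b \<longrightarrow> iso_arr C (on_le h a b))"

definition JH_diagram ::
    "('o, 'm) cat \<Rightarrow> real set \<Rightarrow> (real, 'o, 'm) diagram \<Rightarrow> 'o set \<Rightarrow> int" where
  "JH_diagram C J h = (THE v. \<forall>a \<in> J. JH C (on_obj h a) = v)"


section \<open>The type-B generalized persistence diagram\<close>

definition half_open :: "real \<Rightarrow> ereal \<Rightarrow> real set" where
  "half_open a b = {x. a \<le> x \<and> ereal x < b}"

definition Dgm :: "real set set" where
  "Dgm = {half_open a b | a b. ereal a < b}"

definition is_rank ::
    "('o, 'm) cat \<Rightarrow> (real, 'o, 'm) diagram \<Rightarrow> real \<Rightarrow> ereal \<Rightarrow> ('o set \<Rightarrow> int) \<Rightarrow> bool" where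
  "is_rank C f a b v \<longleftrightarrow>
     (\<exists>c0 \<in> half_open a b. \<forall>c \<in> half_open a b. c0 \<le> c \<longrightarrow>
        JH C (image_obj C (on_le f a c)) = v)"

definition rank_vector ::
    "('o, 'm) cat \<Rightarrow> (real, 'o, 'm) diagram \<Rightarrow> real \<Rightarrow> ereal \<Rightarrow> 'o set \<Rightarrow> int" where
  "rank_vector C f a b = (THE v. is_rank C f a b v)"

text \<open>
  Functions on \<^const>\<open>Dgm\<close> are represented by their extensions by zero to all sets of reals.
  The sum over all larger intervals runs over the finite support only, because a sum over
  an infinite index set is zero by convention.
\<close>

definition is_moebius_inversion ::
    "('o, 'm) cat \<Rightarrow> (real, 'o, 'm) diagram \<Rightarrow> ereal set \<Rightarrow> (real set \<Rightarrow> 'o set \<Rightarrow> int) \<Rightarrow> bool" where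
  "is_moebius_inversion C f S X \<longleftrightarrow>
     (\<forall>L. X L \<in> simple_vectors C) \<and>
     finite {L. X L \<noteq> (\<lambda>_. 0)} \<and>
     (\<forall>L. X L \<noteq> (\<lambda>_. 0) \<longrightarrow>
        (\<exists>a b. ereal a \<in> S \<and> b \<in> S \<and> ereal a < b \<and> L = half_open a b)) \<and>
     (\<forall>a b. ereal a < b \<longrightarrow>
        (\<forall>K. rank_vector C f a b K =
           (\<Sum>L | L \<in> Dgm \<and> half_open a b \<subseteq> L \<and> X L \<noteq> (\<lambda>_. 0). X L K)))"

definition PD_B ::
    "('o, 'm) cat \<Rightarrow> (real, 'o, 'm) diagram \<Rightarrow> real set \<Rightarrow> 'o set \<Rightarrow> int" where
  "PD_B C f = (THE X. \<exists>S. constructible_wrt C f S \<and> is_moebius_inversion C f S X)"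

definition PD_B_well_defined :: "('o, 'm) cat \<Rightarrow> (real, 'o, 'm) diagram \<Rightarrow> bool" where
  "PD_B_well_defined C f \<longleftrightarrow>
     (\<forall>a c. a \<le> c \<longrightarrow> finite_length C (image_obj C (on_le f a c))) \<and>
     (\<forall>a b. ereal a < b \<longrightarrow> (\<exists>!v. is_rank C f a b v)) \<and>
     (\<forall>S. constructible_wrt C f S \<longrightarrow> (\<exists>!X. is_moebius_inversion C f S X)) \<and>
     (\<exists>!X. \<exists>S. constructible_wrt C f S \<and> is_moebius_inversion C f S X)"


section \<open>The saecular persistence diagram\<close>

definition downsets :: "'a set \<Rightarrow> ('a \<Rightarrow> 'a \<Rightarrow> bool) \<Rightarrow> 'a set set" where
  "downsets P leq = {D. D \<subseteq> P \<and> (\<forall>x \<in> D. \<forall>y \<in> P. leq y x \<longrightarrow> y \<in> D)}"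

definition real_intervals :: "real set set" where
  "real_intervals = {J. is_interval J \<and> J \<noteq> {}}"

definition represents :: "real set \<Rightarrow> real set \<Rightarrow> real set \<Rightarrow> bool" where
  "represents J S T \<longleftrightarrow>
     S \<in> downsets UNIV (\<le>) \<and> T \<in> downsets UNIV (\<le>) \<and> S \<subset> T \<and> J = T - S"

definition interval_le :: "real set \<Rightarrow> real set \<Rightarrow> bool" where
  "interval_le J J' \<longleftrightarrow>
     (\<exists>S T S' T'. represents J S T \<and> represents J' S' T' \<and> S \<subseteq> S' \<and> T \<subseteq> T')"

definition principal_down :: "real set \<Rightarrow> real set set" where
  "principal_down J = {L \<in> real_intervals. interval_le L J}"

definition strict_down :: "real set \<Rightarrow> real set set" where
  "strict_down J = {L \<in> real_intervals. interval_le L J \<and> L \<noteq> J}"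

text \<open>
  These conditions do not depend on the representative \<open>m\<close> of the subobject class \<open>M\<close>.
\<close>

definition full_at :: "('o, 'm) cat \<Rightarrow> ('p, 'o, 'm) nattrans set \<Rightarrow> 'p \<Rightarrow> bool" where
  "full_at C M b \<longleftrightarrow> (\<exists>m \<in> M. iso_arr C (nt_at m b))"

definition vanishes_at :: "('o, 'm) cat \<Rightarrow> ('p, 'o, 'm) nattrans set \<Rightarrow> 'p \<Rightarrow> bool" where
  "vanishes_at C M b \<longleftrightarrow> (\<exists>m \<in> M. zero_object C (on_obj (nt_dom m) b))"

definition is_K_hat ::
    "('o, 'm) cat \<Rightarrow> (real, 'o, 'm) diagram \<Rightarrow> real \<Rightarrow> (real, 'o, 'm) nattrans set \<Rightarrow> bool" where
  "is_K_hat C f a M \<longleftrightarrow>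
     least (Sub (functor_cat C) f) M
       {N \<in> carrier (Sub (functor_cat C) f). \<forall>b \<le> a. full_at C N b}"

definition is_K ::
    "('o, 'm) cat \<Rightarrow> (real, 'o, 'm) diagram \<Rightarrow> real \<Rightarrow> (real, 'o, 'm) nattrans set \<Rightarrow> bool" where
  "is_K C f a M \<longleftrightarrow>
     greatest (Sub (functor_cat C) f) M
       {N \<in> carrier (Sub (functor_cat C) f). \<forall>b \<ge> a. vanishes_at C N b}"

text \<open>
  Joins and meets of down-closed sets are unions and intersections; the intersection with
  \<^const>\<open>real_intervals\<close> only matters for the empty meet.
\<close>

definition saecular_hom ::
    "('o, 'm) cat \<Rightarrow> (real, 'o, 'm) diagram \<Rightarrow>
     (real set set \<Rightarrow> (real, 'o, 'm) nattrans set) \<Rightarrow> bool" where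
  "saecular_hom C f \<Omega> \<longleftrightarrow>
     (let A = downsets real_intervals interval_le; L = Sub (functor_cat C) f in
        \<Omega> \<in> A \<rightarrow>\<^sub>E carrier L \<and>
        (\<forall>\<D> \<subseteq> A. least L (\<Omega> (\<Union>\<D>)) (Upper L (\<Omega> ` \<D>))) \<and>
        (\<forall>\<D> \<subseteq> A. greatest L (\<Omega> (real_intervals \<inter> \<Inter>\<D>)) (Lower L (\<Omega> ` \<D>))) \<and>
        (\<forall>a. is_K_hat C f a (\<Omega> {J \<in> real_intervals. \<exists>S T. represents J S T \<and> a \<notin> S})) \<and>
        (\<forall>a. is_K C f a (\<Omega> {J \<in> real_intervals. \<exists>S T. represents J S T \<and> a \<notin> T})))"

definition saecular_CDI ::
    "('o, 'm) cat \<Rightarrow> (real, 'o, 'm) diagram \<Rightarrow> real set set \<Rightarrow> (real, 'o, 'm) nattrans set" where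
  "saecular_CDI C f = (THE \<Omega>. saecular_hom C f \<Omega>)"

definition PD_sae ::
    "('o, 'm) cat \<Rightarrow> (real, 'o, 'm) diagram \<Rightarrow> real set \<Rightarrow> (real, 'o, 'm) diagram" where
  "PD_sae C f J =
     quotient_obj (functor_cat C)
       (saecular_CDI C f (principal_down J)) (saecular_CDI C f (strict_down J))"

definition PD_sae_well_defined :: "('o, 'm) cat \<Rightarrow> (real, 'o, 'm) diagram \<Rightarrow> bool" where
  "PD_sae_well_defined C f \<longleftrightarrow>
     (\<exists>!\<Omega>. saecular_hom C f \<Omega>) \<and>
     (\<forall>J \<in> real_intervals. \<exists>Q.
        is_quotient (functor_cat C)
          (saecular_CDI C f (principal_down J)) (saecular_CDI C f (strict_down J)) Q)"

end

theory Submission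
  imports Defs
begin

text \<open>
  A subobject of an object of an abelian category is identified with the set of all arrows
  factoring through it.  Inclusion, meets and inverse images of subobjects become inclusion,
  intersection and preimages of sets, and membership of sums and images can be tested after
  precomposition with an epimorphism; this makes the lattice computations elementwise.

  Let \<open>s 1 < \<dots> < s n < s (n + 1) = \<infinity>\<close> be the critical values of \<open>f\<close>.  At \<open>a\<close>, the saecular
  homomorphism sends a down-closed set \<open>D\<close> of intervals to the finite join \<open>Om D a\<close> of the subobjects
  \<open>Im f(s i \<le> a) \<inter> Ker f(a \<le> s j)\<close> over all \<open>[s i, s j) \<in> D\<close> containing \<open>a\<close>.  It preserves meets
  because two finite chains generate a distributive sublattice of a modular lattice.  Consequently
  the Jordan--Hoelder vectors of \<open>Om D a\<close> are sums of those of the subquotients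
  \<open>Om (principal_down J) a / Om (strict_down J) a\<close> with \<open>J \<in> D\<close> and \<open>a \<in> J\<close>.  Since the image of
  \<open>f(a \<le> c)\<close> is the quotient of \<open>f a\<close> by \<open>Ker f(a \<le> c)\<close>, the rank is the sum of the contributions
  of the intervals containing both \<open>a\<close> and \<open>c\<close>, which is the inversion formula.
\<close>

section \<open>Arrows and subobjects\<close>

text \<open>Images and quotients are picked by Hilbert choice and \<open>JH\<close> by a definite
  description, so nothing can be computed from a particular representative. Every comparison goes
  through a relation \<open>subq\<close> that fixes a subquotient up to isomorphism, and
  Jordan-Hoelder vectors become a valuation \<open>mu\<close> on intervals of the subobject lattice,
  additive along chains and modular. The counting of intervals then takes place in the lattice and
  never mentions the chosen objects.

  The functor category is not shown to be abelian. Monomorphisms, factorisations and cokernels of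
  diagrams are treated pointwise, and a subobject of \<open>f\<close> becomes a compatible family of
  subobjects of the \<open>f a\<close>.

  The obstacle is preservation of arbitrary meets, as subobject lattices are modular but not
  distributive. Constructibility helps here: at a fixed point every family of down-closed sets of
  intervals turns into a family of subsets of one finite grid. Uniqueness of the saecular
  homomorphism has a different source: its prescribed values determine the principal down-sets as
  meets, and these determine all other values as joins.\<close>

lemma homs_iff: "g \<in> homs C X Y \<longleftrightarrow> g \<in> carr C \<and> cdom C g = X \<and> ccod C g = Y"
  by (simp add: homs_def)

lemma homs_dom: "g \<in> homs C X Y \<Longrightarrow> cdom C g = X"
  and homs_cod: "g \<in> homs C X Y \<Longrightarrow> ccod C g = Y"
  and homs_carr: "g \<in> homs C X Y \<Longrightarrow> g \<in> carr C"
  by (simp_all add: homs_def)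

context category
begin

abbreviation H where "H \<equiv> homs C"

section \<open>Subobjects as sets of arrows\<close>

definition el :: "'m \<Rightarrow> 'm set" where
  "el m = {x \<in> carr C. factors_through C x m}"

definition subs :: "'o \<Rightarrow> 'm set set" where
  "subs X = el ` monos_into C X"

text \<open>The way back from sets to the equivalence classes that form the carrier of
  \<open>Sub C X\<close>. On \<open>subs X\<close> it is injective and turns inclusion into the
  order of \<open>Sub C X\<close>, so everything about that order can be read off from sets of
  arrows.\<close>

definition cls :: "'o \<Rightarrow> 'm set \<Rightarrow> 'm set" where
  "cls X A = {m \<in> monos_into C X. el m = A}"

lemma homs_obj: "g \<in> H X Y \<Longrightarrow> X \<in> cobj C" "g \<in> H X Y \<Longrightarrow> Y \<in> cobj C"
  using dom_obj cod_obj by (auto simp: homs_iff)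

lemma assoc:
  "\<lbrakk>g \<in> H W X; h \<in> H X Y; k \<in> H Y Z\<rbrakk> \<Longrightarrow> (k \<odot> h) \<odot> g = k \<odot> h \<odot> g"
  by (rule comp_assoc)

lemma comp_carr: "g \<in> carr C \<Longrightarrow> h \<in> carr C \<Longrightarrow> ccod C g = cdom C h \<Longrightarrow> h \<odot> g \<in> carr C"
  and comp_dom: "g \<in> carr C \<Longrightarrow> h \<in> carr C \<Longrightarrow> ccod C g = cdom C h \<Longrightarrow> cdom C (h \<odot> g) = cdom C g"
  and comp_cod: "g \<in> carr C \<Longrightarrow> h \<in> carr C \<Longrightarrow> ccod C g = cdom C h \<Longrightarrow> ccod C (h \<odot> g) = ccod C h"
  using comp_homs[of g "cdom C g" "cdom C h" h "ccod C h"] by (simp_all add: homs_iff)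

lemma assoc_carr:
  "\<lbrakk>g \<in> carr C; h \<in> carr C; k \<in> carr C; ccod C g = cdom C h; ccod C h = cdom C k\<rbrakk>
    \<Longrightarrow> (k \<odot> h) \<odot> g = k \<odot> h \<odot> g"
  using assoc[of g "cdom C g" "cdom C h" h "cdom C k" k "ccod C k"] by (simp add: homs_iff)

lemmas arr_simps = homs_iff comp_carr comp_dom comp_cod assoc_carr

lemma mem_el_iff:
  assumes "m \<in> H Y X"
  shows "x \<in> el m \<longleftrightarrow> (\<exists>W. \<exists>h \<in> H W Y. x = m \<odot> h)"
proof
  assume "x \<in> el m"
  then show "\<exists>W. \<exists>h \<in> H W Y. x = m \<odot> h"
    using assms by (auto simp: el_def factors_through_def homs_dom)
next
  assume "\<exists>W. \<exists>h \<in> H W Y. x = m \<odot> h"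
  then obtain W h where h: "h \<in> H W Y" "x = m \<odot> h" by blast
  then have "x \<in> H W X" using assms comp_homs by blast
  then show "x \<in> el m" using h assms by (auto simp: el_def factors_through_def homs_dom homs_carr)
qed

lemma el_comp: "m \<in> H Y X \<Longrightarrow> h \<in> H W Y \<Longrightarrow> m \<odot> h \<in> el m"
  by (auto simp: mem_el_iff)

lemma self_mem_el: "m \<in> H Y X \<Longrightarrow> m \<in> el m"
  using id_homs homs_obj id_right by (metis mem_el_iff)

lemma el_obtain:
  assumes "m \<in> H Y X" "x \<in> el m" "x \<in> H W Z"
  obtains h where "h \<in> H W Y" "x = m \<odot> h"
proof -
  obtain V h where h: "h \<in> H V Y" "x = m \<odot> h" using assms mem_el_iff by blast
  have "V = W" using h assms comp_homs by (metis homs_dom)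
  then show ?thesis using h that by blast
qed

lemma mem_el_homs: "m \<in> H Y X \<Longrightarrow> x \<in> el m \<Longrightarrow> x \<in> H (cdom C x) X"
  by (auto simp: mem_el_iff arr_simps)

lemma el_closed:
  assumes "m \<in> H Y X" "x \<in> el m" "x \<in> H W Z" "h \<in> H V W"
  shows "x \<odot> h \<in> el m"
proof -
  obtain k where k: "k \<in> H W Y" "x = m \<odot> k" using el_obtain assms by blast
  then have "x \<odot> h = m \<odot> k \<odot> h" using assms by (simp add: arr_simps)
  then show ?thesis using el_comp[OF assms(1) comp_homs[OF assms(4) k(1)]] by simp
qed

lemma factors_through_iff_mem:
  "m \<in> carr C \<Longrightarrow> factors_through C m n \<longleftrightarrow> m \<in> el n"
  by (simp add: el_def)

lemma factors_through_iff_el: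
  assumes "m \<in> H Y X" "n \<in> H Z X"
  shows "factors_through C m n \<longleftrightarrow> el m \<subseteq> el n"
proof
  assume "factors_through C m n"
  then have "m \<in> el n" using assms by (simp add: factors_through_iff_mem homs_carr)
  then have "m \<odot> h \<in> el n" if "h \<in> H W Y" for W h
    using el_closed[OF assms(2) _ assms(1) that] by simp
  then show "el m \<subseteq> el n" by (auto simp: mem_el_iff[OF assms(1)])
next
  assume "el m \<subseteq> el n"
  then show "factors_through C m n"
    using self_mem_el[OF assms(1)] homs_carr[OF assms(1)] by (auto simp: factors_through_iff_mem)
qed

lemma monos_into_iff: "m \<in> monos_into C X \<longleftrightarrow> monic C m \<and> m \<in> H (cdom C m) X"
  by (auto simp: monos_into_def monic_def homs_iff)

lemma subs_obtain:
  assumes "A \<in> subs X"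
  obtains Y m where "m \<in> H Y X" "monic C m" "A = el m" "m \<in> monos_into C X"
  using assms unfolding subs_def by (auto simp: monos_into_iff)

lemma subsI: "m \<in> H Y X \<Longrightarrow> monic C m \<Longrightarrow> el m \<in> subs X"
  by (auto simp: subs_def monos_into_def homs_cod)

lemma subs_homs: "A \<in> subs X \<Longrightarrow> x \<in> A \<Longrightarrow> x \<in> H (cdom C x) X"
  by (metis subs_obtain mem_el_homs)

lemma subs_closed: "A \<in> subs X \<Longrightarrow> x \<in> A \<Longrightarrow> x \<in> H W Z \<Longrightarrow> h \<in> H V W \<Longrightarrow> x \<odot> h \<in> A"
  by (metis subs_obtain el_closed)

lemma Sub_rel_iff:
  assumes "m \<in> monos_into C X"
  shows "{(m, n). m \<in> monos_into C X \<and> n \<in> monos_into C X \<and>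
            factors_through C m n \<and> factors_through C n m} `` {m} = cls X (el m)"
  using assms unfolding cls_def
  by (auto simp: monos_into_iff factors_through_iff_el)

lemma carrier_Sub: "carrier (Sub C X) = cls X ` subs X"
proof -
  have "carrier (Sub C X) = (\<Union>m \<in> monos_into C X. {cls X (el m)})"
    unfolding Sub_def quotient_def partial_object.simps
    by (rule SUP_cong) (simp_all only: Sub_rel_iff)
  then show ?thesis by (auto simp: subs_def)
qed

lemma cls_nonempty: "A \<in> subs X \<Longrightarrow> \<exists>m. m \<in> cls X A"
  by (auto simp: subs_def cls_def)

lemma cls_memD: "m \<in> cls X A \<Longrightarrow> m \<in> H (cdom C m) X \<and> monic C m \<and> el m = A"
  by (auto simp: cls_def monos_into_iff)

lemma le_Sub:
  assumes "A \<in> subs X" "B \<in> subs X"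
  shows "le (Sub C X) (cls X A) (cls X B) \<longleftrightarrow> A \<subseteq> B"
proof -
  have "factors_through C m n \<longleftrightarrow> A \<subseteq> B" if "m \<in> cls X A" "n \<in> cls X B" for m n
    using factors_through_iff_el[of m "cdom C m" X n "cdom C n"] cls_memD[OF that(1)] cls_memD[OF that(2)]
    by simp
  then show ?thesis using assms cls_nonempty unfolding Sub_def gorder.simps by blast
qed

lemma eq_Sub [simp]: "eq (Sub C X) = (=)"
  by (simp add: Sub_def)

lemma cls_inj: "inj_on (cls X) (subs X)"
  by (intro inj_onI) (metis cls_nonempty cls_memD)

lemma lless_Sub:
  assumes "A \<in> subs X" "B \<in> subs X"
  shows "lless (Sub C X) (cls X A) (cls X B) \<longleftrightarrow> A \<subset> B"
  using assms by (auto simp: lless_def le_Sub inj_on_eq_iff[OF cls_inj])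

section \<open>Monomorphisms, epimorphisms and isomorphisms\<close>

lemma monic_cancel:
  "monic C m \<Longrightarrow> m \<in> H Y X \<Longrightarrow> u \<in> H W Y \<Longrightarrow> v \<in> H W Y \<Longrightarrow> m \<odot> u = m \<odot> v \<Longrightarrow> u = v"
  unfolding monic_def using homs_obj by (metis homs_dom)

lemma epic_cancel:
  "epic C m \<Longrightarrow> m \<in> H X Y \<Longrightarrow> u \<in> H Y W \<Longrightarrow> v \<in> H Y W \<Longrightarrow> u \<odot> m = v \<odot> m \<Longrightarrow> u = v"
  unfolding epic_def using homs_obj by (metis homs_cod)

lemma monicI:
  assumes "m \<in> H Y X" "\<And>W u v. u \<in> H W Y \<Longrightarrow> v \<in> H W Y \<Longrightarrow> m \<odot> u = m \<odot> v \<Longrightarrow> u = v"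
  shows "monic C m"
  using assms unfolding monic_def by (auto simp: homs_carr homs_dom)

lemma epicI:
  assumes "m \<in> H X Y" "\<And>W u v. u \<in> H Y W \<Longrightarrow> v \<in> H Y W \<Longrightarrow> u \<odot> m = v \<odot> m \<Longrightarrow> u = v"
  shows "epic C m"
  using assms unfolding epic_def by (auto simp: homs_carr homs_cod)

lemma monic_comp:
  assumes "monic C m" "m \<in> H Y X" "monic C n" "n \<in> H Z Y"
  shows "monic C (m \<odot> n)"
proof (rule monicI)
  show "m \<odot> n \<in> H Z X" using assms comp_homs by blast
  fix W u v assume uv: "u \<in> H W Z" "v \<in> H W Z" "(m \<odot> n) \<odot> u = (m \<odot> n) \<odot> v"
  then have "m \<odot> n \<odot> u = m \<odot> n \<odot> v" using assms(2,4) by (simp add: arr_simps)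
  then have "n \<odot> u = n \<odot> v"
    using monic_cancel[OF assms(1,2)] comp_homs[OF uv(1) assms(4)] comp_homs[OF uv(2) assms(4)] by blast
  then show "u = v" using assms uv monic_cancel by metis
qed

lemma epic_comp:
  assumes "epic C m" "m \<in> H Y X" "epic C n" "n \<in> H X Z"
  shows "epic C (n \<odot> m)"
proof (rule epicI)
  show "n \<odot> m \<in> H Y Z" using assms comp_homs by blast
  fix W u v assume uv: "u \<in> H Z W" "v \<in> H Z W" "u \<odot> n \<odot> m = v \<odot> n \<odot> m"
  then have "(u \<odot> n) \<odot> m = (v \<odot> n) \<odot> m" using assms(2,4) by (simp add: arr_simps)
  then have "u \<odot> n = v \<odot> n"
    using epic_cancel[OF assms(1,2)] comp_homs[OF assms(4) uv(1)] comp_homs[OF assms(4) uv(2)] by blast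
  then show "u = v" using assms uv epic_cancel by metis
qed

lemma id_monic: "X \<in> cobj C \<Longrightarrow> monic C (cid C X)"
  by (rule monicI[OF id_homs]) (auto simp: id_left)

lemma id_epic: "X \<in> cobj C \<Longrightarrow> epic C (cid C X)"
  by (rule epicI[OF id_homs]) (auto simp: id_right)

lemma iso_obtain:
  assumes "iso_arr C g" "g \<in> H X Y"
  obtains h where "h \<in> H Y X" "h \<odot> g = cid C X" "g \<odot> h = cid C Y"
  using assms unfolding iso_arr_def by (metis homs_dom homs_cod)

lemma isoI:
  assumes "g \<in> H X Y" "h \<in> H Y X" "h \<odot> g = cid C X" "g \<odot> h = cid C Y"
  shows "iso_arr C g"
  using assms unfolding iso_arr_def by (auto simp: homs_carr homs_dom homs_cod)

lemma iso_monic: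
  assumes "iso_arr C g" "g \<in> H X Y" shows "monic C g"
proof -
  obtain h where h: "h \<in> H Y X" "h \<odot> g = cid C X" "g \<odot> h = cid C Y"
    using assms iso_obtain by blast
  show ?thesis
  proof (rule monicI[OF assms(2)])
    fix W u v assume uv: "u \<in> H W X" "v \<in> H W X" "g \<odot> u = g \<odot> v"
    have "(h \<odot> g) \<odot> u = (h \<odot> g) \<odot> v"
      unfolding assoc[OF uv(1) assms(2) h(1)] assoc[OF uv(2) assms(2) h(1)] uv(3) ..
    then show "u = v" using h(2) id_left uv by metis
  qed
qed

lemma iso_epic:
  assumes "iso_arr C g" "g \<in> H X Y" shows "epic C g"
proof -
  obtain h where h: "h \<in> H Y X" "h \<odot> g = cid C X" "g \<odot> h = cid C Y"
    using assms iso_obtain by blast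
  show ?thesis
  proof (rule epicI[OF assms(2)])
    fix W u v assume uv: "u \<in> H Y W" "v \<in> H Y W" "u \<odot> g = v \<odot> g"
    have "u \<odot> g \<odot> h = v \<odot> g \<odot> h"
      unfolding assoc[OF h(1) assms(2) uv(1), symmetric] assoc[OF h(1) assms(2) uv(2), symmetric] uv(3) ..
    then show "u = v" using h(3) id_right uv by metis
  qed
qed

lemma iso_comp:
  assumes "iso_arr C g" "g \<in> H X Y" "iso_arr C k" "k \<in> H Y Z"
  shows "iso_arr C (k \<odot> g)"
proof -
  obtain h where h: "h \<in> H Y X" "h \<odot> g = cid C X" "g \<odot> h = cid C Y"
    using assms iso_obtain by blast
  obtain l where l: "l \<in> H Z Y" "l \<odot> k = cid C Y" "k \<odot> l = cid C Z"
    using assms iso_obtain by blast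
  show ?thesis
  proof (rule isoI)
    show "k \<odot> g \<in> H X Z" "h \<odot> l \<in> H Z X" using assms h l comp_homs by blast+
    have "(h \<odot> l) \<odot> k \<odot> g = h \<odot> ((l \<odot> k) \<odot> g)"
      using assms(2,4) h(1) l(1) by (simp add: arr_simps)
    then show "(h \<odot> l) \<odot> k \<odot> g = cid C X" using assms h l id_left by metis
    have "(k \<odot> g) \<odot> h \<odot> l = k \<odot> ((g \<odot> h) \<odot> l)"
      using assms(2,4) h(1) l(1) by (simp add: arr_simps)
    then show "(k \<odot> g) \<odot> h \<odot> l = cid C Z" using assms h l id_left by metis
  qed
qed

lemma isomorphicI: "iso_arr C g \<Longrightarrow> g \<in> H X Y \<Longrightarrow> isomorphic C X Y"
  unfolding isomorphic_def by blast

lemma isomorphic_trans: "isomorphic C X Y \<Longrightarrow> isomorphic C Y Z \<Longrightarrow> isomorphic C X Z"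
  unfolding isomorphic_def by (metis iso_comp comp_homs)

end

section \<open>Abelian categories\<close>

text \<open>\<open>abelian_category\<close> only asserts that an additive structure exists; one is
  fixed here so that arrows can be added and subtracted.\<close>

locale abcat = abelian_category C for C :: "('o, 'm) cat" (structure) +
  fixes add :: "'m \<Rightarrow> 'm \<Rightarrow> 'm" (infixl \<open>\<boxplus>\<close> 65) and nul :: "'o \<Rightarrow> 'o \<Rightarrow> 'm"
  assumes preadditive: "preadditive_structure C add nul"
    and biproduct_ex: "\<lbrakk>X \<in> cobj C; Y \<in> cobj C\<rbrakk> \<Longrightarrow> \<exists>B. is_biproduct C add nul X Y B"
begin

section \<open>The groups of arrows\<close>

lemma hom_group:
  assumes "X \<in> cobj C" "Y \<in> cobj C"
  shows "comm_group \<lparr>carrier = H X Y, monoid.mult = add, one = nul X Y\<rparr>"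
  using preadditive assms unfolding preadditive_structure_def by blast

lemma nul_homs: assumes "X \<in> cobj C" "Y \<in> cobj C" shows "nul X Y \<in> H X Y"
  using group.is_monoid[OF comm_group.axioms(2)[OF hom_group[OF assms]]] monoid.one_closed by fastforce

lemma nul_homs': "g \<in> H X Y \<Longrightarrow> nul X Y \<in> H X Y"
  using nul_homs homs_obj by blast

lemma add_homs: assumes "x \<in> H X Y" "y \<in> H X Y" shows "x \<boxplus> y \<in> H X Y"
proof -
  interpret G: comm_group "\<lparr>carrier = H X Y, monoid.mult = add, one = nul X Y\<rparr>"
    using hom_group homs_obj[OF assms(1)] by blast
  show ?thesis using G.m_closed[of x y] assms by simp
qed

lemma add_comm: assumes "x \<in> H X Y" "y \<in> H X Y" shows "x \<boxplus> y = y \<boxplus> x"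
proof -
  interpret G: comm_group "\<lparr>carrier = H X Y, monoid.mult = add, one = nul X Y\<rparr>"
    using hom_group homs_obj[OF assms(1)] by blast
  show ?thesis using G.m_comm[of x y] assms by simp
qed

lemma add_ac: assumes "x \<in> H X Y" "y \<in> H X Y" "z \<in> H X Y" shows "x \<boxplus> y \<boxplus> z = x \<boxplus> (y \<boxplus> z)"
proof -
  interpret G: comm_group "\<lparr>carrier = H X Y, monoid.mult = add, one = nul X Y\<rparr>"
    using hom_group homs_obj[OF assms(1)] by blast
  show ?thesis using G.m_assoc[of x y z] assms by simp
qed

lemma add_nul: assumes "x \<in> H X Y" shows "x \<boxplus> nul X Y = x" "nul X Y \<boxplus> x = x"
proof -
  interpret G: comm_group "\<lparr>carrier = H X Y, monoid.mult = add, one = nul X Y\<rparr>"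
    using hom_group homs_obj[OF assms(1)] by blast
  show "x \<boxplus> nul X Y = x" "nul X Y \<boxplus> x = x" using G.r_one[of x] G.l_one[of x] assms by simp_all
qed

lemma neg_obtain: assumes "x \<in> H X Y" obtains y where "y \<in> H X Y" "x \<boxplus> y = nul X Y"
proof -
  interpret G: comm_group "\<lparr>carrier = H X Y, monoid.mult = add, one = nul X Y\<rparr>"
    using hom_group homs_obj[OF assms(1)] by blast
  show ?thesis using that[of "m_inv \<lparr>carrier = H X Y, monoid.mult = add, one = nul X Y\<rparr> x"]
      G.inv_closed[of x] G.r_inv[of x] assms by simp
qed

lemma add_cancel:
  assumes "x \<in> H X Y" "y \<in> H X Y" "z \<in> H X Y" "x \<boxplus> y = x \<boxplus> z" shows "y = z"
proof -
  obtain n where n: "n \<in> H X Y" "x \<boxplus> n = nul X Y" using neg_obtain[OF assms(1)] by blast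
  have nx: "n \<boxplus> x = nul X Y" using n add_comm[OF n(1) assms(1)] by simp
  have "y = n \<boxplus> (x \<boxplus> y)" using add_ac[OF n(1) assms(1,2)] add_nul(2)[OF assms(2)] nx by simp
  also have "\<dots> = z" using add_ac[OF n(1) assms(1,3)] add_nul(2)[OF assms(3)] nx assms(4) by simp
  finally show ?thesis .
qed

lemma distl:
  assumes "h \<in> H Y Z" "g \<in> H X Y" "g' \<in> H X Y" shows "h \<odot> (g \<boxplus> g') = h \<odot> g \<boxplus> h \<odot> g'"
  using preadditive assms homs_obj[OF assms(1)] homs_obj[OF assms(2)]
  unfolding preadditive_structure_def by blast

lemma distr:
  assumes "h \<in> H Y Z" "h' \<in> H Y Z" "g \<in> H X Y" shows "(h \<boxplus> h') \<odot> g = h \<odot> g \<boxplus> h' \<odot> g"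
  using preadditive assms homs_obj[OF assms(1)] homs_obj[OF assms(3)]
  unfolding preadditive_structure_def by blast

lemma comp_nul: assumes "h \<in> H Y Z" "W \<in> cobj C" shows "h \<odot> nul W Y = nul W Z"
proof -
  have n: "nul W Y \<in> H W Y" "nul W Z \<in> H W Z" using assms nul_homs homs_obj[OF assms(1)] by auto
  have "h \<odot> nul W Y \<boxplus> h \<odot> nul W Y = h \<odot> nul W Y \<boxplus> nul W Z"
    using distl[OF assms(1) n(1) n(1)] add_nul n comp_homs[OF n(1) assms(1)] by simp
  then show ?thesis using add_cancel comp_homs[OF n(1) assms(1)] n by blast
qed

lemma nul_comp: assumes "h \<in> H X Y" "Z \<in> cobj C" shows "nul Y Z \<odot> h = nul X Z"
proof -
  have n: "nul Y Z \<in> H Y Z" "nul X Z \<in> H X Z" using assms nul_homs homs_obj[OF assms(1)] by auto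
  have "nul Y Z \<odot> h \<boxplus> nul Y Z \<odot> h = nul Y Z \<odot> h \<boxplus> nul X Z"
    using distr[OF n(1) n(1) assms(1)] add_nul n comp_homs[OF assms(1) n(1)] by simp
  then show ?thesis using add_cancel comp_homs[OF assms(1) n(1)] n by blast
qed

text \<open>Kernels and cokernels are defined with arrows factoring through a zero object; this
  opens them to computations in the groups of arrows.\<close>

lemma zero_arr_iff:
  assumes "g \<in> H X Y" shows "zero_arr C g \<longleftrightarrow> g = nul X Y"
proof
  assume "zero_arr C g"
  then obtain Z u v where z: "zero_object C Z" "u \<in> H X Z" "v \<in> H Z Y" "g = v \<odot> u"
    using assms unfolding zero_arr_def by (auto simp: homs_dom homs_cod)
  have "u = nul X Z"
    using z(1,2) nul_homs homs_obj[OF z(2)] unfolding zero_object_def by metis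
  then show "g = nul X Y" using z comp_nul homs_obj[OF z(2)] by simp
next
  assume g: "g = nul X Y"
  obtain Z where Z: "zero_object C Z" using zero_ex by blast
  then have o: "Z \<in> cobj C" "X \<in> cobj C" "Y \<in> cobj C"
    using homs_obj[OF assms] by (auto simp: zero_object_def)
  have "g = nul Z Y \<odot> nul X Z" using comp_nul[OF nul_homs[OF o(1,3)] o(2)] g by simp
  then show "zero_arr C g"
    using Z nul_homs[OF o(1,3)] nul_homs[OF o(2,1)] homs_carr[OF assms]
    unfolding zero_arr_def homs_dom[OF assms] homs_cod[OF assms] by blast
qed

lemma zero_object_iff: "zero_object C X \<longleftrightarrow> X \<in> cobj C \<and> cid C X = nul X X"
proof
  assume "zero_object C X"
  then show "X \<in> cobj C \<and> cid C X = nul X X"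
    using id_homs nul_homs unfolding zero_object_def by metis
next
  assume X: "X \<in> cobj C \<and> cid C X = nul X X"
  have "g = nul Y X" if "g \<in> H Y X" for g Y
    using id_left[OF that] nul_comp[OF that] X by simp
  moreover have "g = nul X Y" if "g \<in> H X Y" for g Y
    using id_right[OF that] comp_nul[OF that] X by simp
  ultimately show "zero_object C X"
    unfolding zero_object_def using X nul_homs by blast
qed

text \<open>Equality of \<open>u\<close> and \<open>v\<close> is vanishing of their difference; in
  the proof \<open>n\<close> is the negative of \<open>v\<close>.\<close>

lemma monic_iff:
  assumes "m \<in> H Y X"
  shows "monic C m \<longleftrightarrow> (\<forall>W. \<forall>x \<in> H W Y. m \<odot> x = nul W X \<longrightarrow> x = nul W Y)"
proof
  assume "monic C m"
  then show "\<forall>W. \<forall>x \<in> H W Y. m \<odot> x = nul W X \<longrightarrow> x = nul W Y"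
    using monic_cancel[OF _ assms] comp_nul[OF assms] nul_homs' homs_obj by metis
next
  assume z: "\<forall>W. \<forall>x \<in> H W Y. m \<odot> x = nul W X \<longrightarrow> x = nul W Y"
  show "monic C m"
  proof (rule monicI[OF assms])
    fix W u v assume uv: "u \<in> H W Y" "v \<in> H W Y" "m \<odot> u = m \<odot> v"
    obtain n where n: "n \<in> H W Y" "v \<boxplus> n = nul W Y" using neg_obtain uv by blast
    have "m \<odot> (u \<boxplus> n) = m \<odot> (v \<boxplus> n)" using uv n(1) distl[OF assms] by simp
    also have "\<dots> = nul W X" using n comp_nul[OF assms] homs_obj[OF uv(1)] by simp
    finally have "u \<boxplus> n = v \<boxplus> n" using z add_homs[OF uv(1) n(1)] n by metis
    then have "n \<boxplus> u = n \<boxplus> v" using add_comm uv n(1) by metis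
    then show "u = v" using add_cancel uv n(1) by blast
  qed
qed

lemma epic_iff:
  assumes "e \<in> H X Y"
  shows "epic C e \<longleftrightarrow> (\<forall>W. \<forall>x \<in> H Y W. x \<odot> e = nul X W \<longrightarrow> x = nul Y W)"
proof
  assume "epic C e"
  then show "\<forall>W. \<forall>x \<in> H Y W. x \<odot> e = nul X W \<longrightarrow> x = nul Y W"
    using epic_cancel[OF _ assms] nul_comp[OF assms] nul_homs' homs_obj by metis
next
  assume z: "\<forall>W. \<forall>x \<in> H Y W. x \<odot> e = nul X W \<longrightarrow> x = nul Y W"
  show "epic C e"
  proof (rule epicI[OF assms])
    fix W u v assume uv: "u \<in> H Y W" "v \<in> H Y W" "u \<odot> e = v \<odot> e"
    obtain n where n: "n \<in> H Y W" "v \<boxplus> n = nul Y W" using neg_obtain uv by blast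
    have "(u \<boxplus> n) \<odot> e = (v \<boxplus> n) \<odot> e" using uv n(1) distr[OF _ _ assms] by simp
    also have "\<dots> = nul X W" using n nul_comp[OF assms] homs_obj[OF uv(1)] by simp
    finally have "u \<boxplus> n = v \<boxplus> n" using z add_homs[OF uv(1) n(1)] n by metis
    then have "n \<boxplus> u = n \<boxplus> v" using add_comm uv n(1) by metis
    then show "u = v" using add_cancel uv n(1) by blast
  qed
qed

text \<open>Uniqueness of the factorisation is the cancellation property of \<open>k\<close>, so the
  universal property splits into monicity and a membership condition in \<open>el k\<close>.\<close>

lemma is_kernel_iff:
  assumes "g \<in> H X Y"
  shows "is_kernel C k g \<longleftrightarrow> (\<exists>K. k \<in> H K X \<and> monic C k \<and> g \<odot> k = nul K Y \<and>
     (\<forall>W. \<forall>x \<in> H W X. g \<odot> x = nul W Y \<longrightarrow> x \<in> el k))" (is "_ \<longleftrightarrow> ?R")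
proof
  assume k: "is_kernel C k g"
  have kh: "k \<in> H (cdom C k) X" and u: "\<And>h. \<lbrakk>h \<in> carr C; ccod C h = X; zero_arr C (g \<odot> h)\<rbrakk>
      \<Longrightarrow> \<exists>!u. u \<in> H (cdom C h) (cdom C k) \<and> k \<odot> u = h"
    using k assms unfolding is_kernel_def by (auto simp: homs_iff)
  have gk: "g \<odot> k = nul (cdom C k) Y"
    using k zero_arr_iff[OF comp_homs[OF kh assms]] unfolding is_kernel_def by simp
  have z: "zero_arr C (g \<odot> x)" if "x \<in> H W X" "g \<odot> x = nul W Y" for x W
    using zero_arr_iff[OF comp_homs[OF that(1) assms]] that by simp
  have "monic C k"
  proof (rule monicI[OF kh])
    fix W u v assume uv: "u \<in> H W (cdom C k)" "v \<in> H W (cdom C k)" "k \<odot> u = k \<odot> v"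
    have ku: "k \<odot> u \<in> H W X" using comp_homs uv(1) kh by blast
    have "g \<odot> k \<odot> u = (g \<odot> k) \<odot> u" using assoc[OF uv(1) kh assms] by simp
    also have "\<dots> = nul W Y" using gk nul_comp[OF uv(1)] homs_obj[OF assms] by simp
    finally have "zero_arr C (g \<odot> k \<odot> u)" using z[OF ku] by simp
    from u[OF homs_carr[OF ku] homs_cod[OF ku] this] show "u = v"
      using uv homs_dom[OF ku] by metis
  qed
  moreover have "x \<in> el k" if "x \<in> H W X" "g \<odot> x = nul W Y" for x W
    using u[OF homs_carr[OF that(1)] homs_cod[OF that(1)] z[OF that]] homs_dom[OF that(1)]
      mem_el_iff[OF kh] by metis
  ultimately show ?R using kh gk by blast
next
  assume ?R
  then obtain K where K: "k \<in> H K X" "monic C k" "g \<odot> k = nul K Y"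
    "\<And>W x. x \<in> H W X \<Longrightarrow> g \<odot> x = nul W Y \<Longrightarrow> x \<in> el k" by blast
  have "\<exists>!u. u \<in> H (cdom C h) (cdom C k) \<and> k \<odot> u = h"
    if h: "h \<in> carr C" "ccod C h = X" "zero_arr C (g \<odot> h)" for h
  proof -
    have hh: "h \<in> H (cdom C h) X" using h by (simp add: homs_iff)
    have "h \<in> el k" using K(4)[OF hh] zero_arr_iff[OF comp_homs[OF hh assms]] h by simp
    then obtain u where "u \<in> H (cdom C h) K" "h = k \<odot> u" using el_obtain[OF K(1) _ hh] by blast
    then show ?thesis using monic_cancel[OF K(2,1)] homs_dom[OF K(1)] by auto
  qed
  then show "is_kernel C k g"
    unfolding is_kernel_def
    using assms K zero_arr_iff[OF comp_homs[OF K(1) assms]] by (simp add: homs_iff)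
qed

lemma is_cokernel_iff:
  assumes "g \<in> H X Y"
  shows "is_cokernel C q g \<longleftrightarrow> (\<exists>Q. q \<in> H Y Q \<and> epic C q \<and> q \<odot> g = nul X Q \<and>
     (\<forall>W. \<forall>x \<in> H Y W. x \<odot> g = nul X W \<longrightarrow> (\<exists>u \<in> H Q W. x = u \<odot> q)))" (is "_ \<longleftrightarrow> ?R")
proof
  assume k: "is_cokernel C q g"
  have kh: "q \<in> H Y (ccod C q)" and u: "\<And>h. \<lbrakk>h \<in> carr C; cdom C h = Y; zero_arr C (h \<odot> g)\<rbrakk>
      \<Longrightarrow> \<exists>!u. u \<in> H (ccod C q) (ccod C h) \<and> u \<odot> q = h"
    using k assms unfolding is_cokernel_def by (auto simp: homs_iff)
  have gk: "q \<odot> g = nul X (ccod C q)"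
    using k zero_arr_iff[OF comp_homs[OF assms kh]] unfolding is_cokernel_def by simp
  have z: "zero_arr C (x \<odot> g)" if "x \<in> H Y W" "x \<odot> g = nul X W" for x W
    using zero_arr_iff[OF comp_homs[OF assms that(1)]] that by simp
  have "epic C q"
  proof (rule epicI[OF kh])
    fix W u v assume uv: "u \<in> H (ccod C q) W" "v \<in> H (ccod C q) W" "u \<odot> q = v \<odot> q"
    have ku: "u \<odot> q \<in> H Y W" using comp_homs uv(1) kh by blast
    have "(u \<odot> q) \<odot> g = u \<odot> q \<odot> g" using assoc[OF assms kh uv(1)] by simp
    also have "\<dots> = nul X W" using gk comp_nul[OF uv(1)] homs_obj[OF assms] by simp
    finally have "zero_arr C ((u \<odot> q) \<odot> g)" using z[OF ku] by simp
    from u[OF homs_carr[OF ku] homs_dom[OF ku] this] show "u = v"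
      using uv homs_cod[OF ku] by metis
  qed
  moreover have "\<exists>u \<in> H (ccod C q) W. x = u \<odot> q" if "x \<in> H Y W" "x \<odot> g = nul X W" for x W
    using u[OF homs_carr[OF that(1)] homs_dom[OF that(1)] z[OF that]] homs_cod[OF that(1)]
    by metis
  ultimately show ?R using kh gk by blast
next
  assume ?R
  then obtain Q where K: "q \<in> H Y Q" "epic C q" "q \<odot> g = nul X Q"
    "\<And>W x. x \<in> H Y W \<Longrightarrow> x \<odot> g = nul X W \<Longrightarrow> \<exists>u \<in> H Q W. x = u \<odot> q" by blast
  have "\<exists>!u. u \<in> H (ccod C q) (ccod C h) \<and> u \<odot> q = h"
    if h: "h \<in> carr C" "cdom C h = Y" "zero_arr C (h \<odot> g)" for h
  proof -
    have hh: "h \<in> H Y (ccod C h)" using h by (simp add: homs_iff)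
    have "\<exists>u \<in> H Q (ccod C h). h = u \<odot> q"
      using K(4)[OF hh] zero_arr_iff[OF comp_homs[OF assms hh]] h by simp
    then show ?thesis using epic_cancel[OF K(2,1)] homs_cod[OF K(1)] by auto
  qed
  then show "is_cokernel C q g"
    unfolding is_cokernel_def
    using assms K zero_arr_iff[OF comp_homs[OF assms K(1)]] by (simp add: homs_iff)
qed

lemma kernel_obtain:
  assumes "g \<in> H X Y"
  obtains K k where "k \<in> H K X" "monic C k" "g \<odot> k = nul K Y"
    "\<And>W x. x \<in> H W X \<Longrightarrow> g \<odot> x = nul W Y \<Longrightarrow> x \<in> el k" "is_kernel C k g"
  using kernel_ex[OF homs_carr[OF assms]] is_kernel_iff[OF assms] by metis

lemma cokernel_obtain:
  assumes "g \<in> H X Y"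
  obtains Q q where "q \<in> H Y Q" "epic C q" "q \<odot> g = nul X Q"
    "\<And>W x. x \<in> H Y W \<Longrightarrow> x \<odot> g = nul X W \<Longrightarrow> \<exists>u \<in> H Q W. x = u \<odot> q" "is_cokernel C q g"
  using cokernel_ex[OF homs_carr[OF assms]] is_cokernel_iff[OF assms] by metis

text \<open>\<open>m\<close> is the kernel of some \<open>c\<close>. Since \<open>c\<close> kills
  \<open>m\<close>, it factors through the cokernel \<open>q\<close>, so every arrow killed by
  \<open>q\<close> is killed by \<open>c\<close> and hence factors through \<open>m\<close>.\<close>

lemma monic_kernel_of_cokernel:
  assumes m: "monic C m" "m \<in> H Y X" and q: "is_cokernel C q m"
  shows "is_kernel C m q"
proof -
  obtain Q where Q: "q \<in> H X Q" "epic C q" "q \<odot> m = nul Y Q"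
    "\<And>W x. x \<in> H X W \<Longrightarrow> x \<odot> m = nul Y W \<Longrightarrow> \<exists>u \<in> H Q W. x = u \<odot> q"
    using q is_cokernel_iff[OF m(2)] by metis
  obtain c where c: "is_kernel C m c" using monic_normal m by blast
  define Z where "Z = ccod C c"
  have ch: "c \<in> H X Z" using c m unfolding is_kernel_def Z_def by (auto simp: homs_iff)
  have c2: "c \<odot> m = nul Y Z" "\<And>W x. x \<in> H W X \<Longrightarrow> c \<odot> x = nul W Z \<Longrightarrow> x \<in> el m"
    using c is_kernel_iff[OF ch] m homs_dom by metis+
  obtain u where u: "u \<in> H Q Z" "c = u \<odot> q" using Q(4)[OF ch c2(1)] by blast
  have "x \<in> el m" if "x \<in> H W X" "q \<odot> x = nul W Q" for W x
    using c2(2)[OF that(1)] u(2) assoc[OF that(1) Q(1) u(1)] that comp_nul[OF u(1)] homs_obj by metis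
  then show ?thesis using is_kernel_iff[OF Q(1)] Q m by blast
qed

text \<open>An epimorphism is the cokernel of some \<open>h\<close>, and \<open>x\<close> kills this
  \<open>h\<close> because \<open>e\<close> does.\<close>

lemma epic_factor:
  assumes e: "epic C e" "e \<in> H X Y" and x: "x \<in> H X W"
    and z: "\<And>V h. h \<in> H V X \<Longrightarrow> e \<odot> h = nul V Y \<Longrightarrow> x \<odot> h = nul V W"
  shows "\<exists>u \<in> H Y W. x = u \<odot> e"
proof -
  obtain h where h: "is_cokernel C e h" using epic_normal e by blast
  define V where "V = cdom C h"
  have hh: "h \<in> H V X" using h e unfolding is_cokernel_def V_def by (auto simp: homs_iff)
  have "e \<odot> h = nul V Y" "\<forall>W. \<forall>x \<in> H X W. x \<odot> h = nul V W \<longrightarrow> (\<exists>u \<in> H Y W. x = u \<odot> e)"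
    using h is_cokernel_iff[OF hh] e(2) homs_cod by metis+
  then show ?thesis using z[OF hh] x by blast
qed

text \<open>Factoring the identity through \<open>m\<close> by \<open>epic_factor\<close> yields a
  left inverse; cancelling the epimorphism \<open>m\<close> makes it two-sided.\<close>

lemma monic_epic_iso:
  assumes "monic C m" "epic C m" "m \<in> H X Y"
  shows "iso_arr C m"
proof -
  have "\<exists>u \<in> H Y X. cid C X = u \<odot> m"
  proof (rule epic_factor[OF assms(2,3)])
    show "cid C X \<in> H X X" using id_homs homs_obj assms by blast
    fix V h assume h: "h \<in> H V X" "m \<odot> h = nul V Y"
    then have "h = nul V X" using monic_iff[OF assms(3)] assms(1) by blast
    then show "cid C X \<odot> h = nul V X" using id_left h by metis
  qed
  then obtain u where u: "u \<in> H Y X" "u \<odot> m = cid C X" by auto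
  have "(m \<odot> u) \<odot> m = cid C Y \<odot> m"
    using assoc[OF assms(3) u(1) assms(3)] u(2) id_right[OF assms(3)] id_left[OF assms(3)] by simp
  then have "m \<odot> u = cid C Y"
    using epic_cancel[OF assms(2,3) comp_homs[OF u(1) assms(3)] id_homs] homs_obj[OF assms(3)] by blast
  then show ?thesis using isoI[OF assms(3) u] by simp
qed

lemma is_image_factor:
  assumes g: "g \<in> H X Y" and im: "is_image C m g"
  shows "\<exists>I e. m \<in> H I Y \<and> monic C m \<and> e \<in> H X I \<and> epic C e \<and> g = m \<odot> e"
proof -
  obtain q where q: "is_cokernel C q g" "is_kernel C m q" using im unfolding is_image_def by blast
  obtain Q where Q: "q \<in> H Y Q" "epic C q" "q \<odot> g = nul X Q"
    "\<And>W x. x \<in> H Y W \<Longrightarrow> x \<odot> g = nul X W \<Longrightarrow> \<exists>u \<in> H Q W. x = u \<odot> q"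
    using q is_cokernel_iff[OF g] by metis
  obtain I where I: "m \<in> H I Y" "monic C m" "q \<odot> m = nul I Q"
    "\<And>W x. x \<in> H W Y \<Longrightarrow> q \<odot> x = nul W Q \<Longrightarrow> x \<in> el m"
    using q is_kernel_iff[OF Q(1)] by metis
  obtain e where e: "e \<in> H X I" "g = m \<odot> e" using el_obtain[OF I(1) I(4)[OF g Q(3)] g] by blast
  \<comment> \<open>If \<open>u\<close> kills \<open>e\<close>, then \<open>g\<close> factors
    through \<open>m \<odot> k\<close> with \<open>k\<close> the kernel of \<open>u\<close>. This
    monomorphism is the kernel of its cokernel \<open>r\<close>, and \<open>r\<close> kills
    \<open>g\<close>, so \<open>r\<close> factors through \<open>q\<close> and kills
    \<open>m\<close>. Hence \<open>m\<close> factors through \<open>m \<odot> k\<close>, which gives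
    \<open>k\<close> a right inverse and forces \<open>u\<close> to vanish.\<close>
  have "epic C e"
  proof (subst epic_iff[OF e(1)], intro allI ballI impI)
    fix W u assume u: "u \<in> H I W" "u \<odot> e = nul X W"
    obtain K k where k: "k \<in> H K I" "monic C k" "u \<odot> k = nul K W"
      "\<And>V x. x \<in> H V I \<Longrightarrow> u \<odot> x = nul V W \<Longrightarrow> x \<in> el k" using kernel_obtain[OF u(1)] by metis
    obtain e' where e': "e' \<in> H X K" "e = k \<odot> e'" using el_obtain[OF k(1) k(4)[OF e(1) u(2)] e(1)] by blast
    have mk: "m \<odot> k \<in> H K Y" "monic C (m \<odot> k)" using comp_homs k(1) I(1) monic_comp I k by blast+
    obtain R r where r: "is_cokernel C r (m \<odot> k)" "r \<in> H Y R" "r \<odot> m \<odot> k = nul K R"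
      using cokernel_obtain[OF mk(1)] by metis
    have "is_kernel C (m \<odot> k) r" using monic_kernel_of_cokernel[OF mk(2,1) r(1)] .
    then have rk: "\<And>V x. x \<in> H V Y \<Longrightarrow> r \<odot> x = nul V R \<Longrightarrow> x \<in> el (m \<odot> k)"
      using is_kernel_iff[OF r(2)] by metis
    have "r \<odot> g = (r \<odot> m \<odot> k) \<odot> e'"
      using e e' k(1) I(1) r(2) by (simp add: arr_simps)
    then have "r \<odot> g = nul X R" using r(3) nul_comp[OF e'(1)] homs_obj[OF r(2)] by simp
    then obtain s where s: "s \<in> H Q R" "r = s \<odot> q" using Q(4)[OF r(2)] by blast
    have "r \<odot> m = s \<odot> q \<odot> m" using s I(1) Q(1) by (simp add: arr_simps)
    then have "r \<odot> m = nul I R" using I(3) comp_nul[OF s(1)] homs_obj[OF I(1)] by simp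
    then have "m \<in> el (m \<odot> k)" using rk[OF I(1)] by simp
    then obtain t where t: "t \<in> H I K" "m = (m \<odot> k) \<odot> t" using el_obtain[OF mk(1) _ I(1)] by blast
    have "m \<odot> cid C I = m \<odot> k \<odot> t" using t I(1) k(1) id_right[OF I(1)] by (simp add: arr_simps)
    then have "cid C I = k \<odot> t"
      using monic_cancel[OF I(2,1) id_homs comp_homs[OF t(1) k(1)]] homs_obj[OF I(1)] by blast
    then have "u = (u \<odot> k) \<odot> t" using id_right[OF u(1)] assoc[OF t(1) k(1) u(1)] by simp
    then show "u = nul I W" using k(3) nul_comp[OF t(1)] homs_obj[OF u(1)] by simp
  qed
  then show ?thesis using I e by blast
qed

lemma image_exists: assumes "g \<in> H X Y" shows "\<exists>m. is_image C m g"
proof -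
  obtain Q q where q: "q \<in> H Y Q" "is_cokernel C q g" using cokernel_obtain[OF assms] by metis
  then show ?thesis unfolding is_image_def using kernel_obtain[OF q(1)] by metis
qed

lemma image_obtain:
  assumes "g \<in> H X Y"
  obtains I m e where "m \<in> H I Y" "monic C m" "e \<in> H X I" "epic C e" "g = m \<odot> e"
  using is_image_factor[OF assms] image_exists[OF assms] by metis

section \<open>Biproducts and pullbacks of epimorphisms\<close>

lemma biproduct_obtain:
  assumes "X \<in> cobj C" "Y \<in> cobj C"
  obtains B i j p q where "i \<in> H X B" "j \<in> H Y B" "p \<in> H B X" "q \<in> H B Y"
    "p \<odot> i = cid C X" "q \<odot> j = cid C Y" "p \<odot> j = nul Y X" "q \<odot> i = nul X Y"
    "i \<odot> p \<boxplus> j \<odot> q = cid C B"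
  using biproduct_ex[OF assms] unfolding is_biproduct_def by blast

text \<open>Allows domains to be refined: an arrow into \<open>Y\<close> lifts to \<open>W\<close>
  after precomposition with an epimorphism. The pullback is built as the kernel of the difference of
  the two maps on the biproduct.\<close>

lemma epic_pullback:
  assumes p: "epic C p" "p \<in> H W Y" and g: "g \<in> H X Y"
  obtains V p' g' where "p' \<in> H V X" "epic C p'" "g' \<in> H V W" "p \<odot> g' = g \<odot> p'"
proof -
  obtain B i j a b where B: "i \<in> H W B" "j \<in> H X B" "a \<in> H B W" "b \<in> H B X"
    "a \<odot> i = cid C W" "b \<odot> j = cid C X" "a \<odot> j = nul X W" "b \<odot> i = nul W X"
    "i \<odot> a \<boxplus> j \<odot> b = cid C B"
    using biproduct_obtain homs_obj[OF p(2)] homs_obj[OF g] by metis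
  obtain n where n: "n \<in> H X Y" "g \<boxplus> n = nul X Y" using neg_obtain[OF g] by blast
  have o: "W \<in> cobj C" "X \<in> cobj C" "Y \<in> cobj C" "B \<in> cobj C"
    using homs_obj[OF p(2)] homs_obj[OF g] homs_obj[OF B(1)] by auto
  \<comment> \<open>\<open>n\<close> is the negative of \<open>g\<close>, so \<open>d\<close> is the
    difference of \<open>p \<odot> a\<close> and \<open>g \<odot> b\<close>.\<close>
  define d where "d = p \<odot> a \<boxplus> n \<odot> b"
  have pa: "p \<odot> a \<in> H B Y" "n \<odot> b \<in> H B Y" using comp_homs p(2) B(3,4) n(1) by blast+
  have d: "d \<in> H B Y" unfolding d_def using add_homs pa by blast
  have di: "d \<odot> i = p"
  proof -
    have "d \<odot> i = (p \<odot> a) \<odot> i \<boxplus> (n \<odot> b) \<odot> i" unfolding d_def using distr[OF pa B(1)] .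
    also have "(p \<odot> a) \<odot> i = p" using assoc[OF B(1,3) p(2)] B id_right[OF p(2)] by simp
    also have "(n \<odot> b) \<odot> i = nul W Y" using assoc[OF B(1,4) n(1)] B comp_nul[OF n(1)] o by simp
    finally show ?thesis using add_nul p by simp
  qed
  obtain V k where k: "k \<in> H V B" "d \<odot> k = nul V Y"
    "\<And>U x. x \<in> H U B \<Longrightarrow> d \<odot> x = nul U Y \<Longrightarrow> x \<in> el k" using kernel_obtain[OF d] by metis
  have bk: "b \<odot> k \<in> H V X" "a \<odot> k \<in> H V W" using comp_homs k(1) B(3,4) by blast+
  have ed: "epic C d"
  proof (subst epic_iff[OF d], intro allI ballI impI)
    fix U u assume u: "u \<in> H Y U" "u \<odot> d = nul B U"
    have "u \<odot> p = (u \<odot> d) \<odot> i" using di assoc[OF B(1) d u(1)] by simp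
    then have "u \<odot> p = nul W U" using u nul_comp[OF B(1)] homs_obj[OF u(1)] by simp
    then show "u = nul Y U" using p epic_iff u by blast
  qed
  have "epic C (b \<odot> k)"
  proof (subst epic_iff[OF bk(1)], intro allI ballI impI)
    fix U u assume u: "u \<in> H X U" "u \<odot> b \<odot> k = nul V U"
    have ub: "u \<odot> b \<in> H B U" using comp_homs[OF B(4) u(1)] .
    \<comment> \<open>\<open>u \<odot> b\<close> kills the kernel of \<open>d\<close>, hence factors
      through the epimorphism \<open>d\<close>. Restriction to the summand \<open>W\<close> then
      shows that the factor \<open>v\<close> kills \<open>p\<close>, so \<open>v\<close>
      vanishes.\<close>
    have "\<exists>v \<in> H Y U. u \<odot> b = v \<odot> d"
    proof (rule epic_factor[OF ed d ub])
      fix T h assume h: "h \<in> H T B" "d \<odot> h = nul T Y"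
      obtain l where l: "l \<in> H T V" "h = k \<odot> l" using el_obtain[OF k(1) k(3)[OF h] h(1)] by blast
      have "(u \<odot> b) \<odot> h = (u \<odot> b \<odot> k) \<odot> l" using l k(1) u(1) B(4) by (simp add: arr_simps)
      then show "(u \<odot> b) \<odot> h = nul T U" using u nul_comp[OF l(1)] homs_obj[OF u(1)] by simp
    qed
    then obtain v where v: "v \<in> H Y U" "u \<odot> b = v \<odot> d" by blast
    have "v \<odot> p = (u \<odot> b) \<odot> i" using di v assoc[OF B(1) d v(1)] by simp
    also have "\<dots> = nul W U" using assoc[OF B(1,4) u(1)] B comp_nul[OF u(1)] o by simp
    finally have "v = nul Y U" using p epic_iff v by blast
    then have "u \<odot> b = nul B U" using v nul_comp[OF d] homs_obj[OF u(1)] by simp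
    moreover have "u = (u \<odot> b) \<odot> j" using assoc[OF B(2,4) u(1)] B id_right[OF u(1)] by simp
    ultimately show "u = nul X U" using nul_comp[OF B(2)] homs_obj[OF u(1)] by simp
  qed
  moreover have "p \<odot> a \<odot> k = g \<odot> b \<odot> k"
  proof -
    have h: "p \<odot> a \<odot> k \<in> H V Y" "n \<odot> b \<odot> k \<in> H V Y" "g \<odot> b \<odot> k \<in> H V Y"
      using comp_homs bk p(2) n(1) g by blast+
    have "p \<odot> a \<odot> k \<boxplus> n \<odot> b \<odot> k = nul V Y"
      using k(2) distr[OF pa k(1)] assoc[OF k(1) B(3) p(2)] assoc[OF k(1) B(4) n(1)]
      unfolding d_def by simp
    moreover have "g \<odot> b \<odot> k \<boxplus> n \<odot> b \<odot> k = nul V Y"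
      using distr[OF g n(1) bk(1)] n(2) nul_comp[OF bk(1)] o by simp
    ultimately have "n \<odot> b \<odot> k \<boxplus> p \<odot> a \<odot> k = n \<odot> b \<odot> k \<boxplus> g \<odot> b \<odot> k"
      using add_comm h by metis
    then show ?thesis using add_cancel h by blast
  qed
  ultimately show ?thesis using that[OF bk(1) _ bk(2)] by blast
qed

section \<open>The modular lattice of subobjects\<close>

definition pull :: "'m \<Rightarrow> 'm set \<Rightarrow> 'm set" where
  "pull g A = {x. \<exists>W. x \<in> H W (cdom C g) \<and> g \<odot> x \<in> A}"

text \<open>The epimorphism \<open>p\<close> is there because an arrow into an image lifts to the
  source only after a refinement of its domain. In \<open>join\<close> it has the same
  purpose.\<close>

definition push :: "'m \<Rightarrow> 'm set \<Rightarrow> 'm set" where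
  "push g A = {y. \<exists>W V p x. y \<in> H W (ccod C g) \<and> epic C p \<and> p \<in> H V W \<and>
     x \<in> A \<and> x \<in> H V (cdom C g) \<and> y \<odot> p = g \<odot> x}"

definition join :: "'o \<Rightarrow> 'm set \<Rightarrow> 'm set \<Rightarrow> 'm set" where
  "join X A B = {z. \<exists>W V p x y. z \<in> H W X \<and> epic C p \<and> p \<in> H V W \<and>
     x \<in> A \<and> x \<in> H V X \<and> y \<in> B \<and> y \<in> H V X \<and> z \<odot> p = x \<boxplus> y}"

definition tp :: "'o \<Rightarrow> 'm set" where
  "tp X = {x. \<exists>W. x \<in> H W X}"

definition bt :: "'o \<Rightarrow> 'm set" where
  "bt X = {x. \<exists>W. x \<in> H W X \<and> x = nul W X}"

lemma mem_pull: "g \<in> H X Y \<Longrightarrow> x \<in> H W X \<Longrightarrow> x \<in> pull g A \<longleftrightarrow> g \<odot> x \<in> A"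
  unfolding pull_def by (auto simp: homs_dom)

lemma mem_bt: "x \<in> H W X \<Longrightarrow> x \<in> bt X \<longleftrightarrow> x = nul W X"
  unfolding bt_def by (auto simp: homs_iff)

lemma mem_tp: "x \<in> H W X \<Longrightarrow> x \<in> tp X"
  unfolding tp_def by blast

lemma mem_push:
  assumes "g \<in> H X Y" "y \<in> H W Y"
  shows "y \<in> push g A \<longleftrightarrow> (\<exists>V p x. epic C p \<and> p \<in> H V W \<and> x \<in> A \<and> x \<in> H V X \<and> y \<odot> p = g \<odot> x)"
  using assms unfolding push_def by (auto simp: homs_dom homs_cod) (auto simp: homs_iff)

lemma mem_join:
  assumes "z \<in> H W X"
  shows "z \<in> join X A B \<longleftrightarrow> (\<exists>V p x y. epic C p \<and> p \<in> H V W \<and> x \<in> A \<and> x \<in> H V X \<and>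
     y \<in> B \<and> y \<in> H V X \<and> z \<odot> p = x \<boxplus> y)"
  using assms unfolding join_def by (auto simp: homs_dom) (auto simp: homs_iff)

lemma joinI:
  "\<lbrakk>z \<in> H W X; epic C p; p \<in> H V W; x \<in> A; x \<in> H V X; y \<in> B; y \<in> H V X; z \<odot> p = x \<boxplus> y\<rbrakk>
    \<Longrightarrow> z \<in> join X A B"
  unfolding join_def by blast

lemma subs_subsetI:
  assumes "A \<in> subs X" "\<And>W x. x \<in> H W X \<Longrightarrow> x \<in> A \<Longrightarrow> x \<in> B" shows "A \<subseteq> B"
  using assms subs_homs by blast

lemma subs_eqI:
  assumes "A \<in> subs X" "B \<in> subs X" "\<And>W x. x \<in> H W X \<Longrightarrow> x \<in> A \<longleftrightarrow> x \<in> B" shows "A = B"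
  using assms subs_homs by blast

lemma subs_obj: "A \<in> subs X \<Longrightarrow> X \<in> cobj C"
  using subs_obtain homs_obj by metis

lemma subs_kernelI:
  assumes "c \<in> H X Z" shows "{x. \<exists>W. x \<in> H W X \<and> c \<odot> x = nul W Z} \<in> subs X"
proof -
  obtain K k where k: "k \<in> H K X" "monic C k" "c \<odot> k = nul K Z"
    "\<And>W x. x \<in> H W X \<Longrightarrow> c \<odot> x = nul W Z \<Longrightarrow> x \<in> el k" using kernel_obtain[OF assms] by metis
  have "{x. \<exists>W. x \<in> H W X \<and> c \<odot> x = nul W Z} = el k"
  proof (intro equalityI subsetI)
    fix x assume "x \<in> el k"
    then obtain W h where h: "h \<in> H W K" "x = k \<odot> h" using mem_el_iff[OF k(1)] by blast
    then have "c \<odot> x = nul W Z"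
      using assoc[OF h(1) k(1) assms] k(3) nul_comp[OF h(1)] homs_obj[OF assms] by simp
    then show "x \<in> {x. \<exists>W. x \<in> H W X \<and> c \<odot> x = nul W Z}" using comp_homs h k(1) by blast
  qed (use k in blast)
  then show ?thesis using subsI[OF k(1,2)] by simp
qed

text \<open>A subobject is the kernel of its cokernel, so membership becomes a linear equation.
  Closure under sums and differences and descent along epimorphisms are read off from it.\<close>

lemma subs_kernel_obtain:
  assumes "A \<in> subs X"
  obtains Z c where "c \<in> H X Z" "epic C c" "\<And>W x. x \<in> H W X \<Longrightarrow> x \<in> A \<longleftrightarrow> c \<odot> x = nul W Z"
proof -
  obtain Y m where m: "m \<in> H Y X" "monic C m" "A = el m" using subs_obtain[OF assms] by metis
  obtain Q q where q: "q \<in> H X Q" "epic C q" "is_cokernel C q m" using cokernel_obtain[OF m(1)] by metis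
  have "is_kernel C m q" using monic_kernel_of_cokernel[OF m(2,1) q(3)] .
  then have k: "q \<odot> m = nul Y Q" "\<And>W x. x \<in> H W X \<Longrightarrow> q \<odot> x = nul W Q \<Longrightarrow> x \<in> el m"
    using is_kernel_iff[OF q(1)] homs_dom[OF m(1)] by (auto dest: homs_dom)
  have "q \<odot> x = nul W Q" if x: "x \<in> H W X" "x \<in> el m" for W x
  proof -
    obtain h where h: "h \<in> H W Y" "x = m \<odot> h" using el_obtain[OF m(1) x(2,1)] by blast
    then show ?thesis using assoc[OF h(1) m(1) q(1)] k(1) nul_comp[OF h(1)] homs_obj[OF q(1)] by simp
  qed
  then show ?thesis using that[OF q(1,2)] k(2) m(3) by blast
qed

text \<open>\<open>c \<odot> z\<close> vanishes once it vanishes after the epimorphism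
  \<open>p\<close>. This converse of closure under precomposition lets witnesses be used that exist
  only after a refinement.\<close>

lemma subs_local:
  assumes "A \<in> subs X" "z \<in> H W X" "epic C p" "p \<in> H V W" "z \<odot> p \<in> A" shows "z \<in> A"
proof -
  obtain Z c where c: "c \<in> H X Z" "\<And>W x. x \<in> H W X \<Longrightarrow> x \<in> A \<longleftrightarrow> c \<odot> x = nul W Z"
    using subs_kernel_obtain[OF assms(1)] by metis
  have "(c \<odot> z) \<odot> p = nul V Z"
    using c(2)[OF comp_homs[OF assms(4,2)]] assms(5) assoc[OF assms(4,2) c(1)] by simp
  then have "c \<odot> z = nul W Z" using epic_iff[OF assms(4)] assms(3) comp_homs[OF assms(2) c(1)] by blast
  then show ?thesis using c(2)[OF assms(2)] by simp
qed

lemma subs_nul: assumes "A \<in> subs X" "W \<in> cobj C" shows "nul W X \<in> A"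
proof -
  obtain Z c where c: "c \<in> H X Z" "\<And>W x. x \<in> H W X \<Longrightarrow> x \<in> A \<longleftrightarrow> c \<odot> x = nul W Z"
    using subs_kernel_obtain[OF assms(1)] by metis
  show ?thesis using c(2)[OF nul_homs[OF assms(2)]] comp_nul[OF c(1) assms(2)] subs_obj[OF assms(1)] by simp
qed

lemma subs_add:
  assumes "A \<in> subs X" "x \<in> H W X" "y \<in> H W X" "x \<in> A" "y \<in> A" shows "x \<boxplus> y \<in> A"
proof -
  obtain Z c where c: "c \<in> H X Z" "\<And>W x. x \<in> H W X \<Longrightarrow> x \<in> A \<longleftrightarrow> c \<odot> x = nul W Z"
    using subs_kernel_obtain[OF assms(1)] by metis
  show ?thesis
    using assms distl[OF c(1) assms(2,3)] c(2) add_homs[OF assms(2,3)] add_nul comp_homs[OF assms(2) c(1)]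
    by simp
qed

lemma subs_diff:
  assumes "A \<in> subs X" "x \<in> H W X" "y \<in> H W X" "x \<in> A" "x \<boxplus> y \<in> A" shows "y \<in> A"
proof -
  obtain Z c where c: "c \<in> H X Z" "\<And>W x. x \<in> H W X \<Longrightarrow> x \<in> A \<longleftrightarrow> c \<odot> x = nul W Z"
    using subs_kernel_obtain[OF assms(1)] by metis
  show ?thesis
    using assms distl[OF c(1) assms(2,3)] c(2) add_homs[OF assms(2,3)]
      add_nul(2)[OF comp_homs[OF assms(3) c(1)]] by simp
qed

lemma subs_diff': 
  assumes "A \<in> subs X" "x \<in> H W X" "y \<in> H W X" "y \<in> A" "x \<boxplus> y \<in> A" shows "x \<in> A"
  using subs_diff[OF assms(1,3,2,4)] add_comm[OF assms(2,3)] assms(5) by simp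

lemma tp_subs: "X \<in> cobj C \<Longrightarrow> tp X \<in> subs X"
proof -
  assume X: "X \<in> cobj C"
  have "tp X = el (cid C X)"
    unfolding tp_def using mem_el_iff[OF id_homs[OF X]] id_left by (auto simp: set_eq_iff)
  then show ?thesis using subsI id_homs id_monic X by metis
qed

lemma bt_subs: assumes "X \<in> cobj C" shows "bt X \<in> subs X"
proof -
  have "bt X = {x. \<exists>W. x \<in> H W X \<and> cid C X \<odot> x = nul W X}"
    unfolding bt_def using id_left by auto
  then show ?thesis using subs_kernelI[OF id_homs[OF assms]] by simp
qed

lemma bt_subset: "A \<in> subs X \<Longrightarrow> bt X \<subseteq> A"
  unfolding bt_def using subs_nul homs_obj by auto

lemma subset_tp: "A \<in> subs X \<Longrightarrow> A \<subseteq> tp X"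
  unfolding tp_def using subs_homs by blast

lemma pull_subs: assumes "g \<in> H X Y" "A \<in> subs Y" shows "pull g A \<in> subs X"
proof -
  obtain Z c where c: "c \<in> H Y Z" "\<And>W x. x \<in> H W Y \<Longrightarrow> x \<in> A \<longleftrightarrow> c \<odot> x = nul W Z"
    using subs_kernel_obtain[OF assms(2)] by metis
  have "x \<in> H W X \<Longrightarrow> g \<odot> x \<in> A \<longleftrightarrow> (c \<odot> g) \<odot> x = nul W Z" for x W
    using c comp_homs[OF _ assms(1)] assoc[OF _ assms(1) c(1)] by metis
  then have "pull g A = {x. \<exists>W. x \<in> H W X \<and> (c \<odot> g) \<odot> x = nul W Z}"
    unfolding pull_def homs_dom[OF assms(1)] by blast
  then show ?thesis using subs_kernelI[OF comp_homs[OF assms(1) c(1)]] by simp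
qed

lemma subs_pull_obtain:
  assumes "A \<in> subs X"
  obtains Z c where "c \<in> H X Z" "epic C c" "A = pull c (bt Z)"
proof -
  obtain Z c where c: "c \<in> H X Z" "epic C c" "\<And>W x. x \<in> H W X \<Longrightarrow> x \<in> A \<longleftrightarrow> c \<odot> x = nul W Z"
    using subs_kernel_obtain[OF assms] by metis
  have Z: "Z \<in> cobj C" using homs_obj c by blast
  have "A = pull c (bt Z)"
  proof (rule subs_eqI[OF assms pull_subs[OF c(1) bt_subs[OF Z]]])
    fix W x assume x: "x \<in> H W X"
    show "x \<in> A \<longleftrightarrow> x \<in> pull c (bt Z)"
      using c(3)[OF x] mem_pull[OF c(1) x] mem_bt[OF comp_homs[OF x c(1)]] by simp
  qed
  then show ?thesis using that c(1,2) by blast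
qed

text \<open>The intersection is represented by \<open>m \<odot> n\<close>, where \<open>n\<close>
  represents the preimage of \<open>B\<close> under \<open>m\<close>.\<close>

lemma inter_subs: assumes "A \<in> subs X" "B \<in> subs X" shows "A \<inter> B \<in> subs X"
proof -
  obtain Y m where m: "m \<in> H Y X" "monic C m" "A = el m" using subs_obtain[OF assms(1)] by metis
  obtain Z n where n: "n \<in> H Z Y" "monic C n" "pull m B = el n"
    using subs_obtain[OF pull_subs[OF m(1) assms(2)]] by metis
  have mn: "m \<odot> n \<in> H Z X" using comp_homs[OF n(1) m(1)] .
  have "A \<inter> B = el (m \<odot> n)"
  proof (intro equalityI subsetI)
    fix x assume x: "x \<in> A \<inter> B"
    then obtain W where xh: "x \<in> H W X" using subs_homs assms by blast
    obtain h where h: "h \<in> H W Y" "x = m \<odot> h" using el_obtain[OF m(1) _ xh] x m(3) by blast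
    then have "h \<in> el n" using mem_pull[OF m(1) h(1)] n(3) x by blast
    then obtain k where k: "k \<in> H W Z" "h = n \<odot> k" using el_obtain[OF n(1) _ h(1)] by blast
    then have "x = (m \<odot> n) \<odot> k" using h assoc[OF k(1) n(1) m(1)] by simp
    then show "x \<in> el (m \<odot> n)" using mem_el_iff[OF mn] k by blast
  next
    fix x assume "x \<in> el (m \<odot> n)"
    then obtain W k where k: "k \<in> H W Z" "x = (m \<odot> n) \<odot> k" using mem_el_iff[OF mn] by blast
    have nk: "n \<odot> k \<in> H W Y" "n \<odot> k \<in> el n" using comp_homs[OF k(1) n(1)] el_comp[OF n(1) k(1)] by auto
    have x: "x = m \<odot> n \<odot> k" using k assoc[OF k(1) n(1) m(1)] by simp
    then show "x \<in> A \<inter> B" using m(3) el_comp[OF m(1) nk(1)] mem_pull[OF m(1) nk(1)] nk n(3) by blast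
  qed
  then show ?thesis using subsI[OF mn monic_comp[OF m(2,1) n(2,1)]] by simp
qed

text \<open>Identifies the elementwise image with the categorical one. Lifting an arrow into
  \<open>I\<close> back to \<open>Y\<close> takes the pullback of the epimorphism
  \<open>e\<close>.\<close>

lemma push_el:
  assumes "a \<in> H Y X" "g \<in> H X Z" "m \<in> H I Z" "monic C m" "e \<in> H Y I" "epic C e" "g \<odot> a = m \<odot> e"
  shows "push g (el a) = el m"
proof (intro equalityI subsetI)
  fix y assume "y \<in> push g (el a)"
  then obtain W V p x where y: "y \<in> H W Z" "epic C p" "p \<in> H V W" "x \<in> el a" "x \<in> H V X" "y \<odot> p = g \<odot> x"
    unfolding push_def homs_cod[OF assms(2)] homs_dom[OF assms(2)] by blast
  obtain h where h: "h \<in> H V Y" "x = a \<odot> h" using el_obtain[OF assms(1) y(4,5)] by blast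
  have "y \<odot> p = (g \<odot> a) \<odot> h" using y h assoc[OF h(1) assms(1,2)] by simp
  also have "\<dots> = m \<odot> e \<odot> h" using assms(7) assoc[OF h(1) assms(5,3)] by simp
  finally have "y \<odot> p \<in> el m" using el_comp[OF assms(3) comp_homs[OF h(1) assms(5)]] by simp
  then show "y \<in> el m" using subs_local[OF subsI[OF assms(3,4)] y(1,2,3)] by simp
next
  fix y assume "y \<in> el m"
  then obtain W h where h: "h \<in> H W I" "y = m \<odot> h" using mem_el_iff[OF assms(3)] by blast
  obtain V p k where p: "p \<in> H V W" "epic C p" "k \<in> H V Y" "e \<odot> k = h \<odot> p"
    using epic_pullback[OF assms(6,5) h(1)] by metis
  have "y \<odot> p = g \<odot> a \<odot> k"
  proof -
    have "y \<odot> p = m \<odot> e \<odot> k" using h p assoc[OF p(1) h(1) assms(3)] by simp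
    also have "\<dots> = (m \<odot> e) \<odot> k" using assoc[OF p(3) assms(5,3)] by simp
    also have "\<dots> = (g \<odot> a) \<odot> k" using assms(7) by simp
    also have "\<dots> = g \<odot> a \<odot> k" using assoc[OF p(3) assms(1,2)] by simp
    finally show ?thesis .
  qed
  moreover have "y \<in> H W Z" using h comp_homs[OF _ assms(3)] by blast
  ultimately show "y \<in> push g (el a)"
    using mem_push[OF assms(2)] p el_comp[OF assms(1) p(3)] comp_homs[OF p(3) assms(1)] by blast
qed

lemma push_subs: assumes "g \<in> H X Y" "A \<in> subs X" shows "push g A \<in> subs Y"
proof -
  obtain Z a where a: "a \<in> H Z X" "A = el a" using subs_obtain[OF assms(2)] by metis
  obtain I m e where "m \<in> H I Y" "monic C m" "e \<in> H Z I" "epic C e" "g \<odot> a = m \<odot> e"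
    using image_obtain[OF comp_homs[OF a(1) assms(1)]] by metis
  then show ?thesis using push_el[OF a(1) assms(1)] subsI a(2) by metis
qed

lemma join_subs: assumes "A \<in> subs X" "B \<in> subs X" shows "join X A B \<in> subs X"
proof -
  obtain Y a where a: "a \<in> H Y X" "A = el a" using subs_obtain[OF assms(1)] by metis
  obtain Z b where b: "b \<in> H Z X" "B = el b" using subs_obtain[OF assms(2)] by metis
  obtain S i j p q where S: "i \<in> H Y S" "j \<in> H Z S" "p \<in> H S Y" "q \<in> H S Z"
    "p \<odot> i = cid C Y" "q \<odot> j = cid C Z" "p \<odot> j = nul Z Y" "q \<odot> i = nul Y Z"
    using biproduct_obtain homs_obj[OF a(1)] homs_obj[OF b(1)] by metis
  have ap: "a \<odot> p \<in> H S X" "b \<odot> q \<in> H S X" using comp_homs S a(1) b(1) by blast+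
  \<comment> \<open>The sum of two subobjects is the image of the map out of the biproduct of their
    domains that is \<open>a\<close> on the first summand and \<open>b\<close> on the
    second.\<close>
  define d where "d = a \<odot> p \<boxplus> b \<odot> q"
  have d: "d \<in> H S X" unfolding d_def using add_homs ap by blast
  have dw: "d \<odot> w = a \<odot> p \<odot> w \<boxplus> b \<odot> q \<odot> w" if "w \<in> H V S" for w V
    unfolding d_def using distr[OF ap that] assoc[OF that S(3) a(1)] assoc[OF that S(4) b(1)] by simp
  have "join X A B = push d (tp S)"
  proof (intro equalityI subsetI)
    fix z assume "z \<in> join X A B"
    then obtain W V e x y where z: "z \<in> H W X" "epic C e" "e \<in> H V W" "x \<in> A" "x \<in> H V X"
      "y \<in> B" "y \<in> H V X" "z \<odot> e = x \<boxplus> y" unfolding join_def by blast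
    obtain h where h: "h \<in> H V Y" "x = a \<odot> h" using el_obtain[OF a(1) _ z(5)] z(4) a(2) by blast
    obtain k where k: "k \<in> H V Z" "y = b \<odot> k" using el_obtain[OF b(1) _ z(7)] z(6) b(2) by blast
    have ihh: "i \<odot> h \<in> H V S" "j \<odot> k \<in> H V S" using comp_homs h k S by blast+
    define w where "w = i \<odot> h \<boxplus> j \<odot> k"
    have w: "w \<in> H V S" unfolding w_def using add_homs ihh by blast
    have o: "V \<in> cobj C" using homs_obj w by blast
    have "p \<odot> w = h"
      unfolding w_def distl[OF S(3) ihh] assoc[OF h(1) S(1,3), symmetric] assoc[OF k(1) S(2,3), symmetric]
      using S(5,7) id_left[OF h(1)] nul_comp[OF k(1)] homs_obj[OF h(1)] add_nul(1)[OF h(1)] by simp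
    moreover have "q \<odot> w = k"
      unfolding w_def distl[OF S(4) ihh] assoc[OF h(1) S(1,4), symmetric] assoc[OF k(1) S(2,4), symmetric]
      using S(6,8) id_left[OF k(1)] nul_comp[OF h(1)] homs_obj[OF k(1)] add_nul(2)[OF k(1)] by simp
    ultimately have "z \<odot> e = d \<odot> w" using dw[OF w] h k z by simp
    then show "z \<in> push d (tp S)" using mem_push[OF d z(1)] z w mem_tp by blast
  next
    fix z assume "z \<in> push d (tp S)"
    then obtain W V e w where z: "z \<in> H W X" "epic C e" "e \<in> H V W" "w \<in> H V S" "z \<odot> e = d \<odot> w"
      unfolding push_def homs_cod[OF d] homs_dom[OF d] by blast
    have pq: "p \<odot> w \<in> H V Y" "q \<odot> w \<in> H V Z" using comp_homs z(4) S by blast+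
    have ab: "a \<odot> p \<odot> w \<in> A" "a \<odot> p \<odot> w \<in> H V X" "b \<odot> q \<odot> w \<in> B" "b \<odot> q \<odot> w \<in> H V X"
      using el_comp[OF a(1) pq(1)] el_comp[OF b(1) pq(2)] a(2) b(2)
        comp_homs[OF pq(1) a(1)] comp_homs[OF pq(2) b(1)] by auto
    show "z \<in> join X A B" by (rule joinI[OF z(1,2,3) ab]) (simp add: z(5) dw[OF z(4)])
  qed
  then show ?thesis using push_subs[OF d tp_subs] homs_obj[OF d] by simp
qed

section \<open>Joins and the modular law\<close>

lemma join_ub1: assumes "A \<in> subs X" "B \<in> subs X" shows "A \<subseteq> join X A B"
proof (rule subs_subsetI[OF assms(1)])
  fix W x assume x: "x \<in> H W X" "x \<in> A"
  have o: "W \<in> cobj C" using homs_obj x by blast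
  have "x \<odot> cid C W = x \<boxplus> nul W X" using id_right[OF x(1)] add_nul[OF x(1)] by simp
  then show "x \<in> join X A B"
    using mem_join[OF x(1)] id_homs[OF o] id_epic[OF o] x subs_nul[OF assms(2) o] nul_homs'[OF x(1)] by blast
qed

lemma join_ub2: assumes "A \<in> subs X" "B \<in> subs X" shows "B \<subseteq> join X A B"
proof (rule subs_subsetI[OF assms(2)])
  fix W x assume x: "x \<in> H W X" "x \<in> B"
  have o: "W \<in> cobj C" using homs_obj x by blast
  have "x \<odot> cid C W = nul W X \<boxplus> x" using id_right[OF x(1)] add_nul[OF x(1)] by simp
  then show "x \<in> join X A B"
    using mem_join[OF x(1)] id_homs[OF o] id_epic[OF o] x subs_nul[OF assms(1) o] nul_homs'[OF x(1)] by blast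
qed

lemma join_least: assumes "D \<in> subs X" "A \<subseteq> D" "B \<subseteq> D" shows "join X A B \<subseteq> D"
proof
  fix z assume "z \<in> join X A B"
  then obtain W V p x y where z: "z \<in> H W X" "epic C p" "p \<in> H V W" "x \<in> A" "x \<in> H V X"
    "y \<in> B" "y \<in> H V X" "z \<odot> p = x \<boxplus> y" unfolding join_def by blast
  then show "z \<in> D" using subs_local[OF assms(1) z(1,2,3)] subs_add[OF assms(1) z(5,7)] assms(2,3) by auto
qed

lemma join_absorb: "A \<in> subs X \<Longrightarrow> B \<in> subs X \<Longrightarrow> A \<subseteq> B \<Longrightarrow> join X A B = B"
  by (meson join_least join_ub2 subset_antisym subset_refl)

lemma join_comm: "A \<in> subs X \<Longrightarrow> B \<in> subs X \<Longrightarrow> join X A B = join X B A"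
  by (meson join_least join_subs join_ub1 join_ub2 subset_antisym)

lemma join_mono:
  "A \<in> subs X \<Longrightarrow> B \<in> subs X \<Longrightarrow> A' \<in> subs X \<Longrightarrow> B' \<in> subs X \<Longrightarrow> A \<subseteq> A' \<Longrightarrow> B \<subseteq> B' \<Longrightarrow> join X A B \<subseteq> join X A' B'"
  by (meson join_least join_subs join_ub1 join_ub2 subset_trans)

text \<open>The argument for modules, carried out after an epimorphism: in
  \<open>z \<odot> p = x \<boxplus> y\<close> both \<open>z \<odot> p\<close> and \<open>x\<close>
  lie in \<open>D\<close>, hence so does \<open>y\<close>.\<close>

lemma modular:
  assumes "A \<in> subs X" "B \<in> subs X" "D \<in> subs X" "A \<subseteq> D"
  shows "join X A B \<inter> D = join X A (B \<inter> D)"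
proof
  show "join X A B \<inter> D \<subseteq> join X A (B \<inter> D)"
  proof (rule subs_subsetI[OF inter_subs[OF join_subs[OF assms(1,2)] assms(3)]])
    fix W z assume zh: "z \<in> H W X" "z \<in> join X A B \<inter> D"
    then obtain V p x y where z: "epic C p" "p \<in> H V W" "x \<in> A" "x \<in> H V X"
      "y \<in> B" "y \<in> H V X" "z \<odot> p = x \<boxplus> y" using mem_join[OF zh(1)] by blast
    have "x \<boxplus> y \<in> D" using subs_closed[OF assms(3) _ zh(1) z(2)] zh(2) z(7) by simp
    then have "y \<in> D" using subs_diff[OF assms(3) z(4,6)] z(3) assms(4) by blast
    then show "z \<in> join X A (B \<inter> D)" using joinI[OF zh(1) z(1,2,3,4) _ z(6,7)] z(5) by blast
  qed
  show "join X A (B \<inter> D) \<subseteq> join X A B \<inter> D"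
    using join_mono[OF assms(1) inter_subs[OF assms(2,3)] assms(1,2)] join_least[OF assms(3,4)] by blast
qed

section \<open>Images and inverse images\<close>

lemma push_mono: "A \<subseteq> B \<Longrightarrow> push g A \<subseteq> push g B"
  unfolding push_def by blast

lemma pull_mono: "A \<subseteq> B \<Longrightarrow> pull g A \<subseteq> pull g B"
  unfolding pull_def by blast

text \<open>The Galois connection between image and inverse image; equations between images are
  proved with it by comparing upper bounds, as in \<open>push_comp\<close>.\<close>

lemma push_subset_iff:
  assumes "g \<in> H X Y" "A \<in> subs X" "B \<in> subs Y"
  shows "push g A \<subseteq> B \<longleftrightarrow> A \<subseteq> pull g B"
proof
  assume s: "push g A \<subseteq> B"
  show "A \<subseteq> pull g B"
  proof (rule subs_subsetI[OF assms(2)])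
    fix W x assume x: "x \<in> H W X" "x \<in> A"
    have gx: "g \<odot> x \<in> H W Y" using comp_homs[OF x(1) assms(1)] .
    have "g \<odot> x \<in> push g A"
      using mem_push[OF assms(1) gx] id_epic id_homs id_right[OF gx] x homs_obj[OF x(1)] by blast
    then show "x \<in> pull g B" using s mem_pull[OF assms(1) x(1)] by blast
  qed
next
  assume s: "A \<subseteq> pull g B"
  show "push g A \<subseteq> B"
  proof (rule subs_subsetI[OF push_subs[OF assms(1,2)]])
    fix W y assume y: "y \<in> H W Y" "y \<in> push g A"
    then obtain V p x where p: "epic C p" "p \<in> H V W" "x \<in> A" "x \<in> H V X" "y \<odot> p = g \<odot> x"
      using mem_push[OF assms(1) y(1)] by blast
    then have "g \<odot> x \<in> B" using s mem_pull[OF assms(1) p(4)] by blast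
    then show "y \<in> B" using subs_local[OF assms(3) y(1) p(1,2)] p(5) by simp
  qed
qed

lemma pull_comp:
  assumes "g \<in> H X Y" "h \<in> H Y Z" shows "pull (h \<odot> g) A = pull g (pull h A)"
proof -
  have "x \<in> H W X \<Longrightarrow> (h \<odot> g) \<odot> x \<in> A \<longleftrightarrow> g \<odot> x \<in> pull h A" for W x
    using assoc[OF _ assms] mem_pull[OF assms(2) comp_homs[OF _ assms(1)]] by simp
  then show ?thesis unfolding pull_def[of "h \<odot> g"] pull_def[of g]
    using homs_dom[OF assms(1)] homs_dom[OF comp_homs[OF assms]] by auto
qed

lemma push_comp:
  assumes "g \<in> H X Y" "h \<in> H Y Z" "A \<in> subs X" shows "push (h \<odot> g) A = push h (push g A)"
proof -
  have hg: "h \<odot> g \<in> H X Z" using comp_homs assms by blast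
  have "push (h \<odot> g) A \<subseteq> B \<longleftrightarrow> push h (push g A) \<subseteq> B" if "B \<in> subs Z" for B
    using push_subset_iff[OF hg assms(3) that] pull_comp[OF assms(1,2)]
      push_subset_iff[OF assms(1,3) pull_subs[OF assms(2) that]]
      push_subset_iff[OF assms(2) push_subs[OF assms(1,3)] that] by simp
  then show ?thesis using push_subs[OF hg assms(3)] push_subs[OF assms(2) push_subs[OF assms(1,3)]] by blast
qed

lemma push_join:
  assumes "g \<in> H X Y" "A \<in> subs X" "B \<in> subs X"
  shows "push g (join X A B) = join Y (push g A) (push g B)"
proof
  have p: "push g A \<in> subs Y" "push g B \<in> subs Y" using push_subs assms by blast+
  show "push g (join X A B) \<subseteq> join Y (push g A) (push g B)"
    unfolding push_subset_iff[OF assms(1) join_subs[OF assms(2,3)] join_subs[OF p]]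
    using join_ub1[OF p] join_ub2[OF p] push_subset_iff[OF assms(1) _ join_subs[OF p]] assms
    by (intro join_least pull_subs[OF assms(1) join_subs[OF p]]) auto
  show "join Y (push g A) (push g B) \<subseteq> push g (join X A B)"
    using join_least[OF push_subs[OF assms(1) join_subs[OF assms(2,3)]]]
      push_mono[OF join_ub1[OF assms(2,3)]] push_mono[OF join_ub2[OF assms(2,3)]] by blast
qed

text \<open>Frobenius reciprocity: a witness \<open>x\<close> for membership of \<open>y\<close> in
  the image automatically lies over \<open>B\<close> because \<open>y\<close> lies in
  \<open>B\<close>.\<close>

lemma push_pull_inter:
  assumes "g \<in> H X Y" "A \<in> subs X" "B \<in> subs Y"
  shows "push g (A \<inter> pull g B) = push g A \<inter> B"
proof
  have i: "A \<inter> pull g B \<in> subs X" using inter_subs pull_subs assms by blast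
  show "push g (A \<inter> pull g B) \<subseteq> push g A \<inter> B"
    using push_mono[of "A \<inter> pull g B" A g] push_subset_iff[OF assms(1) i assms(3)] by blast
  show "push g A \<inter> B \<subseteq> push g (A \<inter> pull g B)"
  proof (rule subs_subsetI[OF inter_subs[OF push_subs[OF assms(1,2)] assms(3)]])
    fix W y assume y: "y \<in> H W Y" "y \<in> push g A \<inter> B"
    then obtain V p x where p: "epic C p" "p \<in> H V W" "x \<in> A" "x \<in> H V X" "y \<odot> p = g \<odot> x"
      using mem_push[OF assms(1) y(1)] by blast
    then have "g \<odot> x \<in> B" using subs_closed[OF assms(3) _ y(1) p(2)] y(2) by simp
    then have "x \<in> A \<inter> pull g B" using p mem_pull[OF assms(1) p(4)] by blast
    then show "y \<in> push g (A \<inter> pull g B)" using mem_push[OF assms(1) y(1)] p by blast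
  qed
qed

text \<open>Two arrows with the same image under \<open>g\<close> differ by an element of the
  kernel. As \<open>n\<close> is the negative of \<open>a\<close>, this difference is
  \<open>x \<odot> p \<boxplus> n\<close>.\<close>

lemma pull_push:
  assumes "g \<in> H X Y" "A \<in> subs X"
  shows "pull g (push g A) = join X A (pull g (bt Y))"
proof
  have Y: "Y \<in> cobj C" using homs_obj assms by blast
  have k: "pull g (bt Y) \<in> subs X" using pull_subs[OF assms(1) bt_subs[OF Y]] .
  have pp: "pull g (push g A) \<in> subs X" using pull_subs[OF assms(1) push_subs[OF assms]] .
  show "pull g (push g A) \<subseteq> join X A (pull g (bt Y))"
  proof (rule subs_subsetI[OF pp])
    fix W x assume x: "x \<in> H W X" "x \<in> pull g (push g A)"
    have gx: "g \<odot> x \<in> H W Y" using comp_homs[OF x(1) assms(1)] .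
    obtain V p a where p: "epic C p" "p \<in> H V W" "a \<in> A" "a \<in> H V X" "(g \<odot> x) \<odot> p = g \<odot> a"
      using x(2)[unfolded mem_pull[OF assms(1) x(1)] mem_push[OF assms(1) gx]] by blast
    obtain n where n: "n \<in> H V X" "a \<boxplus> n = nul V X" using neg_obtain p(4) by blast
    have xp: "x \<odot> p \<in> H V X" using comp_homs[OF p(2) x(1)] .
    have k: "x \<odot> p \<boxplus> n \<in> H V X" using add_homs xp n(1) by blast
    have "g \<odot> (x \<odot> p \<boxplus> n) = g \<odot> (a \<boxplus> n)"
      using distl[OF assms(1) xp n(1)] distl[OF assms(1) p(4) n(1)] p(5) assoc[OF p(2) x(1) assms(1)] by simp
    also have "\<dots> = nul V Y" using n(2) comp_nul[OF assms(1)] homs_obj[OF n(1)] by simp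
    finally have "x \<odot> p \<boxplus> n \<in> pull g (bt Y)"
      using mem_pull[OF assms(1) k] mem_bt[OF comp_homs[OF k assms(1)]] by simp
    moreover have "x \<odot> p = a \<boxplus> (x \<odot> p \<boxplus> n)"
    proof -
      have "a \<boxplus> (x \<odot> p \<boxplus> n) = a \<boxplus> (n \<boxplus> x \<odot> p)" using add_comm[OF xp n(1)] by simp
      also have "\<dots> = (a \<boxplus> n) \<boxplus> x \<odot> p" using add_ac[OF p(4) n(1) xp] by simp
      finally show ?thesis using n(2) add_nul(2)[OF xp] by simp
    qed
    ultimately show "x \<in> join X A (pull g (bt Y))" using joinI[OF x(1) p(1,2,3,4) _ k] by blast
  qed
  show "join X A (pull g (bt Y)) \<subseteq> pull g (push g A)"
    using join_least[OF pp] push_subset_iff[OF assms push_subs[OF assms]]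
      pull_mono[OF bt_subset[OF push_subs[OF assms]]] by blast
qed

text \<open>The kernel of a monomorphism is trivial, so the join in \<open>pull_push\<close> adds
  nothing.\<close>

lemma pull_push_monic:
  assumes "m \<in> H Y X" "monic C m" "A \<in> subs Y" shows "pull m (push m A) = A"
proof -
  have o: "X \<in> cobj C" "Y \<in> cobj C" using homs_obj assms(1) by blast+
  have k: "pull m (bt X) \<in> subs Y" using pull_subs[OF assms(1) bt_subs] o by blast
  have "pull m (bt X) \<subseteq> bt Y"
  proof (rule subs_subsetI[OF k])
    fix W x assume x: "x \<in> H W Y" "x \<in> pull m (bt X)"
    then have "m \<odot> x = nul W X" using mem_pull[OF assms(1) x(1)] mem_bt comp_homs[OF x(1) assms(1)] by blast
    then show "x \<in> bt Y" using monic_iff[OF assms(1)] assms(2) mem_bt[OF x(1)] x(1) by blast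
  qed
  then have "pull m (bt X) \<subseteq> A" using bt_subset[OF assms(3)] by blast
  then show ?thesis
    using pull_push[OF assms(1,3)] join_absorb[OF k assms(3)] join_comm[OF k assms(3)] by simp
qed

lemma push_tp_epic:
  assumes "e \<in> H X Y" "epic C e" shows "push e (tp X) = tp Y"
proof -
  have o: "X \<in> cobj C" "Y \<in> cobj C" using homs_obj assms(1) by blast+
  have "y \<in> push e (tp X)" if y: "y \<in> H W Y" for y W
  proof -
    obtain V p k where "p \<in> H V W" "epic C p" "k \<in> H V X" "e \<odot> k = y \<odot> p"
      using epic_pullback[OF assms(2,1) y] by metis
    then show ?thesis using mem_push[OF assms(1) y] mem_tp by metis
  qed
  then show ?thesis using subset_tp[OF push_subs[OF assms(1) tp_subs[OF o(1)]]] unfolding tp_def by blast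
qed

text \<open>The identity of \<open>Y\<close> lies in the image, so it lifts through \<open>e\<close>
  after an epimorphism; an arrow that kills \<open>e\<close> then kills an epimorphism onto
  \<open>Y\<close>.\<close>

lemma epic_if_push_tp:
  assumes "e \<in> H X Y" "push e (tp X) = tp Y" shows "epic C e"
proof (subst epic_iff[OF assms(1)], intro allI ballI impI)
  fix W u assume u: "u \<in> H Y W" "u \<odot> e = nul X W"
  have Y: "Y \<in> cobj C" using homs_obj[OF assms(1)] by blast
  have "cid C Y \<in> push e (tp X)" using assms(2) mem_tp id_homs[OF Y] by blast
  then obtain V p x where p: "epic C p" "p \<in> H V Y" "x \<in> H V X" "cid C Y \<odot> p = e \<odot> x"
    using mem_push[OF assms(1) id_homs[OF Y]] by blast
  have "u \<odot> p = (u \<odot> e) \<odot> x" using id_left[OF p(2)] p(4) assoc[OF p(3) assms(1) u(1)] by simp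
  then have "u \<odot> p = nul V W" using u nul_comp[OF p(3)] homs_obj[OF u(1)] by simp
  then show "u = nul Y W" using epic_iff[OF p(2)] p(1) u(1) by blast
qed

lemma push_pull_epic:
  assumes "e \<in> H X Y" "epic C e" "B \<in> subs Y" shows "push e (pull e B) = B"
proof -
  have X: "X \<in> cobj C" using homs_obj assms(1) by blast
  have "push e (tp X \<inter> pull e B) = tp Y \<inter> B"
    using push_pull_inter[OF assms(1) tp_subs[OF X] assms(3)] push_tp_epic[OF assms(1,2)] by simp
  moreover have "tp X \<inter> pull e B = pull e B" using subset_tp[OF pull_subs[OF assms(1,3)]] by blast
  moreover have "tp Y \<inter> B = B" using subset_tp[OF assms(3)] by blast
  ultimately show ?thesis by simp
qed

lemma push_tp_monic:
  assumes "m \<in> H Y X" "monic C m" shows "push m (tp Y) = el m"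
proof -
  have Y: "Y \<in> cobj C" using homs_obj assms(1) by blast
  have "tp Y = el (cid C Y)"
    unfolding tp_def using mem_el_iff[OF id_homs[OF Y]] id_left by (auto simp: set_eq_iff)
  then show ?thesis
    using push_el[OF id_homs[OF Y] assms(1) assms id_homs[OF Y] id_epic[OF Y]] by simp
qed

text \<open>\<open>Q\<close> is a quotient \<open>B / A\<close>: some \<open>u\<close> generates \<open>B\<close> modulo \<open>A\<close>, and \<open>e\<close> divides out the preimage of \<open>A\<close>.\<close>

definition subq :: "'o \<Rightarrow> 'm set \<Rightarrow> 'm set \<Rightarrow> 'o \<Rightarrow> bool" where
  "subq X A B Q \<longleftrightarrow> (\<exists>W u e. u \<in> H W X \<and> e \<in> H W Q \<and> epic C e \<and>
     pull u A = pull e (bt Q) \<and> join X A (push u (tp W)) = B)"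

lemma subqI:
  "\<lbrakk>u \<in> H W X; e \<in> H W Q; epic C e; pull u A = pull e (bt Q); join X A (push u (tp W)) = B\<rbrakk>
    \<Longrightarrow> subq X A B Q"
  unfolding subq_def by blast

text \<open>Any two presentations of a subquotient are compared inside the cokernel of the smaller subobject.\<close>

lemma subq_unique:
  assumes A: "A \<in> subs X" and "subq X A B Q" "subq X A B Q'"
  shows "isomorphic C Q Q'"
proof -
  obtain Z c where c: "c \<in> H X Z" "\<And>W x. x \<in> H W X \<Longrightarrow> x \<in> A \<longleftrightarrow> c \<odot> x = nul W Z"
    using subs_kernel_obtain[OF A] by metis
  have Z: "Z \<in> cobj C" using homs_obj c by blast
  have cA: "push c A = bt Z"
  proof
    have "A \<subseteq> pull c (bt Z)"
      using mem_pull[OF c(1)] mem_bt[OF comp_homs[OF _ c(1)]] c(2) by (intro subs_subsetI[OF A]) blast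
    then show "push c A \<subseteq> bt Z" using push_subset_iff[OF c(1) A bt_subs[OF Z]] by blast
    show "bt Z \<subseteq> push c A" using bt_subset[OF push_subs[OF c(1) A]] .
  qed
  have "\<exists>m. m \<in> H R Z \<and> monic C m \<and> el m = push c B" if R: "subq X A B R" for R
  proof -
    obtain W u e where u: "u \<in> H W X" "e \<in> H W R" "epic C e" "pull u A = pull e (bt R)"
      "join X A (push u (tp W)) = B" using R unfolding subq_def by blast
    have o: "W \<in> cobj C" "R \<in> cobj C" using homs_obj u(2) by blast+
    have cu: "c \<odot> u \<in> H W Z" using comp_homs u(1) c(1) by blast
    \<comment> \<open>Both \<open>e\<close> and \<open>c \<odot> u\<close> kill exactly the arrows
      that \<open>u\<close> sends into \<open>A\<close>, so \<open>c \<odot> u\<close> factors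
      through \<open>e\<close> by a monomorphism.\<close>
    have ke: "e \<odot> h = nul V R \<longleftrightarrow> (c \<odot> u) \<odot> h = nul V Z" if h: "h \<in> H V W" for V h
    proof -
      have "e \<odot> h = nul V R \<longleftrightarrow> h \<in> pull e (bt R)"
        using mem_pull[OF u(2) h] mem_bt[OF comp_homs[OF h u(2)]] by simp
      also have "\<dots> \<longleftrightarrow> u \<odot> h \<in> A" using mem_pull[OF u(1) h, of A] u(4) by simp
      also have "\<dots> \<longleftrightarrow> (c \<odot> u) \<odot> h = nul V Z"
        using c(2)[OF comp_homs[OF h u(1)]] assoc[OF h u(1) c(1)] by simp
      finally show ?thesis .
    qed
    obtain m where m: "m \<in> H R Z" "c \<odot> u = m \<odot> e"
      using epic_factor[OF u(3,2) cu] ke by blast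
    have "monic C m"
    proof (subst monic_iff[OF m(1)], intro allI ballI impI)
      fix V x assume x: "x \<in> H V R" "m \<odot> x = nul V Z"
      obtain T p k where p: "p \<in> H T V" "epic C p" "k \<in> H T W" "e \<odot> k = x \<odot> p"
        using epic_pullback[OF u(3,2) x(1)] by metis
      have "(c \<odot> u) \<odot> k = (m \<odot> x) \<odot> p"
        using m(2) assoc[OF p(3) u(2) m(1)] assoc[OF p(1) x(1) m(1)] p(4) by simp
      also have "\<dots> = nul T Z" using x(2) nul_comp[OF p(1)] Z by simp
      finally have "x \<odot> p = nul T R" using ke[OF p(3)] p(4) by simp
      then show "x = nul V R" using epic_iff[OF p(1)] p(2) x(1) by blast
    qed
    moreover have "el m = push c B"
    proof -
      have "el m = push m (push e (tp W))"
        using push_tp_monic[OF m(1) \<open>monic C m\<close>] push_tp_epic[OF u(2,3)] by simp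
      also have "\<dots> = push (c \<odot> u) (tp W)" using push_comp[OF u(2) m(1) tp_subs[OF o(1)]] m(2) by simp
      also have "\<dots> = push c (push u (tp W))" using push_comp[OF u(1) c(1) tp_subs[OF o(1)]] .
      also have "\<dots> = join Z (push c A) (push c (push u (tp W)))"
        using cA join_absorb[OF bt_subs[OF Z] _ bt_subset]
          push_subs[OF c(1) push_subs[OF u(1) tp_subs[OF o(1)]]] by simp
      also have "\<dots> = push c B" using push_join[OF c(1) A push_subs[OF u(1) tp_subs[OF o(1)]]] u(5) by simp
      finally show ?thesis .
    qed
    ultimately show ?thesis using m(1) by blast
  qed
  then obtain m m' where m: "m \<in> H Q Z" "monic C m" "el m = push c B"
    "m' \<in> H Q' Z" "monic C m'" "el m' = push c B" using assms(2,3) by metis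
  obtain h where h: "h \<in> H Q Q'" "m = m' \<odot> h" using el_obtain[OF m(4) _ m(1)] self_mem_el[OF m(1)] m by metis
  obtain k where k: "k \<in> H Q' Q" "m' = m \<odot> k" using el_obtain[OF m(1) _ m(4)] self_mem_el[OF m(4)] m by metis
  have o: "Q \<in> cobj C" "Q' \<in> cobj C" using homs_obj h by blast+
  have "m \<odot> k \<odot> h = m \<odot> cid C Q" using h k assoc[OF h(1) k(1) m(1)] id_right[OF m(1)] by simp
  then have kh: "k \<odot> h = cid C Q" using monic_cancel[OF m(2,1) comp_homs[OF h(1) k(1)] id_homs[OF o(1)]] by simp
  have "m' \<odot> h \<odot> k = m' \<odot> cid C Q'" using h k assoc[OF k(1) h(1) m(4)] id_right[OF m(4)] by simp
  then have "h \<odot> k = cid C Q'" using monic_cancel[OF m(5,4) comp_homs[OF k(1) h(1)] id_homs[OF o(2)]] by simp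
  then show ?thesis using isoI[OF h(1) k(1) kh] isomorphicI h(1) by blast
qed

text \<open>The inclusion \<open>m\<close> of \<open>B\<close> and the cokernel \<open>q\<close>
  form a presentation: \<open>h\<close> is monic because \<open>n\<close> is, hence it is the kernel
  of \<open>q\<close>, and \<open>q\<close> divides out exactly the preimage of
  \<open>A\<close>.\<close>

lemma is_quotient_subq:
  assumes "A \<in> subs X" "is_quotient C (cls X B) (cls X A) Q"
  shows "subq X A B Q"
proof -
  obtain m n h q where h: "m \<in> cls X B" "n \<in> cls X A" "h \<in> H (cdom C n) (cdom C m)" "n = m \<odot> h"
    "is_cokernel C q h" "Q = ccod C q" using assms(2) unfolding is_quotient_def by blast
  define Y Z where "Y = cdom C m" and "Z = cdom C n"
  have m: "m \<in> H Y X" "monic C m" "el m = B" and n: "n \<in> H Z X" "monic C n" "el n = A"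
    using cls_memD[OF h(1)] cls_memD[OF h(2)] by (auto simp: Y_def Z_def)
  have hh: "h \<in> H Z Y" using h(3) by (simp add: Y_def Z_def)
  have B: "B \<in> subs X" using subsI m by blast
  have AB: "A \<subseteq> B" unfolding n(3)[symmetric] m(3)[symmetric]
    using factors_through_iff_el[OF n(1) m(1)] h(3,4) unfolding factors_through_def by blast
  have "monic C h"
  proof (rule monicI[OF hh])
    fix W u v assume uv: "u \<in> H W Z" "v \<in> H W Z" "h \<odot> u = h \<odot> v"
    have "n \<odot> u = n \<odot> v" unfolding h(4) assoc[OF uv(1) hh m(1)] assoc[OF uv(2) hh m(1)] uv(3) ..
    then show "u = v" using monic_cancel[OF n(2,1) uv(1,2)] by blast
  qed
  moreover obtain Q' where "q \<in> H Y Q'" "epic C q" using h(5) is_cokernel_iff[OF hh] by blast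
  then have q: "q \<in> H Y Q" "epic C q" using h(6) homs_cod by metis+
  ultimately have "is_kernel C h q" using monic_kernel_of_cokernel[OF _ hh h(5)] by blast
  then have hk: "q \<odot> h = nul Z Q" "\<And>W x. x \<in> H W Y \<Longrightarrow> q \<odot> x = nul W Q \<Longrightarrow> x \<in> el h"
    using is_kernel_iff[OF q(1)] homs_dom[OF hh] homs_dom by metis+
  have o: "Q \<in> cobj C" "Y \<in> cobj C" using homs_obj q(1) by blast+
  have "pull m A = pull q (bt Q)"
  proof (rule subs_eqI[OF pull_subs[OF m(1) assms(1)] pull_subs[OF q(1) bt_subs[OF o(1)]]])
    fix W x assume x: "x \<in> H W Y"
    have "m \<odot> x \<in> A \<longleftrightarrow> x \<in> el h"
    proof
      assume "m \<odot> x \<in> A"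
      then obtain k where k: "k \<in> H W Z" "m \<odot> x = n \<odot> k"
        using el_obtain[OF n(1) _ comp_homs[OF x m(1)]] n(3) by metis
      then have "m \<odot> x = m \<odot> h \<odot> k" using h(4) assoc[OF k(1) hh m(1)] by simp
      then have "x = h \<odot> k" using monic_cancel[OF m(2,1) x comp_homs[OF k(1) hh]] by simp
      then show "x \<in> el h" using el_comp[OF hh k(1)] by simp
    next
      assume "x \<in> el h"
      then obtain k where k: "k \<in> H W Z" "x = h \<odot> k" using el_obtain[OF hh _ x] by blast
      then have "m \<odot> x = n \<odot> k" using h(4) assoc[OF k(1) hh m(1)] by simp
      then show "m \<odot> x \<in> A" using n(3) el_comp[OF n(1) k(1)] by simp
    qed
    moreover have "x \<in> el h \<longleftrightarrow> q \<odot> x = nul W Q"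
    proof
      assume "x \<in> el h"
      then obtain k where k: "k \<in> H W Z" "x = h \<odot> k" using el_obtain[OF hh _ x] by blast
      then show "q \<odot> x = nul W Q" using hk(1) assoc[OF k(1) hh q(1)] nul_comp[OF k(1) o(1)] by simp
    qed (use hk(2)[OF x] in simp)
    ultimately show "x \<in> pull m A \<longleftrightarrow> x \<in> pull q (bt Q)"
      using mem_pull[OF m(1) x] mem_pull[OF q(1) x] mem_bt[OF comp_homs[OF x q(1)]] by simp
  qed
  moreover have "join X A (push m (tp Y)) = B"
    using push_tp_monic[OF m(1,2)] m(3) join_absorb[OF assms(1) B AB] by simp
  ultimately show ?thesis unfolding subq_def using m q by blast
qed

lemma is_quotient_exists:
  assumes "A \<in> subs X" "B \<in> subs X" "A \<subseteq> B"
  shows "\<exists>Q. is_quotient C (cls X B) (cls X A) Q"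
proof -
  obtain m n where mn: "m \<in> cls X B" "n \<in> cls X A" using cls_nonempty assms by blast
  have m: "m \<in> H (cdom C m) X" "el m = B" and n: "n \<in> H (cdom C n) X" "el n = A"
    using cls_memD mn by blast+
  have "factors_through C n m" using factors_through_iff_el[OF n(1) m(1)] m n assms(3) by blast
  then obtain h where h: "h \<in> H (cdom C n) (cdom C m)" "n = m \<odot> h" unfolding factors_through_def by blast
  obtain Q q where "is_cokernel C q h" using cokernel_obtain[OF h(1)] by metis
  then show ?thesis unfolding is_quotient_def using mn h by blast
qed

lemma subq_quotient_obj:
  assumes "A \<in> subs X" "B \<in> subs X" "A \<subseteq> B"
  shows "subq X A B (quotient_obj C (cls X B) (cls X A))"
  using is_quotient_subq[OF assms(1)] someI_ex[OF is_quotient_exists[OF assms]]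
  unfolding quotient_obj_def by blast

lemma isomorphic_subq:
  assumes "subq X A B Q" "isomorphic C Q Q'" shows "subq X A B Q'"
proof -
  obtain W u e where u: "u \<in> H W X" "e \<in> H W Q" "epic C e" "pull u A = pull e (bt Q)"
      "join X A (push u (tp W)) = B" using assms(1) unfolding subq_def by blast
  obtain g where g: "g \<in> H Q Q'" "iso_arr C g" using assms(2) unfolding isomorphic_def by blast
  have o: "Q \<in> cobj C" "Q' \<in> cobj C" using homs_obj g by blast+
  have "push g (bt Q) = bt Q'"
  proof
    have "bt Q \<subseteq> pull g (bt Q')" using bt_subset[OF pull_subs[OF g(1) bt_subs[OF o(2)]]] .
    then show "push g (bt Q) \<subseteq> bt Q'" using push_subset_iff[OF g(1) bt_subs[OF o(1)] bt_subs[OF o(2)]] by simp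
  qed (rule bt_subset[OF push_subs[OF g(1) bt_subs[OF o(1)]]])
  then have "pull g (bt Q') = bt Q"
    using pull_push_monic[OF g(1) iso_monic[OF g(2,1)] bt_subs[OF o(1)]] by simp
  then have "pull (g \<odot> e) (bt Q') = pull u A" using pull_comp[OF u(2) g(1)] u(4) by simp
  then show ?thesis unfolding subq_def
    using u comp_homs[OF u(2) g(1)] epic_comp[OF u(3,2) iso_epic[OF g(2,1)] g(1)] by metis
qed

text \<open>Second isomorphism theorem: the inclusion \<open>m\<close> of \<open>M\<close> presents
  both quotients, since an arrow in \<open>M\<close> lies in \<open>N\<close> iff it lies in
  \<open>M \<inter> N\<close>.\<close>

lemma subq_second_iso:
  assumes "M \<in> subs X" "N \<in> subs X" "subq X (M \<inter> N) M Q" shows "subq X N (join X M N) Q"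
proof -
  obtain Y m where m: "m \<in> H Y X" "monic C m" "M = el m" using subs_obtain[OF assms(1)] by metis
  have o: "Y \<in> cobj C" using homs_obj m by blast
  have MN: "M \<inter> N \<in> subs X" using inter_subs assms by blast
  have pm: "pull m (M \<inter> N) = pull m N"
  proof (rule subs_eqI[OF pull_subs[OF m(1) MN] pull_subs[OF m(1) assms(2)]])
    fix W x assume x: "x \<in> H W Y"
    show "x \<in> pull m (M \<inter> N) \<longleftrightarrow> x \<in> pull m N"
      unfolding mem_pull[OF m(1) x] using m(3) el_comp[OF m(1) x] by simp
  qed
  obtain Z c where c: "c \<in> H Y Z" "epic C c" and pc: "pull m N = pull c (bt Z)"
    using subs_pull_obtain[OF pull_subs[OF m(1) assms(2)]] by metis
  have "join X (M \<inter> N) (push m (tp Y)) = M"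
    using push_tp_monic[OF m(1,2)] m(3) join_absorb[OF MN assms(1)] by simp
  then have "subq X (M \<inter> N) M Z" using subqI[OF m(1) c(1,2)] pc pm by simp
  moreover have "subq X N (join X M N) Z"
    using subqI[OF m(1) c(1,2) pc] push_tp_monic[OF m(1,2)] m(3) join_comm[OF assms(1,2)] by simp
  ultimately show ?thesis using subq_unique[OF MN _ assms(3)] isomorphic_subq by blast
qed

text \<open>Let \<open>b\<close> be the inclusion into \<open>Y\<close> of the preimage of
  \<open>B\<close>. Composed with \<open>e\<close> it presents the quotient inside \<open>Z\<close>,
  composed with \<open>m\<close> the one inside \<open>X\<close>, and the same epimorphism
  \<open>c\<close> serves for both.\<close>

lemma subq_transfer:
  assumes m: "m \<in> H Y X" "monic C m" and e: "e \<in> H Y Z" "epic C e"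
    and A: "A \<in> subs Z" and B: "B \<in> subs Z" and "A \<subseteq> B" and Q: "subq Z A B Q"
  shows "subq X (push m (pull e A)) (push m (pull e B)) Q"
proof -
  have o: "Y \<in> cobj C" using homs_obj m by blast
  have eA: "pull e A \<in> subs Y" and eB: "pull e B \<in> subs Y" using pull_subs e A B by blast+
  obtain V b where b: "b \<in> H V Y" "monic C b" "pull e B = el b" using subs_obtain[OF eB] by metis
  have V: "V \<in> cobj C" using homs_obj b by blast
  obtain R c where c: "c \<in> H V R" "epic C c" and pc: "pull b (pull e A) = pull c (bt R)"
    using subs_pull_obtain[OF pull_subs[OF b(1) eA]] by metis
  have eb: "e \<odot> b \<in> H V Z" and mb: "m \<odot> b \<in> H V X" using comp_homs b(1) e m by blast+
  have "pull (e \<odot> b) A = pull c (bt R)" using pc pull_comp[OF b(1) e(1)] by simp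
  moreover have "push (e \<odot> b) (tp V) = B"
    using push_comp[OF b(1) e(1) tp_subs[OF V]] push_tp_monic[OF b(1,2)] b(3)
      push_pull_epic[OF e B] by simp
  ultimately have "subq Z A B R" unfolding subq_def
    using eb c(1,2) join_absorb[OF A B assms(7)] by blast
  moreover have "subq X (push m (pull e A)) (push m (pull e B)) R"
  proof -
    have "pull (m \<odot> b) (push m (pull e A)) = pull c (bt R)"
      using pc pull_comp[OF b(1) m(1)] pull_push_monic[OF m eA] by simp
    moreover have "push (m \<odot> b) (tp V) = push m (pull e B)"
      using push_comp[OF b(1) m(1) tp_subs[OF V]] push_tp_monic[OF b(1,2)] b(3) by simp
    ultimately show ?thesis unfolding subq_def
      using mb c(1,2) join_absorb[OF push_subs[OF m(1) eA] push_subs[OF m(1) eB]]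
        push_mono[OF pull_mono[OF assms(7)]] by metis
  qed
  ultimately show ?thesis using subq_unique[OF A _ Q] isomorphic_subq by blast
qed

section \<open>Jordan--Hoelder vectors\<close>

definition cover :: "'o \<Rightarrow> 'm set \<Rightarrow> 'm set \<Rightarrow> bool" where
  "cover X A B \<longleftrightarrow> A \<in> subs X \<and> B \<in> subs X \<and> A \<subset> B \<and> (\<forall>D \<in> subs X. A \<subseteq> D \<and> D \<subseteq> B \<longrightarrow> D = A \<or> D = B)"

definition wt :: "'o set \<Rightarrow> 'o \<Rightarrow> 'm set \<Rightarrow> 'm set \<Rightarrow> int" where
  "wt K X A B = (if K \<in> simple_classes C \<and> (\<exists>Q \<in> K. subq X A B Q) then 1 else 0)"

text \<open>The weight is part of the path, so the Jordan-Hoelder theorem becomes the statement that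
  the endpoints determine it (\<open>path_unique\<close>).\<close>

inductive path :: "'o set \<Rightarrow> 'o \<Rightarrow> 'm set \<Rightarrow> 'm set \<Rightarrow> int \<Rightarrow> bool" for K X where
  path_refl: "A \<in> subs X \<Longrightarrow> path K X A A 0"
| path_step: "cover X A A' \<Longrightarrow> path K X A' B v \<Longrightarrow> path K X A B (wt K X A A' + v)"

definition mu :: "'o set \<Rightarrow> 'o \<Rightarrow> 'm set \<Rightarrow> 'm set \<Rightarrow> int" where
  "mu K X A B = (THE v. path K X A B v)"

section \<open>Weights of covers and the Jordan-Hoelder theorem\<close>

lemma simple_classes_closed:
  assumes "K \<in> simple_classes C" "Q \<in> K" "isomorphic C Q Q'" shows "Q' \<in> K"
proof -
  have "Q' \<in> cobj C" using assms(3) homs_obj unfolding isomorphic_def by blast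
  then show ?thesis using assms isomorphic_trans unfolding simple_classes_def by blast
qed

lemma subq_exists:
  assumes "A \<in> subs X" "B \<in> subs X" "A \<subseteq> B" shows "\<exists>Q. subq X A B Q"
  using subq_quotient_obj[OF assms] by blast

text \<open>One implication suffices: quotients exist and are unique up to isomorphism, and the
  classes of simple objects are closed under isomorphism.\<close>

lemma wt_cong:
  assumes "A \<in> subs X" "B \<in> subs X" "A \<subseteq> B" "A' \<in> subs Y"
    and t: "\<And>Q. subq X A B Q \<Longrightarrow> subq Y A' B' Q"
  shows "wt K X A B = wt K Y A' B'"
proof -
  have "(\<exists>Q \<in> K. subq X A B Q) \<longleftrightarrow> (\<exists>Q \<in> K. subq Y A' B' Q)" if K: "K \<in> simple_classes C"
  proof
    assume "\<exists>Q \<in> K. subq Y A' B' Q"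
    then obtain Q where Q: "Q \<in> K" "subq Y A' B' Q" by blast
    obtain R where R: "subq X A B R" using subq_exists[OF assms(1-3)] by blast
    then have "R \<in> K" using simple_classes_closed[OF K Q(1)] subq_unique[OF assms(4) Q(2) t[OF R]] by blast
    then show "\<exists>Q \<in> K. subq X A B Q" using R by blast
  qed (use t in blast)
  then show ?thesis unfolding wt_def by auto
qed

lemma wt_quotient_obj:
  assumes "A \<in> subs X" "B \<in> subs X" "A \<subseteq> B" "K \<in> simple_classes C"
  shows "wt K X A B = (if quotient_obj C (cls X B) (cls X A) \<in> K then 1 else 0)"
proof -
  have q: "subq X A B (quotient_obj C (cls X B) (cls X A))" using subq_quotient_obj[OF assms(1-3)] .
  then have "(\<exists>Q \<in> K. subq X A B Q) \<longleftrightarrow> quotient_obj C (cls X B) (cls X A) \<in> K"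
    using simple_classes_closed[OF assms(4)] subq_unique[OF assms(1)] by blast
  then show ?thesis using assms(4) unfolding wt_def by simp
qed

lemma coverD: "cover X A B \<Longrightarrow> A \<in> subs X" "cover X A B \<Longrightarrow> B \<in> subs X" "cover X A B \<Longrightarrow> A \<subset> B"
  "cover X A B \<Longrightarrow> D \<in> subs X \<Longrightarrow> A \<subseteq> D \<Longrightarrow> D \<subseteq> B \<Longrightarrow> D = A \<or> D = B"
  unfolding cover_def by blast+

text \<open>\<open>join X A (A' \<inter> M)\<close> lies between \<open>A\<close> and
  \<open>A'\<close>, so it is one of them. If it is \<open>A\<close>, the factor survives in the
  joins with \<open>M\<close>; if it is \<open>A'\<close>, it survives in the meets with
  \<open>M\<close>. The other interval collapses, and the factors agree by the second isomorphism
  theorem.\<close>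

lemma cover_split:
  assumes c: "cover X A A'" and M: "M \<in> subs X"
  shows "(A \<inter> M = A' \<inter> M \<and> cover X (join X A M) (join X A' M) \<and>
            wt K X A A' = wt K X (join X A M) (join X A' M)) \<or>
         (join X A M = join X A' M \<and> cover X (A \<inter> M) (A' \<inter> M) \<and>
            wt K X A A' = wt K X (A \<inter> M) (A' \<inter> M))"
proof -
  note A = coverD(1)[OF c] and A' = coverD(2)[OF c] and AA' = coverD(3)[OF c]
  have AM: "A \<inter> M \<in> subs X" and A'M: "A' \<inter> M \<in> subs X" using inter_subs A A' M by blast+
  have jAM: "join X A M \<in> subs X" and jA'M: "join X A' M \<in> subs X" using join_subs A A' M by blast+
  have J: "join X A (A' \<inter> M) \<in> subs X" using join_subs A A'M by blast
  have "join X A (A' \<inter> M) = A \<or> join X A (A' \<inter> M) = A'"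
    using coverD(4)[OF c J join_ub1[OF A A'M]] join_least[OF A', of A "A' \<inter> M"] AA' by blast
  then show ?thesis
  proof
    assume e: "join X A (A' \<inter> M) = A"
    then have sub: "A' \<inter> M \<subseteq> A" using join_ub2[OF A A'M] by blast
    have mA': "join X A M \<inter> A' = A" using modular[OF A M A'] AA' e by (simp add: Int_commute psubset_imp_subset)
    have le: "join X A M \<subseteq> join X A' M" using join_mono[OF A M A' M] AA' by blast
    have "cover X (join X A M) (join X A' M)" unfolding cover_def
    proof (intro conjI ballI impI)
      have "\<not> A' \<subseteq> join X A M" using mA' AA' by blast
      then show "join X A M \<subset> join X A' M" using le join_ub1[OF A' M] by blast
      fix D assume D: "D \<in> subs X" "join X A M \<subseteq> D \<and> D \<subseteq> join X A' M"
      have MD: "M \<subseteq> D" "A \<subseteq> D" using D join_ub1[OF A M] join_ub2[OF A M] by blast+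
      have DA: "D \<inter> A' \<in> subs X" using inter_subs D A' by blast
      have "D \<inter> A' = A \<or> D \<inter> A' = A'" using coverD(4)[OF c DA] MD AA' by blast
      then show "D = join X A M \<or> D = join X A' M"
      proof
        assume "D \<inter> A' = A"
        then have "join X M A' \<inter> D = join X M A" using modular[OF M A' D(1) MD(1)] by (simp add: Int_commute)
        then show ?thesis using D join_comm[OF M A] join_comm[OF M A'] by auto
      next
        assume "D \<inter> A' = A'"
        then have "join X A' M \<subseteq> D" using join_least[OF D(1)] MD by blast
        then show ?thesis using D by blast
      qed
    qed (use jAM jA'M in blast)+
    moreover have "wt K X A A' = wt K X (join X A M) (join X A' M)"
    proof (rule wt_cong[OF A A' _ jAM])
      show "A \<subseteq> A'" using AA' by blast
      fix Q assume Q: "subq X A A' Q"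
      have "A' \<inter> join X A M = A" using mA' by blast
      then have "subq X (join X A M) (join X A' (join X A M)) Q"
        using subq_second_iso[OF A' jAM] Q by simp
      moreover have "join X A' (join X A M) = join X A' M"
      proof
        show "join X A' (join X A M) \<subseteq> join X A' M" by (rule join_least[OF jA'M join_ub1[OF A' M] le])
        show "join X A' M \<subseteq> join X A' (join X A M)" by (rule join_mono[OF A' M A' jAM order.refl join_ub2[OF A M]])
      qed
      ultimately show "subq X (join X A M) (join X A' M) Q" by simp
    qed
    ultimately show ?thesis using sub AA' by blast
  next
    assume e: "join X A (A' \<inter> M) = A'"
    have "join X A M = join X A' M"
    proof
      show "join X A M \<subseteq> join X A' M" using join_mono[OF A M A' M] AA' by blast
      have "join X A (A' \<inter> M) \<subseteq> join X A M" by (rule join_mono[OF A A'M A M]) auto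
      then show "join X A' M \<subseteq> join X A M" using e by (intro join_least[OF jAM _ join_ub2[OF A M]]) simp
    qed
    moreover have "cover X (A \<inter> M) (A' \<inter> M)" unfolding cover_def
    proof (intro conjI ballI impI)
      have j: "join X A (A \<inter> M) = A" using join_absorb[OF AM A] join_comm[OF AM A] by simp
      have "A \<inter> M \<noteq> A' \<inter> M"
      proof
        assume "A \<inter> M = A' \<inter> M"
        then have "A = A'" using j e by metis
        then show False using AA' by simp
      qed
      then show "A \<inter> M \<subset> A' \<inter> M" using AA' by blast
      fix D assume D: "D \<in> subs X" "A \<inter> M \<subseteq> D \<and> D \<subseteq> A' \<inter> M"
      have AD: "join X A D \<in> subs X" using join_subs A D by blast
      have "join X A D = A \<or> join X A D = A'"
        using coverD(4)[OF c AD join_ub1[OF A D(1)]] join_least[OF A', of A D] AA' D by blast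
      then show "D = A \<inter> M \<or> D = A' \<inter> M"
      proof
        assume "join X A D = A"
        then have "D \<subseteq> A" using join_ub2[OF A D(1)] by blast
        then show ?thesis using D by blast
      next
        assume j: "join X A D = A'"
        have DM: "D \<subseteq> M" using D by blast
        have "A' \<inter> M = join X D A \<inter> M" using j join_comm[OF A D(1)] by simp
        also have "\<dots> = join X D (A \<inter> M)" using modular[OF D(1) A M DM] .
        also have "\<dots> = D" using join_absorb[OF AM D(1)] join_comm[OF AM D(1)] D by simp
        finally show ?thesis by blast
      qed
    qed (use AM A'M in blast)+
    moreover have "wt K X (A \<inter> M) (A' \<inter> M) = wt K X A A'"
    proof (rule wt_cong[OF AM A'M _ A])
      show "A \<inter> M \<subseteq> A' \<inter> M" using AA' by blast
      fix Q assume "subq X (A \<inter> M) (A' \<inter> M) Q"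
      moreover have "(A' \<inter> M) \<inter> A = A \<inter> M" using AA' by blast
      ultimately have "subq X A (join X (A' \<inter> M) A) Q" using subq_second_iso[OF A'M A] by simp
      then show "subq X A A' Q" using e join_comm[OF A A'M] by simp
    qed
    ultimately show ?thesis by simp
  qed
qed

lemma path_subs: "path K X A B v \<Longrightarrow> A \<in> subs X \<and> B \<in> subs X \<and> A \<subseteq> B"
  by (induction rule: path.induct) (auto dest: coverD)

text \<open>By \<open>cover_split\<close> each step survives in one of the two projections and
  becomes constant in the other, so the weights add up.\<close>

lemma path_split:
  assumes "path K X A B v" "M \<in> subs X"
  shows "\<exists>v1 v2. path K X (A \<inter> M) (B \<inter> M) v1 \<and> path K X (join X A M) (join X B M) v2 \<and> v = v1 + v2"
  using assms(1)
proof (induction rule: path.induct)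
  case (path_refl A)
  then show ?case
    using path.path_refl[OF inter_subs[OF path_refl assms(2)]]
      path.path_refl[OF join_subs[OF path_refl assms(2)]] by fastforce
next
  case (path_step A A' B v)
  then obtain v1 v2 where v: "path K X (A' \<inter> M) (B \<inter> M) v1" "path K X (join X A' M) (join X B M) v2" "v = v1 + v2"
    by blast
  from cover_split[OF path_step(1) assms(2), of K] show ?case
  proof
    assume a: "A \<inter> M = A' \<inter> M \<and> cover X (join X A M) (join X A' M) \<and>
            wt K X A A' = wt K X (join X A M) (join X A' M)"
    then have "path K X (join X A M) (join X B M) (wt K X A A' + v2)"
      using path.path_step[OF _ v(2)] by simp
    moreover have "path K X (A \<inter> M) (B \<inter> M) v1" using v a by simp
    ultimately show ?thesis using v(3) by fastforce
  next
    assume a: "join X A M = join X A' M \<and> cover X (A \<inter> M) (A' \<inter> M) \<and>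
            wt K X A A' = wt K X (A \<inter> M) (A' \<inter> M)"
    then have "path K X (A \<inter> M) (B \<inter> M) (wt K X A A' + v1)"
      using path.path_step[OF _ v(1)] by simp
    moreover have "path K X (join X A M) (join X B M) v2" using v a by simp
    ultimately show ?thesis using v(3) by fastforce
  qed
qed

lemma path_self: assumes "path K X A A v" shows "v = 0"
  using assms
proof (cases rule: path.cases)
  case (path_step A' v')
  then show ?thesis using path_subs[OF path_step(3)] coverD(3)[OF path_step(2)] by blast
qed

lemma path_cover: assumes "cover X A B" "path K X A B v" shows "v = wt K X A B"
  using assms(2)
proof (cases rule: path.cases)
  case path_refl
  then show ?thesis using coverD(3)[OF assms(1)] by blast
next
  case (path_step A' v')
  have A': "A' = B"
    using coverD(4)[OF assms(1) coverD(2)[OF path_step(2)]] coverD(3)[OF path_step(2)] path_subs[OF path_step(3)] by blast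
  then have "v' = 0" using path_self path_step(3) by blast
  then show ?thesis using path_step(1) A' by simp
qed

text \<open>The second path is split along \<open>A'\<close>, the end of the first step of the first
  path. The meets form a path over this single cover, and the joins form a path from
  \<open>A'\<close> to \<open>B\<close>, to which the induction hypothesis applies.\<close>

lemma path_unique: "path K X A B v \<Longrightarrow> path K X A B v' \<Longrightarrow> v = v'"
proof (induction arbitrary: v' rule: path.induct)
  case (path_refl A)
  then show ?case using path_self by blast
next
  case (path_step A A' B v)
  note A = coverD(1)[OF path_step(1)] and A' = coverD(2)[OF path_step(1)] and AA' = coverD(3)[OF path_step(1)]
  obtain v1 v2 where v: "path K X (A \<inter> A') (B \<inter> A') v1" "path K X (join X A A') (join X B A') v2" "v' = v1 + v2"
    using path_split[OF path_step(4) A'] by blast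
  have B: "B \<in> subs X" "A' \<subseteq> B" using path_subs[OF path_step(2)] by auto
  have "A \<inter> A' = A" "B \<inter> A' = A'" using AA' B by blast+
  moreover have "join X A A' = A'" using join_absorb[OF A A'] AA' by blast
  moreover have "join X B A' = B" using join_absorb[OF A' B(1,2)] join_comm[OF A' B(1)] by simp
  ultimately show ?case using path_step(3)[of v2] path_cover[OF path_step(1), of K v1] v by simp
qed

lemma path_append: "path K X A B v \<Longrightarrow> path K X B D u \<Longrightarrow> path K X A D (v + u)"
  by (induction rule: path.induct) (auto simp: add.assoc intro: path.path_step)

lemma mu_eq: "path K X A B v \<Longrightarrow> mu K X A B = v"
  unfolding mu_def using path_unique by blast

subsection \<open>Finite length\<close>

definition chain_bound :: "'o \<Rightarrow> nat \<Rightarrow> bool" where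
  "chain_bound X n \<longleftrightarrow> (\<forall>K \<subseteq> subs X. (\<forall>A \<in> K. \<forall>B \<in> K. A \<subseteq> B \<or> B \<subseteq> A) \<longrightarrow> finite K \<and> card K \<le> n)"

lemma finite_length_iff: "finite_length C X \<longleftrightarrow> X \<in> cobj C \<and> (\<exists>n. chain_bound X n)"
proof -
  have "(\<forall>K \<subseteq> carrier (Sub C X). (\<forall>M \<in> K. \<forall>N \<in> K. M \<sqsubseteq>\<^bsub>Sub C X\<^esub> N \<or> N \<sqsubseteq>\<^bsub>Sub C X\<^esub> M)
      \<longrightarrow> finite K \<and> card K \<le> n) \<longleftrightarrow> chain_bound X n" for n
    unfolding chain_bound_def carrier_Sub all_subset_image
  proof (rule all_cong1, rule imp_cong[OF refl])
    fix K assume K: "K \<subseteq> subs X"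
    have i: "inj_on (cls X) K" using inj_on_subset[OF cls_inj K] .
    have "(\<forall>M \<in> cls X ` K. \<forall>N \<in> cls X ` K. M \<sqsubseteq>\<^bsub>Sub C X\<^esub> N \<or> N \<sqsubseteq>\<^bsub>Sub C X\<^esub> M)
        \<longleftrightarrow> (\<forall>A \<in> K. \<forall>B \<in> K. A \<subseteq> B \<or> B \<subseteq> A)"
      using K by (auto simp: le_Sub subset_iff)
    then show "((\<forall>M \<in> cls X ` K. \<forall>N \<in> cls X ` K. M \<sqsubseteq>\<^bsub>Sub C X\<^esub> N \<or> N \<sqsubseteq>\<^bsub>Sub C X\<^esub> M)
        \<longrightarrow> finite (cls X ` K) \<and> card (cls X ` K) \<le> n)
      \<longleftrightarrow> ((\<forall>A \<in> K. \<forall>B \<in> K. A \<subseteq> B \<or> B \<subseteq> A) \<longrightarrow> finite K \<and> card K \<le> n)"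
      using finite_image_iff[OF i] card_image[OF i] by simp
  qed
  then show ?thesis unfolding finite_length_def by simp
qed

text \<open>The height of \<open>A\<close> is the largest size of a chain below it; such a chain
  extends by any \<open>B\<close> strictly above \<open>A\<close>. It serves as the termination
  measure for building paths.\<close>

lemma height_exists:
  assumes "chain_bound X n"
  shows "\<exists>h :: 'm set \<Rightarrow> nat. \<forall>A \<in> subs X. h A \<le> n \<and> (\<forall>B \<in> subs X. A \<subset> B \<longrightarrow> h A < h B)"
proof -
  define P where "P A K \<longleftrightarrow> K \<subseteq> subs X \<and> (\<forall>A \<in> K. \<forall>B \<in> K. A \<subseteq> B \<or> B \<subseteq> A) \<and> (\<forall>D \<in> K. D \<subseteq> A)" for A K
  have fin: "finite K \<and> card K \<le> n" if "P A K" for A K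
    using assms[unfolded chain_bound_def, rule_format, of K] that unfolding P_def by simp
  define h where "h A = Max (card ` {K. P A K})" for A
  have f: "finite (card ` {K. P A K})" for A
    by (rule finite_subset[of _ "{..n}"]) (use fin in auto)
  have ne: "card ` {K. P A K} \<noteq> {}" for A using P_def by (auto intro!: exI[of _ "{}"])
  have "h A \<in> card ` {K. P A K}" for A unfolding h_def using Max_in[OF f ne] .
  then have ex: "\<exists>K. P A K \<and> h A = card K" for A by blast
  have "h A < h B" if "A \<in> subs X" "B \<in> subs X" "A \<subset> B" for A B
  proof -
    obtain K where K: "P A K" "h A = card K" using ex by blast
    have "P B (insert B K)" using K(1) that unfolding P_def by blast
    then have "card (insert B K) \<le> h B" unfolding h_def using Max_ge[OF f] by blast
    moreover have "B \<notin> K" using K(1) that unfolding P_def by blast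
    ultimately show ?thesis using K fin by simp
  qed
  moreover have "h A \<le> n" for A using ex[of A] fin by metis
  ultimately show ?thesis by blast
qed

lemma path_exists:
  assumes "finite_length C X" "A \<in> subs X" "B \<in> subs X" "A \<subseteq> B"
  shows "\<exists>v. path K X A B v"
proof -
  obtain n where "chain_bound X n" using assms(1) finite_length_iff by blast
  then obtain h :: "'m set \<Rightarrow> nat" where h: "\<And>A. A \<in> subs X \<Longrightarrow> h A \<le> n"
    "\<And>A B. A \<in> subs X \<Longrightarrow> B \<in> subs X \<Longrightarrow> A \<subset> B \<Longrightarrow> h A < h B" using height_exists by metis
  show ?thesis using assms(2,4)
  proof (induction "n - h A" arbitrary: A rule: less_induct)
    case less
    show ?case
    proof (cases "A = B")
      case True
      then show ?thesis using path.path_refl assms(3) by blast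
    next
      case False
      \<comment> \<open>An element of least height among those strictly above \<open>A\<close> and
        inside \<open>B\<close> covers \<open>A\<close>.\<close>
      define S where "S = {D \<in> subs X. A \<subset> D \<and> D \<subseteq> B}"
      have "B \<in> S" unfolding S_def using assms(3) False less by blast
      then obtain D where D: "D \<in> S" "\<And>D'. D' \<in> S \<Longrightarrow> h D \<le> h D'"
        using ex_has_least_nat[of "\<lambda>D. D \<in> S" B h] by blast
      have Ds: "D \<in> subs X" "A \<subset> D" "D \<subseteq> B" using D(1) unfolding S_def by auto
      have "cover X A D" unfolding cover_def
      proof (intro conjI ballI impI)
        fix D' assume D': "D' \<in> subs X" "A \<subseteq> D' \<and> D' \<subseteq> D"
        show "D' = A \<or> D' = D"
        proof (rule ccontr)
          assume "\<not> (D' = A \<or> D' = D)"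
          then have "D' \<in> S" "D' \<subset> D" using D' Ds unfolding S_def by blast+
          then show False using D(2) h(2)[OF D'(1) Ds(1)] by fastforce
        qed
      qed (use less Ds in auto)
      moreover have "n - h D < n - h A" using h(2)[OF less(2) Ds(1,2)] h(1)[OF Ds(1)] by linarith
      then obtain v where "path K X D B v" using less(1) Ds by blast
      ultimately show ?thesis using path.path_step by blast
    qed
  qed
qed

lemma mu_path:
  assumes "finite_length C X" "A \<in> subs X" "B \<in> subs X" "A \<subseteq> B"
  shows "path K X A B (mu K X A B)"
  using path_exists[OF assms] mu_eq by metis

lemma mu_add:
  assumes "finite_length C X" "A \<in> subs X" "B \<in> subs X" "D \<in> subs X" "A \<subseteq> B" "B \<subseteq> D"
  shows "mu K X A D = mu K X A B + mu K X B D"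
  using mu_eq[OF path_append[OF mu_path[OF assms(1,2,3,5)] mu_path[OF assms(1,3,4,6)]]] .

lemma mu_self: "A \<in> subs X \<Longrightarrow> mu K X A A = 0"
  using mu_eq path.path_refl by blast

text \<open>A path from \<open>M \<inter> N\<close> to \<open>M\<close> is split along
  \<open>N\<close>: the meets are constant and the joins run from \<open>N\<close> to
  \<open>join X M N\<close>.\<close>

lemma mu_modular:
  assumes "finite_length C X" "M \<in> subs X" "N \<in> subs X"
  shows "mu K X (M \<inter> N) M = mu K X N (join X M N)"
proof -
  have MN: "M \<inter> N \<in> subs X" using inter_subs assms by blast
  obtain v1 v2 where v: "path K X (M \<inter> N \<inter> N) (M \<inter> N) v1" "path K X (join X (M \<inter> N) N) (join X M N) v2"
    "mu K X (M \<inter> N) M = v1 + v2"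
    using path_split[OF mu_path[OF assms(1) MN assms(2)] assms(3)] by blast
  have "M \<inter> N \<inter> N = M \<inter> N" by blast
  then have "v1 = 0" using v(1) path_self by simp
  moreover have "join X (M \<inter> N) N = N" using join_absorb[OF MN assms(3)] by blast
  ultimately show ?thesis using v mu_eq by simp
qed

subsection \<open>Composition series\<close>

inductive cseries :: "'o \<Rightarrow> 'm set list \<Rightarrow> bool" for X where
  single: "A \<in> subs X \<Longrightarrow> cseries X [A]"
| Cons: "cover X A A' \<Longrightarrow> cseries X (A' # Bs) \<Longrightarrow> cseries X (A # A' # Bs)"

lemma cseries_subs: "cseries X Bs \<Longrightarrow> set Bs \<subseteq> subs X \<and> Bs \<noteq> []"
  by (induction rule: cseries.induct) (auto dest: coverD)

lemma cseries_sorted: "cseries X Bs \<Longrightarrow> sorted_wrt (\<subset>) Bs"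
proof (induction rule: cseries.induct)
  case (Cons A A' Bs)
  then show ?case using coverD(3)[OF Cons(1)] by fastforce
qed simp

text \<open>An element comparable with the whole chain falls between two neighbours, and a cover
  leaves room only for these two.\<close>

lemma cseries_maximal:
  assumes "cseries X Bs" "N \<in> subs X" "\<forall>B \<in> set Bs. B \<subseteq> N \<or> N \<subseteq> B" "hd Bs \<subseteq> N" "N \<subseteq> last Bs"
  shows "N \<in> set Bs"
  using assms(1,3,4,5)
proof (induction rule: cseries.induct)
  case (Cons A A' Bs)
  show ?case
  proof (cases "A' \<subseteq> N")
    case False
    then have "N \<subseteq> A'" using Cons by auto
    then show ?thesis using coverD(4)[OF Cons(1) assms(2)] Cons by auto
  qed (use Cons in auto)
qed auto

lemma path_cseries:
  "path K X A B v \<Longrightarrow> \<exists>Bs. cseries X Bs \<and> hd Bs = A \<and> last Bs = B"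
proof (induction rule: path.induct)
  case (path_refl A)
  then show ?case using cseries.single by fastforce
next
  case (path_step A A' B v)
  then obtain Bs where Bs: "cseries X Bs" "hd Bs = A'" "last Bs = B" by blast
  then obtain Cs where "Bs = A' # Cs" using cseries_subs by (metis list.collapse)
  then have "cseries X (A # Bs) \<and> hd (A # Bs) = A \<and> last (A # Bs) = B"
    using Bs cseries.Cons[OF path_step(1)] by simp
  then show ?case by blast
qed

text \<open>Index 1 carries the factor of the first two entries; all later indices are those of the
  tail shifted by one.\<close>

lemma factor_count_Cons:
  "factor_count C (M # N # Ms) K =
    (if K \<in> simple_classes C \<and> quotient_obj C N M \<in> K then 1 else 0) + factor_count C (N # Ms) K"
proof (cases "K \<in> simple_classes C")
  case True
  define I where "I = {i. 0 < i \<and> i < length (N # Ms) \<and> quotient_obj C ((N # Ms) ! i) ((N # Ms) ! (i - 1)) \<in> K}"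
  have "{i. 0 < i \<and> i < length (M # N # Ms) \<and> quotient_obj C ((M # N # Ms) ! i) ((M # N # Ms) ! (i - 1)) \<in> K}
      = (if quotient_obj C N M \<in> K then {1} else {}) \<union> Suc ` I" (is "?L = ?R")
  proof (rule Set.set_eqI)
    fix i
    show "i \<in> ?L \<longleftrightarrow> i \<in> ?R"
    proof (cases i)
      case (Suc j)
      then show ?thesis by (cases j) (auto simp: I_def image_iff)
    qed auto
  qed
  moreover have "finite I" unfolding I_def by simp
  moreover have "card (Suc ` I) = card I" by (simp add: card_image)
  moreover have "1 \<notin> Suc ` I" by (auto simp: I_def)
  moreover have "factor_count C (N # Ms) K = int (card I)"
    unfolding factor_count_def I_def using True by (rule if_P)
  moreover have "factor_count C (M # N # Ms) K = int (card ?L)"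
    unfolding factor_count_def using True by (rule if_P)
  ultimately show ?thesis using True by simp
qed (simp add: factor_count_def)

lemma cseries_path:
  "cseries X Bs \<Longrightarrow> path K X (hd Bs) (last Bs) (factor_count C (map (cls X) Bs) K)"
proof (induction rule: cseries.induct)
  case (single A)
  have "{i. 0 < i \<and> i < length [cls X A] \<and> P i} = {}" for P by auto
  then have "factor_count C (map (cls X) [A]) K = 0" by (simp only: factor_count_def list.map) simp
  then show ?case using path.path_refl[OF single] by simp
next
  case (Cons A A' Bs)
  have "wt K X A A' = (if K \<in> simple_classes C \<and> quotient_obj C (cls X A') (cls X A) \<in> K then 1 else 0)"
  proof (cases "K \<in> simple_classes C")
    case True
    then show ?thesis
      using wt_quotient_obj[OF coverD(1,2)[OF Cons(1)] psubset_imp_subset[OF coverD(3)[OF Cons(1)]]] by simp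
  qed (simp add: wt_def)
  then show ?case using path.path_step[OF Cons(1), of K "last (A' # Bs)"] Cons(3) by (simp add: factor_count_Cons)
qed

text \<open>The zero subobject and the whole object are comparable with everything, so maximality
  puts them into the chain. Likewise a subobject between two neighbours is comparable with every
  entry, so neighbours form covers.\<close>

lemma composition_series_obtain:
  assumes "X \<in> cobj C" "composition_series C X Ms"
  obtains Bs where "Ms = map (cls X) Bs" "cseries X Bs" "hd Bs = bt X" "last Bs = tp X"
proof -
  have s: "set Ms \<subseteq> cls X ` subs X" using assms(2) unfolding composition_series_def carrier_Sub by blast
  define Bs where "Bs = map (inv_into (subs X) (cls X)) Ms"
  have "map (\<lambda>M. cls X (inv_into (subs X) (cls X) M)) Ms = Ms"
    by (rule map_idI) (rule f_inv_into_f[OF subsetD[OF s]])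
  moreover have "set Bs \<subseteq> subs X"
    unfolding Bs_def set_map by (rule image_subsetI) (rule inv_into_into[OF subsetD[OF s]])
  ultimately have Bs: "Ms = map (cls X) Bs" "set Bs \<subseteq> subs X"
    by (simp_all add: Bs_def comp_def)
  have so: "sorted_wrt (\<subset>) Bs"
  proof -
    have "sorted_wrt (\<lambda>A B. cls X A \<sqsubset>\<^bsub>Sub C X\<^esub> cls X B) Bs"
      using assms(2) Bs unfolding composition_series_def by (simp add: sorted_wrt_map)
    then show ?thesis
      by (rule sorted_wrt_mono_rel[rotated]) (use Bs lless_Sub in blast)
  qed
  have mx: "N \<in> set Bs" if N: "N \<in> subs X" "\<forall>B \<in> set Bs. B \<subseteq> N \<or> N \<subseteq> B" for N
  proof -
    have "cls X N \<in> set Ms"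
    proof -
      have "\<forall>M \<in> set Ms. M \<sqsubseteq>\<^bsub>Sub C X\<^esub> cls X N \<or> cls X N \<sqsubseteq>\<^bsub>Sub C X\<^esub> M"
        unfolding Bs(1) using N(2)
        by (auto simp: le_Sub[OF subsetD[OF Bs(2)] N(1)] le_Sub[OF N(1) subsetD[OF Bs(2)]])
      then show ?thesis using assms(2) N(1) unfolding composition_series_def carrier_Sub by blast
    qed
    then show ?thesis using Bs N(1) inj_on_image_mem_iff[OF cls_inj] by auto
  qed
  have b: "bt X \<in> set Bs" and t: "tp X \<in> set Bs"
    using mx bt_subs tp_subs bt_subset subset_tp Bs(2) assms(1) by (meson subset_iff)+
  then have ne: "Bs \<noteq> []" by auto
  have h: "hd Bs = bt X"
  proof (rule ccontr)
    assume "hd Bs \<noteq> bt X"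
    then have "hd Bs \<subset> bt X" using so b ne by (cases Bs) auto
    then show False using bt_subset Bs(2) ne by (metis hd_in_set psubsetE subset_iff)
  qed
  have l: "last Bs = tp X"
  proof (rule ccontr)
    assume a: "last Bs \<noteq> tp X"
    obtain Cs where Cs: "Bs = Cs @ [last Bs]" using ne by (metis append_butlast_last_id)
    then have "tp X \<in> set Cs" using t a by (metis Un_iff empty_iff insert_iff list.set set_append)
    then have "tp X \<subset> last Bs" using so Cs by (metis list.set_intros(1) sorted_wrt_append)
    then show False using subset_tp Bs(2) ne by (metis last_in_set psubsetE subset_iff)
  qed
  have cv: "cover X (Bs ! i) (Bs ! Suc i)" if i: "Suc i < length Bs" for i
    unfolding cover_def
  proof (intro conjI ballI impI)
    show "Bs ! i \<in> subs X" "Bs ! Suc i \<in> subs X" using Bs(2) i by auto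
    show "Bs ! i \<subset> Bs ! Suc i" using so i by (simp add: sorted_wrt_iff_nth_less)
    fix D assume D: "D \<in> subs X" "Bs ! i \<subseteq> D \<and> D \<subseteq> Bs ! Suc i"
    have le: "Bs ! j \<subseteq> Bs ! k" if "j \<le> k" "k < length Bs" for j k
      using so that by (metis le_neq_implies_less psubset_imp_subset sorted_wrt_iff_nth_less subset_refl)
    have "D \<in> set Bs"
    proof (rule mx[OF D(1)], rule ballI)
      fix B assume "B \<in> set Bs"
      then obtain j where j: "j < length Bs" "B = Bs ! j" by (metis in_set_conv_nth)
      show "B \<subseteq> D \<or> D \<subseteq> B"
      proof (cases "j \<le> i")
        case True then show ?thesis using le[of j i] j D i by auto
      next
        case False then show ?thesis using le[of "Suc i" j] j D by auto
      qed
    qed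
    then obtain j where j: "j < length Bs" "D = Bs ! j" by (metis in_set_conv_nth)
    have "\<not> j < i" using so j D i by (metis Suc_lessD psubset_subset_trans psubset_eq sorted_wrt_iff_nth_less)
    moreover have "\<not> Suc i < j" using so j D i by (metis psubset_subset_trans psubset_eq sorted_wrt_iff_nth_less)
    ultimately have "j = i \<or> j = Suc i" by linarith
    then show "D = Bs ! i \<or> D = Bs ! Suc i" using j by blast
  qed
  have "cseries X Bs" if "Bs \<noteq> []" "set Bs \<subseteq> subs X" "\<And>i. Suc i < length Bs \<Longrightarrow> cover X (Bs ! i) (Bs ! Suc i)" for Bs
    using that
  proof (induction Bs rule: induct_list012)
    case (2 x)
    then show ?case using cseries.single by simp
  next
    case (3 x y zs)
    have "cseries X (y # zs)" using 3(2) 3(4) 3(5)[of "Suc _"] by force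
    moreover have "cover X x y" using 3(5)[of 0] by simp
    ultimately show ?case using cseries.Cons by blast
  qed simp
  then show ?thesis using that Bs ne cv h l by blast
qed

lemma composition_series_map:
  assumes "cseries X Bs" "hd Bs = bt X" "last Bs = tp X"
  shows "composition_series C X (map (cls X) Bs)"
  unfolding composition_series_def
proof (intro conjI ballI impI)
  have Bs: "set Bs \<subseteq> subs X" using cseries_subs[OF assms(1)] by blast
  show "set (map (cls X) Bs) \<subseteq> carrier (Sub C X)" using Bs by (auto simp: carrier_Sub)
  have "sorted_wrt (\<lambda>A B. cls X A \<sqsubset>\<^bsub>Sub C X\<^esub> cls X B) Bs"
    by (rule sorted_wrt_mono_rel[OF _ cseries_sorted[OF assms(1)]]) (use Bs lless_Sub in blast)
  then show "sorted_wrt (\<lambda>M N. M \<sqsubset>\<^bsub>Sub C X\<^esub> N) (map (cls X) Bs)" by (simp add: sorted_wrt_map)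
  fix N assume N: "N \<in> carrier (Sub C X)"
    "\<forall>M \<in> set (map (cls X) Bs). M \<sqsubseteq>\<^bsub>Sub C X\<^esub> N \<or> N \<sqsubseteq>\<^bsub>Sub C X\<^esub> M"
  then obtain D where D: "D \<in> subs X" "N = cls X D" by (auto simp: carrier_Sub)
  have "\<forall>B \<in> set Bs. B \<subseteq> D \<or> D \<subseteq> B"
    using N(2) unfolding D(2)
    by (auto simp: le_Sub[OF subsetD[OF Bs] D(1)] le_Sub[OF D(1) subsetD[OF Bs]] simp del: subset_iff)
  then have "D \<in> set Bs"
    using cseries_maximal[OF assms(1) D(1)] assms(2,3) bt_subset[OF D(1)] subset_tp[OF D(1)] by simp
  then show "N \<in> set (map (cls X) Bs)" using D by simp
qed

text \<open>Every composition series is a path from \<open>bt X\<close> to \<open>tp X\<close>, so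
  all factor counts agree and the definite description in \<open>JH\<close> is justified.\<close>

theorem JH_eq_mu:
  assumes "finite_length C X" shows "JH C X = (\<lambda>K. mu K X (bt X) (tp X))"
proof -
  have X: "X \<in> cobj C" using assms unfolding finite_length_def by blast
  have bt: "bt X \<in> subs X" "tp X \<in> subs X" "bt X \<subseteq> tp X" using bt_subs tp_subs subset_tp X by auto
  have f: "factor_count C Ms = (\<lambda>K. mu K X (bt X) (tp X))" if "composition_series C X Ms" for Ms
  proof
    fix K
    obtain Bs where Bs: "Ms = map (cls X) Bs" "cseries X Bs" "hd Bs = bt X" "last Bs = tp X"
      using composition_series_obtain[OF X \<open>composition_series C X Ms\<close>] by metis
    show "factor_count C Ms K = mu K X (bt X) (tp X)"
      using mu_eq[OF cseries_path[OF Bs(2), of K]] Bs by simp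
  qed
  obtain Bs where "cseries X Bs" "hd Bs = bt X" "last Bs = tp X"
    using path_cseries[OF mu_path[OF assms bt]] by blast
  then have e: "\<exists>Ms. composition_series C X Ms" using composition_series_map by blast
  show ?thesis unfolding JH_def
  proof (rule the_equality)
    show "(\<exists>Ms. composition_series C X Ms) \<and>
      (\<forall>Ms. composition_series C X Ms \<longrightarrow> factor_count C Ms = (\<lambda>K. mu K X (bt X) (tp X)))"
      using e f by blast
  qed (use e f in blast)
qed

subsection \<open>Transfer along subquotients\<close>

lemma push_pull_monic:
  assumes "m \<in> H Y X" "monic C m" "D \<in> subs X" shows "push m (pull m D) = el m \<inter> D"
proof -
  have Y: "Y \<in> cobj C" using homs_obj assms by blast
  have "tp Y \<inter> pull m D = pull m D" using subset_tp[OF pull_subs[OF assms(1,3)]] by blast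
  then show ?thesis
    using push_pull_inter[OF assms(1) tp_subs[OF Y] assms(3)] push_tp_monic[OF assms(1,2)] by simp
qed

context
  fixes m e X Y Z
  assumes m: "m \<in> H Y X" "monic C m" and e: "e \<in> H Y Z" "epic C e"
begin

text \<open>\<open>Z\<close> is a quotient of the subobject \<open>Y\<close> of \<open>X\<close>. By
  the correspondence theorem, \<open>\<phi>\<close> embeds the subobjects of \<open>Z\<close> as an
  interval in those of \<open>X\<close>.\<close>

abbreviation \<phi> where "\<phi> D \<equiv> push m (pull e D)"

lemma phi_subs: "D \<in> subs Z \<Longrightarrow> \<phi> D \<in> subs X"
  using push_subs[OF m(1) pull_subs[OF e(1)]] by blast

lemma phi_inverse: "D \<in> subs Z \<Longrightarrow> push e (pull m (\<phi> D)) = D"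
  using pull_push_monic[OF m pull_subs[OF e(1)]] push_pull_epic[OF e] by simp

lemma phi_mono: "D \<subseteq> D' \<Longrightarrow> \<phi> D \<subseteq> \<phi> D'"
  using push_mono pull_mono by blast

lemma phi_le_iff: "D \<in> subs Z \<Longrightarrow> D' \<in> subs Z \<Longrightarrow> \<phi> D \<subseteq> \<phi> D' \<longleftrightarrow> D \<subseteq> D'"
  using phi_mono push_mono pull_mono phi_inverse by metis

lemma phi_inj: "inj_on \<phi> (subs Z)"
  using phi_inverse by (rule inj_on_inverseI)

text \<open>A subobject in this range contains the image of the kernel of \<open>e\<close> and lies
  in \<open>el m\<close>, so passing to \<open>Z\<close> and back loses nothing.\<close>

lemma phi_surj:
  assumes "A \<in> subs Z" "B \<in> subs Z" "D \<in> subs X" "\<phi> A \<subseteq> D" "D \<subseteq> \<phi> B"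
  shows "\<exists>D' \<in> subs Z. D = \<phi> D'"
proof -
  have pD: "pull m D \<in> subs Y" using pull_subs m assms by blast
  have Z: "Z \<in> cobj C" using homs_obj e by blast
  have "pull e A \<subseteq> pull m D"
    using pull_mono[OF assms(4), of m] pull_push_monic[OF m pull_subs[OF e(1) assms(1)]] by simp
  then have "pull e (bt Z) \<subseteq> pull m D" using pull_mono[OF bt_subset[OF assms(1)], of e] by blast
  then have "pull e (push e (pull m D)) = pull m D"
    using pull_push[OF e(1) pD] join_comm[OF pD pull_subs[OF e(1) bt_subs[OF Z]]]
      join_absorb[OF pull_subs[OF e(1) bt_subs[OF Z]] pD] by simp
  moreover have "D \<subseteq> el m"
    using assms(5) push_mono[OF subset_tp[OF pull_subs[OF e(1) assms(2)]], of m] push_tp_monic[OF m] by simp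
  ultimately have "D = \<phi> (push e (pull m D))" by (simp add: push_pull_monic[OF m assms(3)] Int_absorb1)
  then show ?thesis using push_subs[OF e(1) pD] by blast
qed

lemma phi_cover:
  assumes "cover Z A B" shows "cover X (\<phi> A) (\<phi> B)"
  unfolding cover_def
proof (intro conjI ballI impI)
  note A = coverD(1)[OF assms] and B = coverD(2)[OF assms] and AB = coverD(3)[OF assms]
  show "\<phi> A \<in> subs X" "\<phi> B \<in> subs X" using phi_subs A B by blast+
  show "\<phi> A \<subset> \<phi> B" using phi_le_iff[OF A B] phi_le_iff[OF B A] AB by blast
  fix D assume D: "D \<in> subs X" "\<phi> A \<subseteq> D \<and> D \<subseteq> \<phi> B"
  then obtain D' where D': "D' \<in> subs Z" "D = \<phi> D'" using phi_surj[OF A B] by blast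
  then have "A \<subseteq> D'" "D' \<subseteq> B" using D phi_le_iff A B by auto
  then show "D = \<phi> A \<or> D = \<phi> B" using coverD(4)[OF assms D'(1)] D' by blast
qed

lemma phi_path: "path K Z A B v \<Longrightarrow> path K X (\<phi> A) (\<phi> B) v"
proof (induction rule: path.induct)
  case (path_refl A)
  then show ?case using path.path_refl phi_subs by blast
next
  case (path_step A A' B v)
  have s: "A \<in> subs Z" "A' \<in> subs Z" "A \<subseteq> A'" using coverD[OF path_step(1)] by blast+
  have "wt K Z A A' = wt K X (\<phi> A) (\<phi> A')"
    by (rule wt_cong[OF s phi_subs[OF s(1)]]) (rule subq_transfer[OF m e s])
  then show ?case using path.path_step[OF phi_cover[OF path_step(1)] path_step(3)] by simp
qed

lemma phi_finite_length: assumes "finite_length C X" shows "finite_length C Z"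
proof -
  obtain n where n: "chain_bound X n" using assms finite_length_iff by blast
  have "chain_bound Z n" unfolding chain_bound_def
  proof (intro allI impI)
    fix K assume K: "K \<subseteq> subs Z" "\<forall>A \<in> K. \<forall>B \<in> K. A \<subseteq> B \<or> B \<subseteq> A"
    have i: "inj_on \<phi> K" using inj_on_subset[OF phi_inj K(1)] .
    have s: "\<phi> ` K \<subseteq> subs X" using K(1) phi_subs by blast
    have c: "\<forall>A \<in> \<phi> ` K. \<forall>B \<in> \<phi> ` K. A \<subseteq> B \<or> B \<subseteq> A"
      using K(2) phi_mono unfolding ball_simps(9) by meson
    have "finite (\<phi> ` K) \<and> card (\<phi> ` K) \<le> n"
      using mp[OF mp[OF spec[OF n[unfolded chain_bound_def]] s] c] .
    then show "finite K \<and> card K \<le> n" using finite_image_iff[OF i] card_image[OF i] by simp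
  qed
  then show ?thesis using finite_length_iff homs_obj[OF e(1)] by blast
qed

lemma phi_JH:
  assumes "finite_length C X" shows "JH C Z = (\<lambda>K. mu K X (\<phi> (bt Z)) (\<phi> (tp Z)))"
proof -
  have f: "finite_length C Z" using phi_finite_length assms by blast
  have Z: "Z \<in> cobj C" using homs_obj[OF e(1)] by blast
  have "mu K Z (bt Z) (tp Z) = mu K X (\<phi> (bt Z)) (\<phi> (tp Z))" for K
    using mu_eq[OF phi_path[OF mu_path[OF f bt_subs[OF Z] tp_subs[OF Z] bt_subset[OF tp_subs[OF Z]]]]] by simp
  then show ?thesis using JH_eq_mu[OF f] by simp
qed

end

lemma pull_bt_monic: assumes "g \<in> H X Y" "monic C g" shows "pull g (bt Y) = bt X"
proof -
  have o: "X \<in> cobj C" "Y \<in> cobj C" using homs_obj assms by blast+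
  have "bt X \<subseteq> pull g (bt Y)" using bt_subset[OF pull_subs[OF assms(1) bt_subs[OF o(2)]]] .
  then have "push g (bt X) = bt Y"
    using push_subset_iff[OF assms(1) bt_subs[OF o(1)] bt_subs[OF o(2)]]
      bt_subset[OF push_subs[OF assms(1) bt_subs[OF o(1)]]] by blast
  then show ?thesis using pull_push_monic[OF assms bt_subs[OF o(1)]] by simp
qed

lemma pull_tp: assumes "g \<in> H X Y" shows "pull g (tp Y) = tp X"
proof -
  have "x \<in> H W X \<Longrightarrow> g \<odot> x \<in> tp Y" for x W using mem_tp comp_homs[OF _ assms] by blast
  then show ?thesis unfolding pull_def homs_dom[OF assms] by (auto simp: tp_def)
qed

text \<open>The arrow \<open>u\<close> in \<open>subq\<close> may fail to be monic. With the
  inclusion of \<open>B\<close> there is a presentation of some quotient \<open>R\<close>, and the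
  isomorphism from \<open>R\<close> to \<open>Q\<close> carries it over to \<open>Q\<close>.\<close>

lemma subq_presentation:
  assumes A: "A \<in> subs X" and B: "B \<in> subs X" and AB: "A \<subseteq> B" and Q: "subq X A B Q"
  shows "\<exists>Y m e. m \<in> H Y X \<and> monic C m \<and> el m = B \<and> e \<in> H Y Q \<and> epic C e \<and> push m (pull e (bt Q)) = A"
proof -
  obtain Y m where m: "m \<in> H Y X" "monic C m" "B = el m" using subs_obtain[OF B] by metis
  obtain R c where c: "c \<in> H Y R" "epic C c" "pull m A = pull c (bt R)"
    using subs_pull_obtain[OF pull_subs[OF m(1) A]] by metis
  have "join X A (push m (tp Y)) = B"
    using push_tp_monic[OF m(1,2)] m(3) join_absorb[OF A B AB] by simp
  then have "subq X A B R" using subqI[OF m(1) c] by simp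
  then obtain g where g: "g \<in> H R Q" "iso_arr C g"
    using subq_unique[OF A _ Q] unfolding isomorphic_def by blast
  have "pull (g \<odot> c) (bt Q) = pull m A"
    using pull_comp[OF c(1) g(1)] pull_bt_monic[OF g(1) iso_monic[OF g(2,1)]] c(3) by simp
  then have "push m (pull (g \<odot> c) (bt Q)) = A"
    using push_pull_monic[OF m(1,2) A] AB m(3) by auto
  then show ?thesis
    using m comp_homs[OF c(1) g(1)] epic_comp[OF c(2,1) iso_epic[OF g(2,1)] g(1)] by metis
qed

lemma subq_JH:
  assumes "finite_length C X" "A \<in> subs X" "B \<in> subs X" "A \<subseteq> B" "subq X A B Q"
  shows "finite_length C Q" "JH C Q = (\<lambda>K. mu K X A B)"
proof -
  obtain Y m e where m: "m \<in> H Y X" "monic C m" "el m = B" and e: "e \<in> H Y Q" "epic C e"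
    and p: "push m (pull e (bt Q)) = A" using subq_presentation[OF assms(2-5)] by blast
  show "finite_length C Q" using phi_finite_length[OF m(1,2) e assms(1)] .
  have "push m (pull e (tp Q)) = B" using pull_tp[OF e(1)] push_tp_monic[OF m(1,2)] m(3) by simp
  then show "JH C Q = (\<lambda>K. mu K X A B)" using phi_JH[OF m(1,2) e assms(1)] p by simp
qed

lemma push_id: assumes "A \<in> subs X" shows "push (cid C X) A = A"
proof -
  have X: "X \<in> cobj C" using subs_obj assms by blast
  have "pull (cid C X) A = A"
    by (rule subs_eqI[OF pull_subs[OF id_homs[OF X] assms] assms])
      (metis mem_pull[OF id_homs[OF X]] id_left)
  then show ?thesis using push_pull_epic[OF id_homs[OF X] id_epic[OF X] assms] by simp
qed

text \<open>The image is the quotient of \<open>X\<close> by the kernel of \<open>g\<close>: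
  \<open>\<phi>\<close> is used with the identity as inclusion and the epic part of \<open>g\<close>
  as quotient map.\<close>

lemma image_JH:
  assumes "finite_length C X" "g \<in> H X Y"
  shows "finite_length C (image_obj C g)"
    "JH C (image_obj C g) = (\<lambda>K. mu K X (pull g (bt Y)) (tp X))"
proof -
  define m where "m = (SOME m. is_image C m g)"
  have "is_image C m g" unfolding m_def using someI_ex[OF image_exists[OF assms(2)]] .
  then obtain I e where I: "m \<in> H I Y" "monic C m" "e \<in> H X I" "epic C e" "g = m \<odot> e"
    using is_image_factor[OF assms(2)] by blast
  have io: "image_obj C g = I" unfolding image_obj_def m_def[symmetric] using homs_dom I(1) by metis
  have X: "X \<in> cobj C" and Io: "I \<in> cobj C" using homs_obj I by blast+
  note p = phi_finite_length[OF id_homs[OF X] id_monic[OF X] I(3,4) assms(1)]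
    phi_JH[OF id_homs[OF X] id_monic[OF X] I(3,4) assms(1)]
  show "finite_length C (image_obj C g)" using p(1) io by simp
  have "pull e (bt I) = pull g (bt Y)" using pull_comp[OF I(3,1)] pull_bt_monic[OF I(1,2)] I(5) by simp
  then show "JH C (image_obj C g) = (\<lambda>K. mu K X (pull g (bt Y)) (tp X))"
    using p(2) io pull_tp[OF I(3)] push_id[OF tp_subs[OF X]] push_id[OF pull_subs[OF I(3) bt_subs[OF Io]]]
    by simp
qed

lemma JH_simple_vectors: "finite_length C X \<Longrightarrow> JH C X \<in> simple_vectors C"
proof -
  assume f: "finite_length C X"
  have X: "X \<in> cobj C" using f unfolding finite_length_def by blast
  have z: "v = 0" if "path K X A B v" "K \<notin> simple_classes C" for K A B v
    using that by (induction rule: path.induct) (auto simp: wt_def)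
  have "mu K X (bt X) (tp X) = 0" if "K \<notin> simple_classes C" for K
    using z[OF mu_path[OF f bt_subs[OF X] tp_subs[OF X] bt_subset[OF tp_subs[OF X]]] that] .
  then show ?thesis unfolding simple_vectors_def using JH_eq_mu[OF f] by simp
qed

subsection \<open>Finite joins and filtered pairs\<close>

text \<open>The join is the intersection of all upper bounds; for infinite families it need not be a subobject.\<close>

definition Jn :: "'o \<Rightarrow> 'm set set \<Rightarrow> 'm set" where
  "Jn X \<A> = \<Inter>{D \<in> subs X. \<Union>\<A> \<subseteq> D}"

lemma Jn_least: "D \<in> subs X \<Longrightarrow> (\<And>A. A \<in> \<A> \<Longrightarrow> A \<subseteq> D) \<Longrightarrow> Jn X \<A> \<subseteq> D"
  unfolding Jn_def by blast

lemma Jn_upper: "A \<in> \<A> \<Longrightarrow> A \<subseteq> Jn X \<A>"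
  unfolding Jn_def by blast

lemma Jn_mono: "\<A> \<subseteq> \<B> \<Longrightarrow> Jn X \<A> \<subseteq> Jn X \<B>"
  unfolding Jn_def by blast

lemma Jn_subs:
  assumes "X \<in> cobj C" "finite \<A>" "\<A> \<subseteq> subs X" shows "Jn X \<A> \<in> subs X"
  using assms(2,3)
proof (induction rule: finite_induct)
  case empty
  have "Jn X {} = bt X"
  proof
    show "Jn X {} \<subseteq> bt X" by (rule Jn_least[OF bt_subs[OF assms(1)]]) simp
    show "bt X \<subseteq> Jn X {}" unfolding Jn_def using bt_subset by blast
  qed
  then show ?case using bt_subs[OF assms(1)] by simp
next
  case (insert A \<A>)
  then have A: "A \<in> subs X" and J: "Jn X \<A> \<in> subs X" by auto
  have "Jn X (insert A \<A>) = join X A (Jn X \<A>)"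
  proof
    show "Jn X (insert A \<A>) \<subseteq> join X A (Jn X \<A>)"
      using join_ub1[OF A J] join_ub2[OF A J] Jn_upper by (intro Jn_least[OF join_subs[OF A J]]) blast
    show "join X A (Jn X \<A>) \<subseteq> Jn X (insert A \<A>)"
    proof -
      have "join X A (Jn X \<A>) \<subseteq> D" if "D \<in> subs X" "\<Union>(insert A \<A>) \<subseteq> D" for D
        using that(2) by (intro join_least[OF that(1)] Jn_least[OF that(1)]) auto
      then show ?thesis unfolding Jn_def[of X "insert A \<A>"] by blast
    qed
  qed
  then show ?case using join_subs[OF A J] by simp
qed

lemma Jn_empty: "X \<in> cobj C \<Longrightarrow> Jn X {} = bt X"
  using Jn_least[OF bt_subs] bt_subset[OF Jn_subs] by (metis empty_iff empty_subsetI finite.emptyI subset_antisym)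

lemma Jn_Un:
  assumes "X \<in> cobj C" "finite \<A>" "\<A> \<subseteq> subs X" "finite \<B>" "\<B> \<subseteq> subs X"
  shows "Jn X (\<A> \<union> \<B>) = join X (Jn X \<A>) (Jn X \<B>)"
proof
  have s: "Jn X \<A> \<in> subs X" "Jn X \<B> \<in> subs X" using Jn_subs assms by blast+
  have u: "A \<subseteq> join X (Jn X \<A>) (Jn X \<B>)" if "A \<in> \<A> \<union> \<B>" for A
    using that join_ub1[OF s] join_ub2[OF s] Jn_upper by blast
  show "Jn X (\<A> \<union> \<B>) \<subseteq> join X (Jn X \<A>) (Jn X \<B>)"
    by (rule Jn_least[OF join_subs[OF s] u])
  have "Jn X (\<A> \<union> \<B>) \<in> subs X" using Jn_subs assms by simp
  then show "join X (Jn X \<A>) (Jn X \<B>) \<subseteq> Jn X (\<A> \<union> \<B>)"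
    by (rule join_least) (auto intro: Jn_mono[THEN subsetD, rotated])
qed

lemma Jn_chain:
  fixes \<rho> :: "nat set"
  assumes "finite \<rho>" "\<rho> \<noteq> {}" "\<And>i. i \<in> \<rho> \<Longrightarrow> A i \<in> subs X" "\<And>i j. i \<in> \<rho> \<Longrightarrow> j \<in> \<rho> \<Longrightarrow> i \<le> j \<Longrightarrow> A i \<subseteq> A j"
  shows "Jn X (A ` \<rho>) = A (Max \<rho>)"
proof
  have M: "Max \<rho> \<in> \<rho>" using assms by simp
  show "Jn X (A ` \<rho>) \<subseteq> A (Max \<rho>)"
    using assms(4)[OF _ M] Max_ge[OF assms(1)] by (intro Jn_least[OF assms(3)[OF M]]) blast
  show "A (Max \<rho>) \<subseteq> Jn X (A ` \<rho>)" using M by (intro Jn_upper) blast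
qed

text \<open>The key step towards complete distributivity: the sublattice generated by two finite
  chains in a modular lattice is distributive. The induction removes the largest member of the
  second chain.\<close>

lemma bifiltration_Inter:
  fixes P R :: "nat \<Rightarrow> 'm set" and \<D> :: "(nat \<times> nat) set set"
  assumes X: "X \<in> cobj C" and I: "finite I" and J: "finite J"
    and P: "\<And>i. i \<in> I \<Longrightarrow> P i \<in> subs X" and R: "\<And>j. j \<in> J \<Longrightarrow> R j \<in> subs X"
    and Pm: "\<And>i i'. i \<in> I \<Longrightarrow> i' \<in> I \<Longrightarrow> i \<le> i' \<Longrightarrow> P i \<subseteq> P i'"
    and Rm: "\<And>j j'. j \<in> J \<Longrightarrow> j' \<in> J \<Longrightarrow> j \<le> j' \<Longrightarrow> R j \<subseteq> R j'"
    and ne: "\<D> \<noteq> {}" and DIJ: "\<And>D. D \<in> \<D> \<Longrightarrow> D \<subseteq> I \<times> J"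
    and down: "\<And>D i j i' j'. \<lbrakk>D \<in> \<D>; (i, j) \<in> D; i' \<in> I; j' \<in> J; i' \<le> i; j' \<le> j\<rbrakk> \<Longrightarrow> (i', j') \<in> D"
  shows "(\<Inter>D \<in> \<D>. Jn X ((\<lambda>(i, j). P i \<inter> R j) ` D)) \<subseteq> Jn X ((\<lambda>(i, j). P i \<inter> R j) ` \<Inter>\<D>)"
proof -
  define F where "F = (\<lambda>(i, j). P i \<inter> R j)"
  \<comment> \<open>\<open>lo D l\<close> collects the pairs with second index below
    \<open>l\<close>, and \<open>row D l\<close> is the slice at \<open>l\<close>; the induction on
    \<open>l\<close> adds one slice at a time.\<close>
  define lo where "lo D l = {x \<in> D. snd x < l}" for D :: "(nat \<times> nat) set" and l
  define row where "row D l = {i. (i, l) \<in> D}" for D :: "(nat \<times> nat) set" and l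
  have fin: "finite D'" "F ` D' \<subseteq> subs X" if "D' \<subseteq> I \<times> J" for D'
    using finite_subset[OF that] I J that P R inter_subs unfolding F_def by auto
  have U: "Jn X (F ` D') \<in> subs X" if "D' \<subseteq> I \<times> J" for D'
    using Jn_subs[OF X _ fin(2)[OF that]] fin(1)[OF that] by blast
  have lo_sub: "lo D l \<subseteq> I \<times> J" if "D \<in> \<D>" for D l using DIJ[OF that] unfolding lo_def by blast
  have D0: "\<Inter>\<D> \<subseteq> I \<times> J" using ne DIJ by blast
  then have lo_D0: "lo (\<Inter>\<D>) l \<subseteq> I \<times> J" for l unfolding lo_def by blast
  have key: "z \<in> Jn X (F ` lo (\<Inter>\<D>) l)"
    if "z \<in> H W X" "\<And>D. D \<in> \<D> \<Longrightarrow> z \<in> Jn X (F ` lo D l)" for z W l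
    using that
  proof (induction l arbitrary: z W)
    case 0
    have "lo D 0 = {}" for D unfolding lo_def by simp
    then show ?case using 0 ne by auto
  next
    case (Suc l)
    have lo_Suc: "lo D (Suc l) = lo D l \<union> row D l \<times> {l}" for D
      unfolding lo_def row_def by (auto simp: less_Suc_eq)
    have rowI: "row D l \<subseteq> I" "row D l \<times> {l} \<subseteq> I \<times> J" if "D \<in> \<D>" for D
      using DIJ[OF that] unfolding row_def by auto
    show ?case
    proof (cases "l \<in> J")
      case False
      have "row D l = {}" if "D \<in> \<D>" for D using False DIJ[OF that] unfolding row_def by auto
      then have "lo D (Suc l) = lo D l" if "D \<in> \<D>" for D using lo_Suc that by simp
      moreover from this have "lo (\<Inter>\<D>) (Suc l) = lo (\<Inter>\<D>) l"
        using ne unfolding lo_def by blast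
      ultimately show ?thesis using Suc by simp
    next
      case True
      \<comment> \<open>Slices are initial segments of \<open>I\<close>, hence ordered by inclusion,
        so a slice of least cardinality is contained in all others.\<close>
      obtain E where E: "E \<in> \<D>" "\<And>D. D \<in> \<D> \<Longrightarrow> card (row E l) \<le> card (row D l)"
        using ex_has_least_nat[of "\<lambda>D. D \<in> \<D>" _ "\<lambda>D. card (row D l)"] ne by blast
      have Erow: "row E l \<subseteq> row D l" if D: "D \<in> \<D>" for D
      proof (rule ccontr)
        assume "\<not> row E l \<subseteq> row D l"
        then obtain i where i: "i \<in> row E l" "i \<notin> row D l" by blast
        have "row D l \<subseteq> row E l"
        proof
          fix i' assume i': "i' \<in> row D l"
          have "i \<in> I" "i' \<in> I" using i i' rowI(1)[OF E(1)] rowI(1)[OF D] by blast+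
          then show "i' \<in> row E l"
            using down[OF D _ _ True, of i' l i] down[OF E(1) _ _ True, of i l i'] i i'
            unfolding row_def by (cases "i \<le> i'") auto
        qed
        then have "row D l \<subset> row E l" using i by blast
        then have "card (row D l) < card (row E l)"
          by (rule psubset_card_mono[OF finite_subset[OF rowI(1)[OF E(1)] I]])
        then show False using E(2)[OF D] by simp
      qed
      define T where "T D = Jn X (F ` (row D l \<times> {l}))" for D
      have Ts: "T D \<in> subs X" if "D \<in> \<D>" for D unfolding T_def using U[OF rowI(2)[OF that]] .
      have dec: "Jn X (F ` lo D (Suc l)) = join X (Jn X (F ` lo D l)) (T D)" if "D \<in> \<D>" for D
        unfolding lo_Suc image_Un T_def
        by (rule Jn_Un[OF X]) (use fin[OF lo_sub[OF that]] fin[OF rowI(2)[OF that]] in auto)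
      define Jl where "Jl = {j \<in> J. j < l}"
      \<comment> \<open>\<open>B\<close> is the largest \<open>R j\<close> with
        \<open>j < l\<close>, or the zero subobject if there is none. It contains every lower part,
        and by modularity it cuts the part up to \<open>l\<close> back to the lower part.\<close>
      define B where "B = Jn X (R ` Jl)"
      have Bs: "B \<in> subs X" unfolding B_def by (rule Jn_subs[OF X]) (use J R Jl_def in auto)
      have loB: "Jn X (F ` lo D l) \<subseteq> B" if D: "D \<in> \<D>" for D
      proof (rule Jn_least[OF Bs])
        fix A assume "A \<in> F ` lo D l"
        then obtain i j where ij: "(i, j) \<in> D" "j < l" "A = P i \<inter> R j" unfolding F_def lo_def by auto
        then have "j \<in> Jl" using DIJ[OF D] unfolding Jl_def by blast
        then show "A \<subseteq> B" using ij Jn_upper[of "R j" "R ` Jl" X] unfolding B_def by blast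
      qed
      have TB: "T D \<inter> B \<subseteq> Jn X (F ` lo D l)" if D: "D \<in> \<D>" for D
      proof (cases "row D l = {} \<or> Jl = {}")
        case True
        then have "T D = bt X \<or> B = bt X"
        proof
          assume "row D l = {}"
          then show ?thesis unfolding T_def by (simp only: Jn_empty[OF X] Sigma_empty1 image_empty simp_thms)
        next
          assume "Jl = {}"
          then show ?thesis unfolding B_def by (simp only: Jn_empty[OF X] image_empty simp_thms)
        qed
        then show ?thesis using bt_subset[OF U[OF lo_sub[OF D]]] by blast
      next
        case False
        have fr: "finite (row D l)" using finite_subset[OF rowI(1)[OF D] I] .
        \<comment> \<open>\<open>T D\<close> is \<open>P i \<inter> R l\<close> and \<open>B\<close>
          is \<open>R j\<close>, so they meet inside \<open>P i \<inter> R j\<close>, which is a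
          generator of the lower part because \<open>D\<close> is down-closed.\<close>
        define i j where "i = Max (row D l)" and "j = Max Jl"
        have i: "i \<in> row D l" unfolding i_def using False fr by simp
        have "finite Jl" unfolding Jl_def using J by simp
        then have j: "j \<in> Jl" unfolding j_def using False by (intro Max_in) auto
        have "T D = Jn X ((\<lambda>i. P i \<inter> R l) ` row D l)"
          unfolding T_def F_def by (rule arg_cong[where f = "Jn X"]) auto
        also have "\<dots> = P i \<inter> R l" unfolding i_def
        proof (rule Jn_chain[OF fr])
          show "row D l \<noteq> {}" using False by blast
          show "P i \<inter> R l \<in> subs X" if "i \<in> row D l" for i
            using that rowI(1)[OF D] P R True inter_subs by blast
          show "P i \<inter> R l \<subseteq> P i' \<inter> R l" if "i \<in> row D l" "i' \<in> row D l" "i \<le> i'" for i i'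
            using that rowI(1)[OF D] Pm by blast
        qed
        finally have "T D \<subseteq> P i" by blast
        moreover have "B = R j" unfolding B_def j_def
          by (rule Jn_chain) (use False J R Rm Jl_def in auto)
        moreover have "(i, j) \<in> D"
          using down[OF D, of i l i j] i j rowI(1)[OF D] unfolding row_def Jl_def by auto
        then have "P i \<inter> R j \<in> F ` lo D l" using j unfolding lo_def F_def Jl_def by force
        ultimately show ?thesis using Jn_upper[of "P i \<inter> R j" "F ` lo D l" X] by blast
      qed
      have cut: "Jn X (F ` lo D (Suc l)) \<inter> B \<subseteq> Jn X (F ` lo D l)" if D: "D \<in> \<D>" for D
      proof -
        note L = U[OF lo_sub[OF D, of l]]
        have "join X (Jn X (F ` lo D l)) (T D) \<inter> B = join X (Jn X (F ` lo D l)) (T D \<inter> B)"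
          using modular[OF L Ts[OF D] Bs loB[OF D]] .
        also have "\<dots> \<subseteq> Jn X (F ` lo D l)" using join_least[OF L order.refl TB[OF D]] .
        finally show ?thesis using dec[OF D] by simp
      qed
      have "z \<in> join X (Jn X (F ` lo E l)) (T E)" using Suc(3)[OF E(1)] dec[OF E(1)] by simp
      \<comment> \<open>The component \<open>x\<close> in the smallest slice is split off. As
        \<open>T E\<close> lies in every one of the joins, so does \<open>y\<close>; moreover
        \<open>y\<close> lies in \<open>B\<close>, so \<open>cut\<close> moves it into every lower
        part, where the induction hypothesis applies.\<close>
      then obtain V p y x where z: "epic C p" "p \<in> H V W" "y \<in> Jn X (F ` lo E l)" "y \<in> H V X"
        "x \<in> T E" "x \<in> H V X" "z \<odot> p = y \<boxplus> x"
        using mem_join[OF Suc(2)] by blast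
      have TE: "T E \<subseteq> Jn X (F ` lo D (Suc l))" if "D \<in> \<D>" for D
        unfolding T_def lo_Suc using Erow[OF that] by (intro Jn_mono image_mono) blast
      have "y \<in> Jn X (F ` lo D l)" if D: "D \<in> \<D>" for D
      proof -
        note S = U[OF lo_sub[OF D, of "Suc l"]]
        have "y \<boxplus> x \<in> Jn X (F ` lo D (Suc l))"
          using subs_closed[OF S Suc(3)[OF D] Suc(2) z(2)] z(7) by simp
        then have "y \<in> Jn X (F ` lo D (Suc l))" using subs_diff'[OF S z(4,6)] TE[OF D] z(5) by blast
        then show ?thesis using cut[OF D] loB[OF E(1)] z(3) by blast
      qed
      then have "y \<in> Jn X (F ` lo (\<Inter>\<D>) l)" using Suc(1)[OF z(4)] by blast
      moreover have "lo (\<Inter>\<D>) l \<subseteq> lo (\<Inter>\<D>) (Suc l)" unfolding lo_def by auto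
      ultimately have y: "y \<in> Jn X (F ` lo (\<Inter>\<D>) (Suc l))" using Jn_mono[OF image_mono] by blast
      have "row E l \<times> {l} \<subseteq> lo (\<Inter>\<D>) (Suc l)" using Erow unfolding lo_def row_def by auto
      then have "x \<in> Jn X (F ` lo (\<Inter>\<D>) (Suc l))" using z(5) Jn_mono[OF image_mono] unfolding T_def by blast
      then have "z \<odot> p \<in> Jn X (F ` lo (\<Inter>\<D>) (Suc l))"
        using subs_add[OF U[OF lo_D0] z(4,6) y] z(7) by simp
      then show ?thesis using subs_local[OF U[OF lo_D0] Suc(2) z(1,2)] by blast
    qed
  qed
  obtain l where l: "\<forall>j \<in> J. j < l" using J finite_nat_set_iff_bounded by blast
  have lo_l: "lo D' l = D'" if "D' \<subseteq> I \<times> J" for D' using that l unfolding lo_def by auto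
  obtain E where E: "E \<in> \<D>" using ne by blast
  have "(\<Inter>D \<in> \<D>. Jn X (F ` D)) \<subseteq> Jn X (F ` \<Inter>\<D>)"
  proof
    fix z assume z: "z \<in> (\<Inter>D \<in> \<D>. Jn X (F ` D))"
    then have "z \<in> H (cdom C z) X" using subs_homs[OF U[OF DIJ[OF E]]] E by blast
    then have "z \<in> Jn X (F ` lo (\<Inter>\<D>) l)" by (rule key) (use z lo_l[OF DIJ] in auto)
    then show "z \<in> Jn X (F ` \<Inter>\<D>)" using lo_l[OF D0] by simp
  qed
  then show ?thesis unfolding F_def .
qed

end

section \<open>The category of diagrams\<close>

lemma homs_functor_cat:
  "t \<in> homs (functor_cat C) F G \<longleftrightarrow> is_nattrans C t \<and> nt_dom t = F \<and> nt_cod t = G"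
  by (simp add: functor_cat_def homs_iff)

lemma nattrans_eqI:
  "\<lbrakk>t \<in> homs (functor_cat C) F G; s \<in> homs (functor_cat C) F G; \<And>p. nt_at t p = nt_at s p\<rbrakk> \<Longrightarrow> t = s"
  by (simp add: homs_functor_cat nattrans.expand fun_eq_iff)

lemma nt_at_comp [simp]: "nt_at (t \<odot>\<^bsub>functor_cat C\<^esub> s) p = nt_at t p \<odot>\<^bsub>C\<^esub> nt_at s p"
  by (simp add: functor_cat_def)

lemma nt_at_id [simp]: "nt_at (cid (functor_cat C) F) p = cid C (on_obj F p)"
  by (simp add: functor_cat_def)

lemma nt_at_homs: "t \<in> homs (functor_cat C) F G \<Longrightarrow> nt_at t p \<in> homs C (on_obj F p) (on_obj G p)"
  by (auto simp: homs_functor_cat is_nattrans_def)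

lemma nt_natural:
  "t \<in> homs (functor_cat C) F G \<Longrightarrow> p \<le> q \<Longrightarrow>
    nt_at t q \<odot>\<^bsub>C\<^esub> on_le F p q = on_le G p q \<odot>\<^bsub>C\<^esub> nt_at t p"
  by (auto simp: homs_functor_cat is_nattrans_def)

lemma functor_le: "is_functor C F \<Longrightarrow> p \<le> q \<Longrightarrow> on_le F p q \<in> homs C (on_obj F p) (on_obj F q)"
  by (simp add: is_functor_def)

lemma functor_comp:
  "is_functor C F \<Longrightarrow> p \<le> q \<Longrightarrow> q \<le> r \<Longrightarrow> on_le F p r = on_le F q r \<odot>\<^bsub>C\<^esub> on_le F p q"
  by (simp add: is_functor_def)

lemma nt_functors:
  "t \<in> homs (functor_cat C) F G \<Longrightarrow> is_functor C F" "t \<in> homs (functor_cat C) F G \<Longrightarrow> is_functor C G"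
  by (auto simp: homs_functor_cat is_nattrans_def)

lemma NatTrans_homs:
  assumes "is_functor C F" "is_functor C G" "\<And>p. t p \<in> homs C (on_obj F p) (on_obj G p)"
    "\<And>p q. p \<le> q \<Longrightarrow> t q \<odot>\<^bsub>C\<^esub> on_le F p q = on_le G p q \<odot>\<^bsub>C\<^esub> t p"
  shows "NatTrans F t G \<in> homs (functor_cat C) F G"
  using assms by (simp add: homs_functor_cat is_nattrans_def)

context category
begin

lemma category_functor_cat: "category (functor_cat C :: (('p::order, 'o, 'm) diagram, ('p, 'o, 'm) nattrans) cat)"
proof
  let ?F = "functor_cat C :: (('p, 'o, 'm) diagram, ('p, 'o, 'm) nattrans) cat"
  show "cdom ?F g \<in> cobj ?F" if "g \<in> carr ?F" for g
    using that by (simp add: functor_cat_def is_nattrans_def)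
  show "ccod ?F g \<in> cobj ?F" if "g \<in> carr ?F" for g
    using that by (simp add: functor_cat_def is_nattrans_def)
  show "cid ?F X \<in> homs ?F X X" if "X \<in> cobj ?F" for X
  proof -
    have X: "is_functor C X" using that by (simp add: functor_cat_def)
    then have o: "on_obj X p \<in> cobj C" for p by (simp add: is_functor_def)
    have "NatTrans X (\<lambda>p. cid C (on_obj X p)) X \<in> homs ?F X X"
      by (rule NatTrans_homs[OF X X id_homs[OF o]])
        (simp add: id_left[OF functor_le[OF X]] id_right[OF functor_le[OF X]])
    then show ?thesis by (simp add: functor_cat_def)
  qed
  show comp: "h \<odot>\<^bsub>?F\<^esub> g \<in> homs ?F X Z" if g: "g \<in> homs ?F X Y" and h: "h \<in> homs ?F Y Z" for g h X Y Z
  proof -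
    have "NatTrans X (\<lambda>p. nt_at h p \<odot> nt_at g p) Z \<in> homs ?F X Z"
    proof (rule NatTrans_homs[OF nt_functors(1)[OF g] nt_functors(2)[OF h] comp_homs[OF nt_at_homs[OF g] nt_at_homs[OF h]]])
      fix p q :: 'p assume pq: "p \<le> q"
      note t = functor_le[OF nt_functors(1)[OF g] pq] functor_le[OF nt_functors(2)[OF g] pq]
        functor_le[OF nt_functors(2)[OF h] pq] nt_at_homs[OF g] nt_at_homs[OF h]
      have "(nt_at h q \<odot> nt_at g q) \<odot> on_le X p q = nt_at h q \<odot> nt_at g q \<odot> on_le X p q"
        using assoc[OF t(1,4,5)] .
      also have "\<dots> = nt_at h q \<odot> on_le Y p q \<odot> nt_at g p" using nt_natural[OF g pq] by simp
      also have "\<dots> = (nt_at h q \<odot> on_le Y p q) \<odot> nt_at g p" using assoc[OF t(4,2,5)] by simp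
      also have "\<dots> = (on_le Z p q \<odot> nt_at h p) \<odot> nt_at g p" using nt_natural[OF h pq] by simp
      also have "\<dots> = on_le Z p q \<odot> nt_at h p \<odot> nt_at g p" using assoc[OF t(4,5,3)] .
      finally show "(nt_at h q \<odot> nt_at g q) \<odot> on_le X p q = on_le Z p q \<odot> nt_at h p \<odot> nt_at g p" .
    qed
    moreover have "nt_dom g = X" "nt_cod h = Z" using g h by (simp_all add: homs_functor_cat)
    ultimately show ?thesis by (simp add: functor_cat_def)
  qed
  show "(k \<odot>\<^bsub>?F\<^esub> h) \<odot>\<^bsub>?F\<^esub> g = k \<odot>\<^bsub>?F\<^esub> h \<odot>\<^bsub>?F\<^esub> g"
    if g: "g \<in> homs ?F W X" and h: "h \<in> homs ?F X Y" and k: "k \<in> homs ?F Y Z" for g h k W X Y Z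
    by (rule nattrans_eqI[OF comp[OF g comp[OF h k]] comp[OF comp[OF g h] k]])
      (simp add: assoc[OF nt_at_homs[OF g] nt_at_homs[OF h] nt_at_homs[OF k]])
  show "g \<odot>\<^bsub>?F\<^esub> cid ?F X = g" if g: "g \<in> homs ?F X Y" for g X Y
  proof -
    have "nt_dom g = X" "nt_cod g = Y" using g by (simp_all add: homs_functor_cat)
    then show ?thesis
      by (intro nattrans.expand) (simp add: functor_cat_def id_right[OF nt_at_homs[OF g]] fun_eq_iff)
  qed
  show "cid ?F Y \<odot>\<^bsub>?F\<^esub> g = g" if g: "g \<in> homs ?F X Y" for g X Y
  proof -
    have "nt_dom g = X" "nt_cod g = Y" using g by (simp_all add: homs_functor_cat)
    then show ?thesis
      by (intro nattrans.expand) (simp add: functor_cat_def id_left[OF nt_at_homs[OF g]] fun_eq_iff)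
  qed
qed

end

section \<open>Subobjects of diagrams as families of subobjects\<close>

context abcat
begin

text \<open>\<open>subf\<close> and \<open>fcls\<close> play for diagrams the roles of
  \<open>subs\<close> and \<open>cls\<close>; the second condition makes the family stable under the
  structure maps.\<close>

definition subf :: "('p::order, 'o, 'm) diagram \<Rightarrow> ('p \<Rightarrow> 'm set) \<Rightarrow> bool" where
  "subf F A \<longleftrightarrow> (\<forall>p. A p \<in> subs (on_obj F p)) \<and>
     (\<forall>p q. p \<le> q \<longrightarrow> A p \<subseteq> pull (on_le F p q) (A q))"

definition fcls :: "('p::order, 'o, 'm) diagram \<Rightarrow> ('p \<Rightarrow> 'm set) \<Rightarrow> ('p, 'o, 'm) nattrans set" where
  "fcls F A = {t \<in> monos_into (functor_cat C) F. \<forall>p. el (nt_at t p) = A p}"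

lemma functor_obj: "is_functor C F \<Longrightarrow> on_obj F p \<in> cobj C"
  by (simp add: is_functor_def)

lemma subf_subs: "subf F A \<Longrightarrow> A p \<in> subs (on_obj F p)"
  by (simp add: subf_def)

text \<open>The structure maps are restrictions of those of \<open>F\<close>. They exist because the
  family is stable, and functoriality follows by cancelling the monomorphisms
  \<open>m p\<close>.\<close>

lemma subfunctor_construct:
  assumes F: "is_functor C F" and A: "subf F A"
    and m: "\<And>p. m p \<in> H (M p) (on_obj F p)" "\<And>p. monic C (m p)" "\<And>p. el (m p) = A p"
  shows "\<exists>G. NatTrans G m F \<in> homs (functor_cat C) G F \<and> on_obj G = M"
proof -
  have "\<exists>h. h \<in> H (M p) (M q) \<and> on_le F p q \<odot> m p = m q \<odot> h" if "p \<le> q" for p q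
  proof -
    have Fm: "on_le F p q \<odot> m p \<in> H (M p) (on_obj F q)" using comp_homs[OF m(1) functor_le[OF F that]] .
    have "m p \<in> pull (on_le F p q) (A q)"
      using self_mem_el[OF m(1)] m(3) A that unfolding subf_def by blast
    then have "on_le F p q \<odot> m p \<in> el (m q)" using mem_pull[OF functor_le[OF F that] m(1)] m(3) by simp
    then show ?thesis using el_obtain[OF m(1) _ Fm] by metis
  qed
  then obtain h where h: "\<And>p q. p \<le> q \<Longrightarrow> h p q \<in> H (M p) (M q)"
    "\<And>p q. p \<le> q \<Longrightarrow> on_le F p q \<odot> m p = m q \<odot> h p q" by metis
  \<comment> \<open>\<open>is_functor\<close> fixes the value at unordered pairs to be
    \<open>undefined\<close>.\<close>
  define G where "G = Diagram M (\<lambda>p q. if p \<le> q then h p q else undefined)"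
  have G: "on_obj G = M" "\<And>p q. p \<le> q \<Longrightarrow> on_le G p q = h p q" by (simp_all add: G_def)
  have Mo: "M p \<in> cobj C" for p using homs_obj[OF m(1)] by blast
  have "is_functor C G" unfolding is_functor_def
  proof (intro conjI allI impI)
    show "on_obj G p \<in> cobj C" for p using Mo G by simp
    show "on_le G p q \<in> H (on_obj G p) (on_obj G q)" if "p \<le> q" for p q using that h G by simp
    show "on_le G p q = undefined" if "\<not> p \<le> q" for p q using that by (simp add: G_def)
    show "on_le G p p = cid C (on_obj G p)" for p
    proof -
      have "m p \<odot> h p p = m p \<odot> cid C (M p)"
        using h(2)[of p p] F id_left[OF m(1)] id_right[OF m(1)] by (simp add: is_functor_def)
      then show ?thesis using monic_cancel[OF m(2,1) h(1) id_homs[OF Mo]] G by simp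
    qed
    show "on_le G p r = on_le G q r \<odot> on_le G p q" if pqr: "p \<le> q \<and> q \<le> r" for p q r
    proof -
      have le: "p \<le> q" "q \<le> r" "p \<le> r" using pqr by auto
      note a = functor_le[OF F le(1)] functor_le[OF F le(2)]
      have "m r \<odot> h p r = (on_le F q r \<odot> on_le F p q) \<odot> m p"
        using h(2)[OF le(3)] functor_comp[OF F le(1,2)] by simp
      also have "\<dots> = on_le F q r \<odot> m q \<odot> h p q" using assoc[OF m(1) a] h(2)[OF le(1)] by simp
      also have "\<dots> = (m r \<odot> h q r) \<odot> h p q" using assoc[OF h(1)[OF le(1)] m(1) a(2)] h(2)[OF le(2)] by simp
      also have "\<dots> = m r \<odot> h q r \<odot> h p q" using assoc[OF h(1)[OF le(1)] h(1)[OF le(2)] m(1)] .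
      finally have "h p r = h q r \<odot> h p q"
        using monic_cancel[OF m(2,1) h(1)[OF le(3)] comp_homs[OF h(1)[OF le(1)] h(1)[OF le(2)]]] by simp
      then show ?thesis using G le by simp
    qed
  qed
  then have "NatTrans G m F \<in> homs (functor_cat C) G F"
    using F m(1) h(2) G by (intro NatTrans_homs) simp_all
  then show ?thesis using G by blast
qed

lemma subf_mono_exists:
  assumes F: "is_functor C F" and A: "subf F A"
  obtains G m where "NatTrans G m F \<in> homs (functor_cat C) G F" "\<And>p. monic C (m p)" "\<And>p. el (m p) = A p"
proof -
  have "\<exists>M m. m \<in> H M (on_obj F p) \<and> monic C m \<and> el m = A p" for p
    using subs_obtain[OF subf_subs[OF A]] by metis
  then obtain M m where m: "\<And>p. m p \<in> H (M p) (on_obj F p)" "\<And>p. monic C (m p)" "\<And>p. el (m p) = A p"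
    by metis
  then show ?thesis using that subfunctor_construct[OF F A m] by blast
qed

lemma nul_nattrans:
  assumes "is_functor C F" "is_functor C G"
  shows "NatTrans F (\<lambda>p. nul (on_obj F p) (on_obj G p)) G \<in> homs (functor_cat C) F G"
proof (rule NatTrans_homs[OF assms])
  show "nul (on_obj F p) (on_obj G p) \<in> H (on_obj F p) (on_obj G p)" for p
    using nul_homs functor_obj assms by blast
  show "nul (on_obj F q) (on_obj G q) \<odot> on_le F p q = on_le G p q \<odot> nul (on_obj F p) (on_obj G p)"
    if "p \<le> q" for p q
    using nul_comp[OF functor_le[OF assms(1) that] functor_obj[OF assms(2)]]
      comp_nul[OF functor_le[OF assms(2) that] functor_obj[OF assms(1)]] by simp
qed

lemma zero_functor_exists:
  "\<exists>Z :: ('p::order, 'o, 'm) diagram. zero_object (functor_cat C) Z \<and> is_functor C Z \<and> (\<forall>p. zero_object C (on_obj Z p))"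
proof -
  obtain Z where Z: "zero_object C Z" using zero_ex by blast
  then have Zo: "Z \<in> cobj C" by (simp add: zero_object_def)
  define N :: "('p, 'o, 'm) diagram" where "N = Diagram (\<lambda>_. Z) (\<lambda>p q. if p \<le> q then cid C Z else undefined)"
  have N0: "is_functor C N" "\<And>p. on_obj N p = Z"
    using Zo id_homs[OF Zo] id_left[OF id_homs[OF Zo]] by (auto simp: N_def is_functor_def)
  have z: "t = nul X Z" if "t \<in> H X Z" for t X
    using Z that nul_homs[OF homs_obj(1)[OF that] Zo] homs_obj(1)[OF that] unfolding zero_object_def by blast
  have z': "t = nul Z X" if "t \<in> H Z X" for t X
    using Z that nul_homs[OF Zo homs_obj(2)[OF that]] homs_obj(2)[OF that] unfolding zero_object_def by blast
  have "zero_object (functor_cat C) N" unfolding zero_object_def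
  proof (intro conjI ballI)
    show "N \<in> cobj (functor_cat C)" using N0 by (simp add: functor_cat_def)
    fix F :: "('p, 'o, 'm) diagram" assume "F \<in> cobj (functor_cat C)"
    then have F: "is_functor C F" by (simp add: functor_cat_def)
    show "\<exists>!g. g \<in> homs (functor_cat C) F N"
    proof (rule ex1I, rule nul_nattrans[OF F N0(1)])
      fix t assume t: "t \<in> homs (functor_cat C) F N"
      show "t = NatTrans F (\<lambda>p. nul (on_obj F p) (on_obj N p)) N"
        by (rule nattrans_eqI[OF t nul_nattrans[OF F N0(1)]])
          (use z nt_at_homs[OF t] N0(2) in simp)
    qed
    show "\<exists>!g. g \<in> homs (functor_cat C) N F"
    proof (rule ex1I, rule nul_nattrans[OF N0(1) F])
      fix t assume t: "t \<in> homs (functor_cat C) N F"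
      show "t = NatTrans N (\<lambda>p. nul (on_obj N p) (on_obj F p)) F"
        by (rule nattrans_eqI[OF t nul_nattrans[OF N0(1) F]])
          (use z' nt_at_homs[OF t] N0(2) in simp)
    qed
  qed
  then show ?thesis using N0 Z by auto
qed

lemma zero_arr_functor_iff:
  fixes F G :: "('p::order, 'o, 'm) diagram"
  assumes t: "t \<in> homs (functor_cat C) F G"
  shows "zero_arr (functor_cat C) t \<longleftrightarrow> (\<forall>p. nt_at t p = nul (on_obj F p) (on_obj G p))"
proof
  note FG = nt_functors[OF t]
  obtain N :: "('p, 'o, 'm) diagram" where N0: "zero_object (functor_cat C) N" "is_functor C N" "\<And>p. zero_object C (on_obj N p)"
    using zero_functor_exists by blast
  {
    assume "zero_arr (functor_cat C) t"
    then obtain Z u v where z: "zero_object (functor_cat C) Z" "u \<in> homs (functor_cat C) F Z"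
      "v \<in> homs (functor_cat C) Z G" "t = v \<odot>\<^bsub>functor_cat C\<^esub> u"
      unfolding zero_arr_def homs_dom[OF t] homs_cod[OF t] by blast
    have "F \<in> cobj (functor_cat C)" using FG by (simp add: functor_cat_def)
    then have "\<exists>!g. g \<in> homs (functor_cat C) F Z" using z(1) unfolding zero_object_def by blast
    then have "u = NatTrans F (\<lambda>p. nul (on_obj F p) (on_obj Z p)) Z"
      using z(2) nul_nattrans[OF FG(1) nt_functors(2)[OF z(2)]] by blast
    then show "\<forall>p. nt_at t p = nul (on_obj F p) (on_obj G p)"
      using z(4) comp_nul[OF nt_at_homs[OF z(3)] functor_obj[OF FG(1)]] by simp
  }
  assume n: "\<forall>p. nt_at t p = nul (on_obj F p) (on_obj G p)"
  define u v where "u = NatTrans F (\<lambda>p. nul (on_obj F p) (on_obj N p)) N"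
    and "v = NatTrans N (\<lambda>p. nul (on_obj N p) (on_obj G p)) G"
  have uv: "u \<in> homs (functor_cat C) F N" "v \<in> homs (functor_cat C) N G"
    unfolding u_def v_def using nul_nattrans FG N0 by blast+
  have "t = v \<odot>\<^bsub>functor_cat C\<^esub> u"
  proof (rule nattrans_eqI[OF t category.comp_homs[OF category_functor_cat uv]])
    show "nt_at t p = nt_at (v \<odot>\<^bsub>functor_cat C\<^esub> u) p" for p
      using n nul_comp[OF nul_homs[OF functor_obj[OF FG(1)] functor_obj[OF N0(2)]] functor_obj[OF FG(2)]]
      by (simp add: u_def v_def)
  qed
  then show "zero_arr (functor_cat C) t"
    unfolding zero_arr_def homs_dom[OF t] homs_cod[OF t] using uv N0(1) homs_carr[OF t] by blast
qed

lemma pull_bt_subset_monic: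
  assumes "g \<in> H X Y" "pull g (bt Y) \<subseteq> bt X" shows "monic C g"
proof (subst monic_iff[OF assms(1)], intro allI ballI impI)
  fix W x assume x: "x \<in> H W X" "g \<odot> x = nul W Y"
  then have "x \<in> pull g (bt Y)" using mem_pull[OF assms(1) x(1)] mem_bt[OF comp_homs[OF x(1) assms(1)]] by simp
  then show "x = nul W X" using assms(2) mem_bt[OF x(1)] by blast
qed

text \<open>For the forward direction the pointwise kernels are assembled into a subfunctor. Its
  inclusion and the zero transformation agree after \<open>t\<close>, so the inclusion is zero and
  every pointwise kernel is trivial.\<close>

lemma monic_functor_iff:
  fixes F G :: "('p::order, 'o, 'm) diagram"
  assumes t: "t \<in> homs (functor_cat C) F G"
  shows "monic (functor_cat C) t \<longleftrightarrow> (\<forall>p. monic C (nt_at t p))"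
proof
  note FG = nt_functors[OF t]
  assume mt: "monic (functor_cat C) t"
  define A where "A p = pull (nt_at t p) (bt (on_obj G p))" for p
  have "subf F A" unfolding subf_def
  proof (intro conjI allI impI)
    show As: "A p \<in> subs (on_obj F p)" for p
      unfolding A_def using pull_subs[OF nt_at_homs[OF t] bt_subs[OF functor_obj[OF FG(2)]]] .
    fix p q :: 'p assume pq: "p \<le> q"
    have "A p \<subseteq> pull (nt_at t p) (pull (on_le G p q) (bt (on_obj G q)))"
      unfolding A_def
      by (rule pull_mono, rule bt_subset, rule pull_subs[OF functor_le[OF FG(2) pq] bt_subs[OF functor_obj[OF FG(2)]]])
    also have "\<dots> = pull (on_le F p q) (A q)"
      unfolding A_def pull_comp[OF nt_at_homs[OF t] functor_le[OF FG(2) pq], symmetric]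
        pull_comp[OF functor_le[OF FG(1) pq] nt_at_homs[OF t], symmetric] nt_natural[OF t pq] ..
    finally show "A p \<subseteq> pull (on_le F p q) (A q)" .
  qed
  then obtain K k where k: "NatTrans K k F \<in> homs (functor_cat C) K F" "\<And>p. el (k p) = A p"
    using subf_mono_exists[OF FG(1)] by metis
  define z where "z = NatTrans K (\<lambda>p. nul (on_obj K p) (on_obj F p)) F"
  have z: "z \<in> homs (functor_cat C) K F" unfolding z_def using nul_nattrans nt_functors[OF k(1)] by blast
  have kp: "k p \<in> H (on_obj K p) (on_obj F p)" for p using nt_at_homs[OF k(1), of p] by simp
  have Ko: "on_obj K p \<in> cobj C" for p using homs_obj[OF kp] by blast
  have "t \<odot>\<^bsub>functor_cat C\<^esub> NatTrans K k F = t \<odot>\<^bsub>functor_cat C\<^esub> z"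
  proof (rule nattrans_eqI[OF category.comp_homs[OF category_functor_cat k(1) t] category.comp_homs[OF category_functor_cat z t]])
    fix p
    have "k p \<in> A p" using self_mem_el[OF kp] k(2) by simp
    then have "nt_at t p \<odot> k p = nul (on_obj K p) (on_obj G p)"
      unfolding A_def mem_pull[OF nt_at_homs[OF t] kp] using mem_bt[OF comp_homs[OF kp nt_at_homs[OF t]]] by simp
    then show "nt_at (t \<odot>\<^bsub>functor_cat C\<^esub> NatTrans K k F) p = nt_at (t \<odot>\<^bsub>functor_cat C\<^esub> z) p"
      using comp_nul[OF nt_at_homs[OF t] Ko] by (simp add: z_def)
  qed
  then have "NatTrans K k F = z"
    using category.monic_cancel[OF category_functor_cat mt t k(1) z] by simp
  then have kn: "k p = nul (on_obj K p) (on_obj F p)" for p by (simp add: z_def)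
  show "\<forall>p. monic C (nt_at t p)"
  proof
    fix p
    have "el (k p) \<subseteq> bt (on_obj F p)"
    proof
      fix x assume "x \<in> el (k p)"
      then obtain W h where h: "h \<in> H W (on_obj K p)" "x = k p \<odot> h" using mem_el_iff[OF kp] by blast
      then have "x = nul W (on_obj F p)" using kn nul_comp[OF h(1) functor_obj[OF FG(1)]] by simp
      then show "x \<in> bt (on_obj F p)"
        using subs_nul[OF bt_subs[OF functor_obj[OF FG(1)]] homs_obj(1)[OF h(1)]] by simp
    qed
    then show "monic C (nt_at t p)" using pull_bt_subset_monic[OF nt_at_homs[OF t]] k(2) unfolding A_def by blast
  qed
next
  assume m: "\<forall>p. monic C (nt_at t p)"
  show "monic (functor_cat C) t"
  proof (rule category.monicI[OF category_functor_cat t])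
    fix W u v assume uv: "u \<in> homs (functor_cat C) W F" "v \<in> homs (functor_cat C) W F"
      and e: "t \<odot>\<^bsub>functor_cat C\<^esub> u = t \<odot>\<^bsub>functor_cat C\<^esub> v"
    have "nt_at t p \<odot> nt_at u p = nt_at t p \<odot> nt_at v p" for p
      using arg_cong[OF e, of "\<lambda>s. nt_at s p"] by simp
    then have "nt_at u p = nt_at v p" for p
      by (rule monic_cancel[OF m[rule_format] nt_at_homs[OF t] nt_at_homs[OF uv(1)] nt_at_homs[OF uv(2)]])
    then show "u = v" using nattrans_eqI[OF uv] by blast
  qed
qed

text \<open>Pointwise factorisations are unique because the \<open>nt_at s p\<close> are monic, and
  this forces them to be natural.\<close>

lemma factors_through_functor_iff:
  fixes F G K :: "('p::order, 'o, 'm) diagram"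
  assumes t: "t \<in> homs (functor_cat C) G F" and s: "s \<in> homs (functor_cat C) K F" and ms: "\<And>p. monic C (nt_at s p)"
  shows "factors_through (functor_cat C) t s \<longleftrightarrow> (\<forall>p. el (nt_at t p) \<subseteq> el (nt_at s p))"
proof
  assume "factors_through (functor_cat C) t s"
  then obtain h where h: "h \<in> homs (functor_cat C) G K" "t = s \<odot>\<^bsub>functor_cat C\<^esub> h"
    unfolding factors_through_def homs_dom[OF t] homs_dom[OF s] by blast
  have "factors_through C (nt_at t p) (nt_at s p)" for p
    unfolding factors_through_def homs_dom[OF nt_at_homs[OF t]] homs_dom[OF nt_at_homs[OF s]]
    using nt_at_homs[OF h(1)] h(2) by auto
  then show "\<forall>p. el (nt_at t p) \<subseteq> el (nt_at s p)"
    using factors_through_iff_el[OF nt_at_homs[OF t] nt_at_homs[OF s]] by blast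
next
  assume "\<forall>p. el (nt_at t p) \<subseteq> el (nt_at s p)"
  then have "nt_at t p \<in> el (nt_at s p)" for p using self_mem_el[OF nt_at_homs[OF t]] by blast
  then have "\<exists>h. h \<in> H (on_obj G p) (on_obj K p) \<and> nt_at t p = nt_at s p \<odot> h" for p
    using el_obtain[OF nt_at_homs[OF s] _ nt_at_homs[OF t]] by metis
  then obtain h where h: "\<And>p. h p \<in> H (on_obj G p) (on_obj K p)" "\<And>p. nt_at t p = nt_at s p \<odot> h p" by metis
  have "NatTrans G h K \<in> homs (functor_cat C) G K"
  proof (rule NatTrans_homs[OF nt_functors(1)[OF t] nt_functors(1)[OF s] h(1)])
    fix p q :: 'p assume pq: "p \<le> q"
    note a = functor_le[OF nt_functors(1)[OF t] pq] functor_le[OF nt_functors(1)[OF s] pq]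
      functor_le[OF nt_functors(2)[OF s] pq]
    have "nt_at s q \<odot> h q \<odot> on_le G p q = nt_at t q \<odot> on_le G p q"
      using assoc[OF a(1) h(1) nt_at_homs[OF s]] h(2) by simp
    also have "\<dots> = on_le F p q \<odot> nt_at s p \<odot> h p" using nt_natural[OF t pq] h(2) by simp
    also have "\<dots> = (nt_at s q \<odot> on_le K p q) \<odot> h p"
      using assoc[OF h(1) nt_at_homs[OF s] a(3)] nt_natural[OF s pq] by simp
    also have "\<dots> = nt_at s q \<odot> on_le K p q \<odot> h p" using assoc[OF h(1) a(2) nt_at_homs[OF s]] .
    finally show "h q \<odot> on_le G p q = on_le K p q \<odot> h p"
      using monic_cancel[OF ms nt_at_homs[OF s] comp_homs[OF a(1) h(1)] comp_homs[OF h(1) a(2)]] by blast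
  qed
  moreover from this have "t = s \<odot>\<^bsub>functor_cat C\<^esub> NatTrans G h K"
    by (intro nattrans_eqI[OF t category.comp_homs[OF category_functor_cat _ s]]) (simp_all add: h(2))
  ultimately show "factors_through (functor_cat C) t s"
    unfolding factors_through_def homs_dom[OF t] homs_dom[OF s] by blast
qed

lemma fcls_memD:
  assumes "t \<in> fcls F A"
  shows "t \<in> homs (functor_cat C) (nt_dom t) F" "monic (functor_cat C) t" "monic C (nt_at t p)" "el (nt_at t p) = A p"
proof -
  show t: "t \<in> homs (functor_cat C) (nt_dom t) F" and m: "monic (functor_cat C) t"
    using assms category.monos_into_iff[OF category_functor_cat, of t F]
    by (auto simp: fcls_def functor_cat_def)
  show "monic C (nt_at t p)" using monic_functor_iff[OF t] m by blast
  show "el (nt_at t p) = A p" using assms by (simp add: fcls_def)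
qed

lemma fcls_nonempty: assumes "is_functor C F" "subf F A" shows "\<exists>t. t \<in> fcls F A"
proof -
  obtain G m where m: "NatTrans G m F \<in> homs (functor_cat C) G F" "\<And>p. monic C (m p)" "\<And>p. el (m p) = A p"
    using subf_mono_exists[OF assms] by metis
  have "monic (functor_cat C) (NatTrans G m F)" using monic_functor_iff[OF m(1)] m(2) by simp
  then have "NatTrans G m F \<in> monos_into (functor_cat C) F"
    using homs_cod[OF m(1)] by (simp add: monos_into_def)
  then show ?thesis unfolding fcls_def using m(3) by auto
qed

lemma subf_of_mono:
  fixes F G :: "('p::order, 'o, 'm) diagram"
  assumes t: "t \<in> homs (functor_cat C) G F" and m: "\<And>p. monic C (nt_at t p)"
  shows "subf F (\<lambda>p. el (nt_at t p))"
  unfolding subf_def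
proof (intro conjI allI impI)
  note G = nt_functors(1)[OF t] and F = nt_functors(2)[OF t]
  show s: "el (nt_at t p) \<in> subs (on_obj F p)" for p using subsI[OF nt_at_homs[OF t] m] .
  fix p q :: 'p assume pq: "p \<le> q"
  show "el (nt_at t p) \<subseteq> pull (on_le F p q) (el (nt_at t q))"
  proof (rule subs_subsetI[OF s])
    fix W x assume x: "x \<in> H W (on_obj F p)" "x \<in> el (nt_at t p)"
    obtain h where h: "h \<in> H W (on_obj G p)" "x = nt_at t p \<odot> h" using el_obtain[OF nt_at_homs[OF t] x(2,1)] by blast
    have "on_le F p q \<odot> x = (nt_at t q \<odot> on_le G p q) \<odot> h"
      using h(2) assoc[OF h(1) nt_at_homs[OF t] functor_le[OF F pq]] nt_natural[OF t pq] by simp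
    also have "\<dots> = nt_at t q \<odot> on_le G p q \<odot> h"
      using assoc[OF h(1) functor_le[OF G pq] nt_at_homs[OF t]] .
    finally show "x \<in> pull (on_le F p q) (el (nt_at t q))"
      using mem_pull[OF functor_le[OF F pq] x(1)] el_comp[OF nt_at_homs[OF t] comp_homs[OF h(1) functor_le[OF G pq]]]
      by simp
  qed
qed

lemma carrier_Sub_functor:
  fixes F :: "('p::order, 'o, 'm) diagram"
  assumes F: "is_functor C F"
  shows "carrier (Sub (functor_cat C) F) = fcls F ` {A. subf F A}"
proof -
  let ?el = "category.el (functor_cat C :: (('p, 'o, 'm) diagram, ('p, 'o, 'm) nattrans) cat)"
  have fc: "category.cls (functor_cat C) F (?el t) = fcls F (\<lambda>p. el (nt_at t p))"
    if t: "t \<in> monos_into (functor_cat C) F" for t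
  proof -
    have th: "t \<in> homs (functor_cat C) (nt_dom t) F" and tm: "\<And>p. monic C (nt_at t p)"
      using that category.monos_into_iff[OF category_functor_cat, of t F] monic_functor_iff
      by (auto simp: functor_cat_def)
    have "?el s = ?el t \<longleftrightarrow> (\<forall>p. el (nt_at s p) = el (nt_at t p))" if "s \<in> monos_into (functor_cat C) F" for s
    proof -
      have sh: "s \<in> homs (functor_cat C) (nt_dom s) F" and sm: "\<And>p. monic C (nt_at s p)"
        using that category.monos_into_iff[OF category_functor_cat, of s F] monic_functor_iff
        by (auto simp: functor_cat_def)
      have "?el s = ?el t \<longleftrightarrow> ?el s \<subseteq> ?el t \<and> ?el t \<subseteq> ?el s" by blast
      also have "\<dots> \<longleftrightarrow> (\<forall>p. el (nt_at s p) \<subseteq> el (nt_at t p)) \<and> (\<forall>p. el (nt_at t p) \<subseteq> el (nt_at s p))"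
        unfolding category.factors_through_iff_el[OF category_functor_cat sh th, symmetric]
          category.factors_through_iff_el[OF category_functor_cat th sh, symmetric]
          factors_through_functor_iff[OF sh th tm] factors_through_functor_iff[OF th sh sm] ..
      finally show ?thesis by blast
    qed
    then show ?thesis unfolding category.cls_def[OF category_functor_cat] fcls_def by blast
  qed
  have "carrier (Sub (functor_cat C) F) = (\<lambda>t. fcls F (\<lambda>p. el (nt_at t p))) ` monos_into (functor_cat C) F"
    unfolding category.carrier_Sub[OF category_functor_cat] category.subs_def[OF category_functor_cat] image_image
    using fc by (rule image_cong[OF refl])
  also have "\<dots> = fcls F ` {A. subf F A}"
  proof (intro equalityI subsetI)
    fix M assume "M \<in> (\<lambda>t. fcls F (\<lambda>p. el (nt_at t p))) ` monos_into (functor_cat C) F"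
    then obtain t where t: "t \<in> monos_into (functor_cat C) F" "M = fcls F (\<lambda>p. el (nt_at t p))" by blast
    then have "t \<in> fcls F (\<lambda>p. el (nt_at t p))" by (simp add: fcls_def)
    from subf_of_mono[OF fcls_memD(1,3)[OF this]] show "M \<in> fcls F ` {A. subf F A}" using t(2) by blast
  next
    fix M assume "M \<in> fcls F ` {A. subf F A}"
    then obtain A where A: "subf F A" "M = fcls F A" by blast
    then obtain t where t: "t \<in> fcls F A" using fcls_nonempty[OF F] by blast
    then have "A = (\<lambda>p. el (nt_at t p))" by (auto simp: fcls_def)
    moreover have "t \<in> monos_into (functor_cat C) F" using t by (simp add: fcls_def)
    ultimately show "M \<in> (\<lambda>t. fcls F (\<lambda>p. el (nt_at t p))) ` monos_into (functor_cat C) F" using A(2) by blast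
  qed
  finally show ?thesis .
qed

lemma le_Sub_functor:
  assumes F: "is_functor C F" and A: "subf F A" and B: "subf F B"
  shows "le (Sub (functor_cat C) F) (fcls F A) (fcls F B) \<longleftrightarrow> (\<forall>p. A p \<subseteq> B p)"
proof -
  have "factors_through (functor_cat C) s t \<longleftrightarrow> (\<forall>p. A p \<subseteq> B p)" if s: "s \<in> fcls F A" and t: "t \<in> fcls F B" for s t
    using factors_through_functor_iff[OF fcls_memD(1)[OF s] fcls_memD(1)[OF t] fcls_memD(3)[OF t]]
    unfolding fcls_memD(4)[OF s] fcls_memD(4)[OF t] .
  then show ?thesis using fcls_nonempty[OF F A] fcls_nonempty[OF F B] unfolding Sub_def gorder.simps by blast
qed

text \<open>A monomorphism whose image is everything is also epic, hence invertible by
  \<open>monic_epic_iso\<close>.\<close>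

lemma full_at_fcls:
  assumes F: "is_functor C F" and A: "subf F A"
  shows "full_at C (fcls F A) b \<longleftrightarrow> A b = tp (on_obj F b)"
proof -
  have "iso_arr C (nt_at t b) \<longleftrightarrow> A b = tp (on_obj F b)" if t: "t \<in> fcls F A" for t
  proof -
    note h = nt_at_homs[OF fcls_memD(1)[OF t], of b] and m = fcls_memD(3)[OF t, of b] and e = fcls_memD(4)[OF t, of b]
    have p: "push (nt_at t b) (tp (on_obj (nt_dom t) b)) = A b" using push_tp_monic[OF h m] e by simp
    show ?thesis
      using monic_epic_iso[OF m _ h] epic_if_push_tp[OF h] push_tp_epic[OF h] iso_epic[OF _ h] p by metis
  qed
  then show ?thesis using fcls_nonempty[OF F A] unfolding full_at_def by blast
qed

lemma zero_object_tp: "zero_object C X \<longleftrightarrow> X \<in> cobj C \<and> tp X = bt X"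
proof
  assume "zero_object C X"
  then have X: "X \<in> cobj C" "cid C X = nul X X" using zero_object_iff by auto
  have "x \<in> bt X" if "x \<in> H W X" for x W
    using id_left[OF that] nul_comp[OF that X(1)] X(2) mem_bt[OF that] by simp
  then have "tp X \<subseteq> bt X" unfolding tp_def by blast
  then show "X \<in> cobj C \<and> tp X = bt X" using X subset_tp[OF bt_subs] by blast
next
  assume X: "X \<in> cobj C \<and> tp X = bt X"
  then have "cid C X \<in> bt X" using mem_tp[OF id_homs] by blast
  then show "zero_object C X" using zero_object_iff mem_bt[OF id_homs] X by blast
qed

lemma push_bt: assumes "g \<in> H X Y" shows "push g (bt X) = bt Y"
proof -
  have o: "X \<in> cobj C" "Y \<in> cobj C" using homs_obj assms by blast+
  have "bt X \<subseteq> pull g (bt Y)" using bt_subset[OF pull_subs[OF assms bt_subs[OF o(2)]]] .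
  then show ?thesis
    using push_subset_iff[OF assms bt_subs[OF o(1)] bt_subs[OF o(2)]]
      bt_subset[OF push_subs[OF assms bt_subs[OF o(1)]]] by blast
qed

lemma vanishes_at_fcls:
  assumes F: "is_functor C F" and A: "subf F A"
  shows "vanishes_at C (fcls F A) b \<longleftrightarrow> A b = bt (on_obj F b)"
proof -
  have "zero_object C (on_obj (nt_dom t) b) \<longleftrightarrow> A b = bt (on_obj F b)" if t: "t \<in> fcls F A" for t
  proof -
    note h = nt_at_homs[OF fcls_memD(1)[OF t], of b] and m = fcls_memD(3)[OF t, of b] and e = fcls_memD(4)[OF t, of b]
    have o: "on_obj (nt_dom t) b \<in> cobj C" using homs_obj h by blast
    have p: "push (nt_at t b) (tp (on_obj (nt_dom t) b)) = A b" using push_tp_monic[OF h m] e by simp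
    have "A b = bt (on_obj F b) \<longleftrightarrow> tp (on_obj (nt_dom t) b) = bt (on_obj (nt_dom t) b)"
      using p push_bt[OF h] pull_push_monic[OF h m tp_subs[OF o]] pull_push_monic[OF h m bt_subs[OF o]] by metis
    then show ?thesis using zero_object_tp o by blast
  qed
  then show ?thesis using fcls_nonempty[OF F A] unfolding vanishes_at_def by blast
qed

end

subsection \<open>Quotients of diagrams\<close>

context abcat
begin

text \<open>Pointwise cokernels are functorial by their universal property. The conclusion records
  both the pointwise and the diagrammatic property, so that an arbitrary cokernel can be compared
  with this one.\<close>

lemma cokernel_functor_construct:
  fixes N M :: "('p::order, 'o, 'm) diagram"
  assumes h: "h \<in> homs (functor_cat C) N M"
  shows "\<exists>Q c. c \<in> homs (functor_cat C) M Q \<and> (\<forall>p. is_cokernel C (nt_at c p) (nt_at h p)) \<and>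
    is_cokernel (functor_cat C) c h"
proof -
  note N = nt_functors(1)[OF h] and M = nt_functors(2)[OF h] and hp = nt_at_homs[OF h]
  have "\<exists>Q q. q \<in> H (on_obj M p) Q \<and> epic C q \<and> q \<odot> nt_at h p = nul (on_obj N p) Q \<and>
      (\<forall>W x. x \<in> H (on_obj M p) W \<longrightarrow> x \<odot> nt_at h p = nul (on_obj N p) W \<longrightarrow> (\<exists>u \<in> H Q W. x = u \<odot> q)) \<and>
      is_cokernel C q (nt_at h p)" for p
    using cokernel_obtain[OF hp] by metis
  then obtain Q c where c: "\<And>p. c p \<in> H (on_obj M p) (Q p)" "\<And>p. epic C (c p)"
    "\<And>p. c p \<odot> nt_at h p = nul (on_obj N p) (Q p)"
    and cu: "\<And>p W x. x \<in> H (on_obj M p) W \<Longrightarrow> x \<odot> nt_at h p = nul (on_obj N p) W \<Longrightarrow> \<exists>u \<in> H (Q p) W. x = u \<odot> c p"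
    and cc: "\<And>p. is_cokernel C (c p) (nt_at h p)"
    by metis
  have Qo: "Q p \<in> cobj C" for p using homs_obj[OF c(1)] by blast
  have "\<exists>g. g \<in> H (Q p) (Q q) \<and> c q \<odot> on_le M p q = g \<odot> c p" if pq: "p \<le> q" for p q
  proof -
    note a = functor_le[OF N pq] functor_le[OF M pq]
    have "(c q \<odot> on_le M p q) \<odot> nt_at h p = c q \<odot> nt_at h q \<odot> on_le N p q"
      using assoc[OF hp a(2) c(1)] nt_natural[OF h pq] by simp
    also have "\<dots> = nul (on_obj N p) (Q q)"
      using assoc[OF a(1) hp c(1)] c(3) nul_comp[OF a(1) Qo] by simp
    finally show ?thesis using cu[OF comp_homs[OF a(2) c(1)]] by blast
  qed
  then obtain g where g: "\<And>p q. p \<le> q \<Longrightarrow> g p q \<in> H (Q p) (Q q)"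
    "\<And>p q. p \<le> q \<Longrightarrow> c q \<odot> on_le M p q = g p q \<odot> c p" by metis
  define G where "G = Diagram Q (\<lambda>p q. if p \<le> q then g p q else undefined)"
  have G: "on_obj G = Q" "\<And>p q. p \<le> q \<Longrightarrow> on_le G p q = g p q" by (simp_all add: G_def)
  have GF: "is_functor C G" unfolding is_functor_def
  proof (intro conjI allI impI)
    show "on_obj G p \<in> cobj C" for p using Qo G by simp
    show "on_le G p q \<in> H (on_obj G p) (on_obj G q)" if "p \<le> q" for p q using that g G by simp
    show "on_le G p q = undefined" if "\<not> p \<le> q" for p q using that by (simp add: G_def)
    show "on_le G p p = cid C (on_obj G p)" for p
    proof -
      have "g p p \<odot> c p = cid C (Q p) \<odot> c p"
        using g(2)[of p p] M id_left[OF c(1)] id_right[OF c(1)] by (simp add: is_functor_def)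
      then show ?thesis using epic_cancel[OF c(2,1) g(1) id_homs[OF Qo]] G by simp
    qed
    show "on_le G p r = on_le G q r \<odot> on_le G p q" if pqr: "p \<le> q \<and> q \<le> r" for p q r
    proof -
      have le: "p \<le> q" "q \<le> r" "p \<le> r" using pqr by auto
      note a = functor_le[OF M le(1)] functor_le[OF M le(2)]
      have "g p r \<odot> c p = c r \<odot> on_le M q r \<odot> on_le M p q"
        using g(2)[OF le(3)] functor_comp[OF M le(1,2)] by simp
      also have "\<dots> = (g q r \<odot> c q) \<odot> on_le M p q" using assoc[OF a c(1)] g(2)[OF le(2)] by simp
      also have "\<dots> = g q r \<odot> g p q \<odot> c p" using assoc[OF a(1) c(1) g(1)[OF le(2)]] g(2)[OF le(1)] by simp
      also have "\<dots> = (g q r \<odot> g p q) \<odot> c p" using assoc[OF c(1) g(1)[OF le(1)] g(1)[OF le(2)]] by simp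
      finally have "g p r = g q r \<odot> g p q"
        using epic_cancel[OF c(2,1) g(1)[OF le(3)] comp_homs[OF g(1)[OF le(1)] g(1)[OF le(2)]]] by simp
      then show ?thesis using G le by simp
    qed
  qed
  define t where "t = NatTrans M c G"
  have t: "t \<in> homs (functor_cat C) M G" unfolding t_def
    using c(1) g(2) G by (intro NatTrans_homs[OF M GF]) simp_all
  note thh = category.comp_homs[OF category_functor_cat h t]
  have "is_cokernel (functor_cat C) t h" unfolding is_cokernel_def
  proof (intro conjI ballI impI)
    show "h \<in> carr (functor_cat C)" "t \<in> carr (functor_cat C)" using homs_carr[OF h] homs_carr[OF t] by simp_all
    show "cdom (functor_cat C) t = ccod (functor_cat C) h" using homs_dom[OF t] homs_cod[OF h] by simp
    show "zero_arr (functor_cat C) (t \<odot>\<^bsub>functor_cat C\<^esub> h)"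
      unfolding zero_arr_functor_iff[OF thh] using c(3) G by (simp add: t_def)
    fix k assume k: "k \<in> carr (functor_cat C)"
      "cdom (functor_cat C) k = ccod (functor_cat C) h \<and> zero_arr (functor_cat C) (k \<odot>\<^bsub>functor_cat C\<^esub> h)"
    define K where "K = ccod (functor_cat C) k"
    have kh: "k \<in> homs (functor_cat C) M K" using k homs_cod[OF h] by (simp add: homs_iff K_def)
    note KF = nt_functors(2)[OF kh] and kp = nt_at_homs[OF kh]
    have "nt_at k p \<odot> nt_at h p = nul (on_obj N p) (on_obj K p)" for p
      using k(2) zero_arr_functor_iff[OF category.comp_homs[OF category_functor_cat h kh]] by simp
    then have "\<exists>u. u \<in> H (Q p) (on_obj K p) \<and> nt_at k p = u \<odot> c p" for p
      using cu[OF kp] by blast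
    then obtain u where u: "\<And>p. u p \<in> H (Q p) (on_obj K p)" "\<And>p. nt_at k p = u p \<odot> c p" by metis
    define v where "v = NatTrans G u K"
    have v: "v \<in> homs (functor_cat C) G K" unfolding v_def
    proof (rule NatTrans_homs[OF GF KF])
      show "u p \<in> H (on_obj G p) (on_obj K p)" for p using u(1) G by simp
      fix p q :: 'p assume pq: "p \<le> q"
      note a = functor_le[OF M pq] functor_le[OF KF pq] g(1)[OF pq]
      have "(u q \<odot> g p q) \<odot> c p = u q \<odot> c q \<odot> on_le M p q"
        using assoc[OF c(1) a(3) u(1)] g(2)[OF pq] by simp
      also have "\<dots> = on_le K p q \<odot> nt_at k p" using assoc[OF a(1) c(1) u(1)] u(2) nt_natural[OF kh pq] by simp
      also have "\<dots> = (on_le K p q \<odot> u p) \<odot> c p" using assoc[OF c(1) u(1) a(2)] u(2) by simp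
      finally show "u q \<odot> on_le G p q = on_le K p q \<odot> u p"
        using epic_cancel[OF c(2,1) comp_homs[OF a(3) u(1)] comp_homs[OF u(1) a(2)]] G pq by simp
    qed
    have vt: "v \<odot>\<^bsub>functor_cat C\<^esub> t = k"
      by (rule nattrans_eqI[OF category.comp_homs[OF category_functor_cat t v] kh])
        (simp add: v_def t_def u(2))
    show "\<exists>!u. u \<in> homs (functor_cat C) (ccod (functor_cat C) t) (ccod (functor_cat C) k) \<and>
        u \<odot>\<^bsub>functor_cat C\<^esub> t = k"
      unfolding homs_cod[OF t] homs_cod[OF kh]
    proof (rule ex1I)
      show "v \<in> homs (functor_cat C) G K \<and> v \<odot>\<^bsub>functor_cat C\<^esub> t = k" using v vt by simp
      fix w assume w: "w \<in> homs (functor_cat C) G K \<and> w \<odot>\<^bsub>functor_cat C\<^esub> t = k"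
      have wp: "nt_at w p \<in> H (Q p) (on_obj K p)" for p using nt_at_homs w G by metis
      have "nt_at w p \<odot> c p = u p \<odot> c p" for p
        using arg_cong[OF conjunct2[OF w], of "\<lambda>s. nt_at s p"] u(2) by (simp add: t_def)
      then have "nt_at w p = u p" for p by (rule epic_cancel[OF c(2,1) wp u(1)])
      then show "w = v" using w by (intro nattrans_eqI[OF _ v]) (simp_all add: v_def)
    qed
  qed
  then show ?thesis using t cc by (intro exI[of _ G] exI[of _ t]) (simp add: t_def)
qed

text \<open>\<open>quotient_obj\<close> may select any cokernel in the functor category. The given
  \<open>q\<close> is compared with the constructed \<open>c\<close> through the induced arrows
  \<open>u\<close> and \<open>v\<close>, which transport epimorphy and kernels at each
  point.\<close>

lemma cokernel_functor_pointwise: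
  fixes N M :: "('p::order, 'o, 'm) diagram"
  assumes h: "h \<in> homs (functor_cat C) N M" and q: "is_cokernel (functor_cat C) q h"
  shows "q \<in> homs (functor_cat C) M (nt_cod q)" "epic C (nt_at q p)"
    "x \<in> H W (on_obj M p) \<Longrightarrow> nt_at q p \<odot> x = nul W (on_obj (nt_cod q) p) \<longleftrightarrow> x \<in> push (nt_at h p) (tp (on_obj N p))"
proof -
  let ?Q = "nt_cod q"
  show qh: "q \<in> homs (functor_cat C) M ?Q"
    using q homs_cod[OF h] unfolding is_cokernel_def by (simp add: homs_iff functor_cat_def)
  have qu: "\<exists>!u. u \<in> homs (functor_cat C) ?Q K \<and> u \<odot>\<^bsub>functor_cat C\<^esub> q = k"
    if k: "k \<in> homs (functor_cat C) M K" "zero_arr (functor_cat C) (k \<odot>\<^bsub>functor_cat C\<^esub> h)" for k K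
  proof -
    have "\<forall>k \<in> carr (functor_cat C). cdom (functor_cat C) k = M \<and>
        zero_arr (functor_cat C) (k \<odot>\<^bsub>functor_cat C\<^esub> h) \<longrightarrow>
        (\<exists>!u. u \<in> homs (functor_cat C) ?Q (ccod (functor_cat C) k) \<and> u \<odot>\<^bsub>functor_cat C\<^esub> q = k)"
      using q unfolding is_cokernel_def homs_cod[OF h] homs_cod[OF qh] by (elim conjE)
    from bspec[OF this homs_carr[OF k(1)]] show ?thesis
      using k(2) by (simp only: homs_dom[OF k(1)] homs_cod[OF k(1)] simp_thms)
  qed
  obtain G c where c: "c \<in> homs (functor_cat C) M G" "\<And>p. is_cokernel C (nt_at c p) (nt_at h p)"
    "is_cokernel (functor_cat C) c h" using cokernel_functor_construct[OF h] by blast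
  have zc: "zero_arr (functor_cat C) (c \<odot>\<^bsub>functor_cat C\<^esub> h)" using c(3) unfolding is_cokernel_def by blast
  have zq: "zero_arr (functor_cat C) (q \<odot>\<^bsub>functor_cat C\<^esub> h)" using q unfolding is_cokernel_def by blast
  obtain u where u: "u \<in> homs (functor_cat C) ?Q G" "u \<odot>\<^bsub>functor_cat C\<^esub> q = c" using qu[OF c(1) zc] by blast
  obtain v where v: "v \<in> homs (functor_cat C) G ?Q" "v \<odot>\<^bsub>functor_cat C\<^esub> c = q"
    using c(3) homs_carr[OF qh] homs_dom[OF qh] homs_cod[OF qh] homs_cod[OF h] homs_cod[OF c(1)] zq
    unfolding is_cokernel_def by metis
  have vu: "v \<odot>\<^bsub>functor_cat C\<^esub> u \<in> homs (functor_cat C) ?Q ?Q"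
    using category.comp_homs[OF category_functor_cat u(1) v(1)] .
  have "(v \<odot>\<^bsub>functor_cat C\<^esub> u) \<odot>\<^bsub>functor_cat C\<^esub> q = q"
    using category.assoc[OF category_functor_cat qh u(1) v(1)] u(2) v(2) by simp
  moreover have "cid (functor_cat C) ?Q \<in> homs (functor_cat C) ?Q ?Q"
    "cid (functor_cat C) ?Q \<odot>\<^bsub>functor_cat C\<^esub> q = q"
    using category.id_homs[OF category_functor_cat category.homs_obj(2)[OF category_functor_cat qh]]
      category.id_left[OF category_functor_cat qh] by blast+
  ultimately have e: "v \<odot>\<^bsub>functor_cat C\<^esub> u = cid (functor_cat C) ?Q" using qu[OF qh zq] vu by blast
  note hp = nt_at_homs[OF h, of p] and qp = nt_at_homs[OF qh, of p] and cp = nt_at_homs[OF c(1), of p]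
    and up = nt_at_homs[OF u(1), of p] and vp = nt_at_homs[OF v(1), of p]
  have vup: "nt_at v p \<odot> nt_at u p = cid C (on_obj ?Q p)" using arg_cong[OF e, of "\<lambda>s. nt_at s p"] by simp
  have upq: "nt_at u p \<odot> nt_at q p = nt_at c p" using arg_cong[OF u(2), of "\<lambda>s. nt_at s p"] by simp
  have vpc: "nt_at v p \<odot> nt_at c p = nt_at q p" using arg_cong[OF v(2), of "\<lambda>s. nt_at s p"] by simp
  obtain R where R: "nt_at c p \<in> H (on_obj M p) R" "epic C (nt_at c p)"
      "nt_at c p \<odot> nt_at h p = nul (on_obj N p) R"
    using c(2)[of p] is_cokernel_iff[OF hp] by blast
  have Ro: "R = on_obj G p" using homs_cod[OF R(1)] homs_cod[OF cp] by simp
  have "epic C (nt_at v p)"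
  proof (rule epicI[OF vp])
    fix W a b assume ab: "a \<in> H (on_obj ?Q p) W" "b \<in> H (on_obj ?Q p) W" "a \<odot> nt_at v p = b \<odot> nt_at v p"
    have "a \<odot> nt_at v p \<odot> nt_at u p = b \<odot> nt_at v p \<odot> nt_at u p"
      using assoc[OF up vp ab(1)] assoc[OF up vp ab(2)] ab(3) by simp
    then show "a = b" using vup id_right[OF ab(1)] id_right[OF ab(2)] by simp
  qed
  then show "epic C (nt_at q p)" using epic_comp[OF R(2) cp _ vp] vpc by simp
  assume x: "x \<in> H W (on_obj M p)"
  have No: "on_obj N p \<in> cobj C" and Qo: "on_obj ?Q p \<in> cobj C" and Go: "on_obj G p \<in> cobj C"
    using homs_obj hp qp cp by blast+
  show "nt_at q p \<odot> x = nul W (on_obj ?Q p) \<longleftrightarrow> x \<in> push (nt_at h p) (tp (on_obj N p))"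
  proof
    assume "nt_at q p \<odot> x = nul W (on_obj ?Q p)"
    then have cx: "nt_at c p \<odot> x = nul W (on_obj G p)"
      using upq assoc[OF x qp up] comp_nul[OF up homs_obj(1)[OF x]] by simp
    obtain I m e where I: "m \<in> H I (on_obj M p)" "monic C m" "e \<in> H (on_obj N p) I" "epic C e" "nt_at h p = m \<odot> e"
      using image_obtain[OF hp] by metis
    have pm: "push (nt_at h p) (tp (on_obj N p)) = el m"
      using I(5) push_comp[OF I(3,1) tp_subs[OF No]] push_tp_epic[OF I(3,4)] push_tp_monic[OF I(1,2)] by simp
    have Io: "I \<in> cobj C" using homs_obj I by blast
    \<comment> \<open>\<open>s\<close> divides out the image of \<open>nt_at h p\<close>. It kills
      \<open>nt_at h p\<close>, so it factors through \<open>nt_at c p\<close> and kills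
      \<open>x\<close>, which therefore lies in the image.\<close>
    obtain S s where s: "s \<in> H (on_obj M p) S" "is_cokernel C s m" using cokernel_obtain[OF I(1)] by metis
    have k: "is_kernel C m s" using monic_kernel_of_cokernel[OF I(2,1) s(2)] .
    have So: "S \<in> cobj C" using homs_obj s by blast
    have sm: "s \<odot> m = nul I S" and sk: "\<And>W x. x \<in> H W (on_obj M p) \<Longrightarrow> s \<odot> x = nul W S \<Longrightarrow> x \<in> el m"
      using k is_kernel_iff[OF s(1)] homs_dom[OF I(1)] by (metis homs_dom)+
    have "s \<odot> nt_at h p = nul (on_obj N p) S"
      using I(5) assoc[OF I(3,1) s(1)] sm nul_comp[OF I(3) So] by simp
    then obtain w where w: "w \<in> H R S" "s = w \<odot> nt_at c p"
      using c(2)[of p] is_cokernel_iff[OF hp] s(1) homs_cod[OF R(1)] by (metis homs_cod)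
    have "s \<odot> x = nul W S"
      using w assoc[OF x R(1) w(1)] cx comp_nul[OF w(1) homs_obj(1)[OF x]] Ro by simp
    then show "x \<in> push (nt_at h p) (tp (on_obj N p))" using sk[OF x] pm by simp
  next
    assume a: "x \<in> push (nt_at h p) (tp (on_obj N p))"
    have "tp (on_obj N p) \<subseteq> pull (nt_at h p) (pull (nt_at q p) (bt (on_obj ?Q p)))"
    proof (rule subs_subsetI[OF tp_subs[OF No]])
      fix V y assume y: "y \<in> H V (on_obj N p)"
      have qpn: "nt_at q p \<odot> nt_at h p = nul (on_obj N p) (on_obj ?Q p)"
        using zq zero_arr_functor_iff[OF category.comp_homs[OF category_functor_cat h qh]] by simp
      have hy: "nt_at h p \<odot> y \<in> H V (on_obj M p)" using comp_homs[OF y hp] .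
      have "nt_at q p \<odot> nt_at h p \<odot> y = nul V (on_obj ?Q p)"
        using assoc[OF y hp qp] qpn nul_comp[OF y Qo] by simp
      then show "y \<in> pull (nt_at h p) (pull (nt_at q p) (bt (on_obj ?Q p)))"
        using mem_pull[OF hp y] mem_pull[OF qp hy] mem_bt[OF comp_homs[OF hy qp]] by simp
    qed
    then have "x \<in> pull (nt_at q p) (bt (on_obj ?Q p))"
      using push_subset_iff[OF hp tp_subs[OF No] pull_subs[OF qp bt_subs[OF Qo]]] a by blast
    then show "nt_at q p \<odot> x = nul W (on_obj ?Q p)"
      using mem_pull[OF qp x] mem_bt[OF comp_homs[OF x qp]] by simp
  qed
qed

lemma is_quotient_functor:
  fixes F :: "('p::order, 'o, 'm) diagram"
  assumes F: "is_functor C F" and A: "subf F A" and B: "subf F B"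
    and Q: "is_quotient (functor_cat C) (fcls F B) (fcls F A) Q"
  shows "\<exists>m q G. m \<in> homs (functor_cat C) G F \<and> q \<in> homs (functor_cat C) G Q \<and>
    (\<forall>p. monic C (nt_at m p) \<and> el (nt_at m p) = B p \<and> epic C (nt_at q p) \<and>
         pull (nt_at m p) (A p) = pull (nt_at q p) (bt (on_obj Q p)))"
proof -
  obtain m n h q where d: "m \<in> fcls F B" "n \<in> fcls F A"
    "h \<in> homs (functor_cat C) (cdom (functor_cat C) n) (cdom (functor_cat C) m)" "n = m \<odot>\<^bsub>functor_cat C\<^esub> h"
    "is_cokernel (functor_cat C) q h" "Q = ccod (functor_cat C) q"
    using Q unfolding is_quotient_def by blast
  have h: "h \<in> homs (functor_cat C) (nt_dom n) (nt_dom m)" using d(3) by (simp add: functor_cat_def)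
  have Qe: "Q = nt_cod q" using d(6) by (simp add: functor_cat_def)
  note m = fcls_memD[OF d(1)] and n = fcls_memD[OF d(2)] and q = cokernel_functor_pointwise[OF h d(5)]
  note Qo = functor_obj[OF nt_functors(2)[OF q(1)]]
  have "pull (nt_at m p) (A p) = pull (nt_at q p) (bt (on_obj (nt_cod q) p))" for p
  proof -
    note mp = nt_at_homs[OF m(1), of p] and hp = nt_at_homs[OF h, of p] and np = nt_at_homs[OF n(1), of p]
      and qp = nt_at_homs[OF q(1), of p]
    have No: "on_obj (nt_dom n) p \<in> cobj C" using homs_obj hp by blast
    have "A p = push (nt_at m p) (push (nt_at h p) (tp (on_obj (nt_dom n) p)))"
      using push_comp[OF hp mp tp_subs[OF No]] d(4) push_tp_monic[OF np n(3)] n(4)[of p] by simp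
    then have pA: "pull (nt_at m p) (A p) = push (nt_at h p) (tp (on_obj (nt_dom n) p))"
      using pull_push_monic[OF mp m(3) push_subs[OF hp tp_subs[OF No]]] by simp
    show ?thesis unfolding pA
    proof (rule subs_eqI[OF push_subs[OF hp tp_subs[OF No]] pull_subs[OF qp bt_subs[OF Qo]]])
      fix W x assume x: "x \<in> H W (on_obj (nt_dom m) p)"
      show "x \<in> push (nt_at h p) (tp (on_obj (nt_dom n) p)) \<longleftrightarrow>
          x \<in> pull (nt_at q p) (bt (on_obj (nt_cod q) p))"
        unfolding mem_pull[OF qp x] mem_bt[OF comp_homs[OF x qp]] q(3)[OF x] ..
    qed
  qed
  then show ?thesis using m q(1,2) Qe by blast
qed

lemma is_quotient_functor_exists:
  fixes F :: "('p::order, 'o, 'm) diagram"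
  assumes F: "is_functor C F" and A: "subf F A" and B: "subf F B" and AB: "\<And>p. A p \<subseteq> B p"
  shows "\<exists>Q. is_quotient (functor_cat C) (fcls F B) (fcls F A) Q"
proof -
  obtain m n where mn: "m \<in> fcls F B" "n \<in> fcls F A" using fcls_nonempty[OF F] A B by metis
  note m = fcls_memD[OF mn(1)] and n = fcls_memD[OF mn(2)]
  have "factors_through (functor_cat C) n m"
    using factors_through_functor_iff[OF n(1) m(1) m(3)] m(4) n(4) AB by simp
  then obtain h where h: "h \<in> homs (functor_cat C) (cdom (functor_cat C) n) (cdom (functor_cat C) m)"
    "n = m \<odot>\<^bsub>functor_cat C\<^esub> h" unfolding factors_through_def by blast
  obtain c where "is_cokernel (functor_cat C) c h" using cokernel_functor_construct[OF h(1)] by blast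
  then show ?thesis unfolding is_quotient_def using mn h by blast
qed

text \<open>The third claim concerns the induced map from \<open>B p / A p\<close> to
  \<open>B r / A r\<close>: it is epic because \<open>B p\<close> maps onto \<open>B r\<close>, and
  monic because elements of \<open>B p\<close> sent into \<open>A r\<close> already lie in
  \<open>A p\<close>.\<close>

lemma quotient_functor:
  fixes F :: "('p::order, 'o, 'm) diagram"
  assumes F: "is_functor C F" and A: "subf F A" and B: "subf F B" and AB: "\<And>p. A p \<subseteq> B p"
    and Q: "is_quotient (functor_cat C) (fcls F B) (fcls F A) Q"
  shows "is_functor C Q" "subq (on_obj F p) (A p) (B p) (on_obj Q p)"
    "\<lbrakk>p \<le> r; push (on_le F p r) (B p) = B r; B p \<inter> pull (on_le F p r) (A r) \<subseteq> A p\<rbrakk> \<Longrightarrow> iso_arr C (on_le Q p r)"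
proof -
  obtain m q G where d: "m \<in> homs (functor_cat C) G F" "q \<in> homs (functor_cat C) G Q"
    and m: "\<And>p. monic C (nt_at m p)" "\<And>p. el (nt_at m p) = B p" and q: "\<And>p. epic C (nt_at q p)"
    and mq: "\<And>p. pull (nt_at m p) (A p) = pull (nt_at q p) (bt (on_obj Q p))"
    using is_quotient_functor[OF F A B Q] by blast
  show QF: "is_functor C Q" using nt_functors(2)[OF d(2)] .
  note GF = nt_functors(1)[OF d(2)]
  note mp = nt_at_homs[OF d(1)] and qp = nt_at_homs[OF d(2)]
  note Go = functor_obj[OF GF] and Qo = functor_obj[OF QF]
  have pm: "push (nt_at m p) (tp (on_obj G p)) = B p" for p using push_tp_monic[OF mp m(1)] m(2) by simp
  show "subq (on_obj F p) (A p) (B p) (on_obj Q p)"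
    by (rule subqI[OF mp qp q mq]) (simp add: pm join_absorb[OF subf_subs[OF A] subf_subs[OF B] AB])
  assume pr: "p \<le> r" and s: "push (on_le F p r) (B p) = B r" and k: "B p \<inter> pull (on_le F p r) (A r) \<subseteq> A p"
  note Fpr = functor_le[OF F pr] and Gpr = functor_le[OF GF pr] and Qpr = functor_le[OF QF pr]
  have mG: "nt_at m r \<odot> on_le G p r = on_le F p r \<odot> nt_at m p" using nt_natural[OF d(1) pr] .
  have qG: "nt_at q r \<odot> on_le G p r = on_le Q p r \<odot> nt_at q p" using nt_natural[OF d(2) pr] .
  have "push (nt_at m r) (push (on_le G p r) (tp (on_obj G p))) = push (nt_at m r) (tp (on_obj G r))"
    using push_comp[OF Gpr mp tp_subs[OF Go]] push_comp[OF mp Fpr tp_subs[OF Go]] mG pm s by simp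
  then have pG: "push (on_le G p r) (tp (on_obj G p)) = tp (on_obj G r)"
    using pull_push_monic[OF mp m(1) push_subs[OF Gpr tp_subs[OF Go]]] pull_push_monic[OF mp m(1) tp_subs[OF Go]]
    by metis
  have "push (on_le Q p r) (tp (on_obj Q p)) = push (on_le Q p r) (push (nt_at q p) (tp (on_obj G p)))"
    using push_tp_epic[OF qp q] by simp
  also have "\<dots> = push (nt_at q r) (push (on_le G p r) (tp (on_obj G p)))"
    using push_comp[OF qp Qpr tp_subs[OF Go]] push_comp[OF Gpr qp tp_subs[OF Go]] qG by simp
  also have "\<dots> = tp (on_obj Q r)" using pG push_tp_epic[OF qp q] by simp
  finally have e: "epic C (on_le Q p r)" by (rule epic_if_push_tp[OF Qpr])
  have "monic C (on_le Q p r)"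
  proof (subst monic_iff[OF Qpr], intro allI ballI impI)
    fix W x assume x: "x \<in> H W (on_obj Q p)" "on_le Q p r \<odot> x = nul W (on_obj Q r)"
    obtain V e z where z: "e \<in> H V W" "epic C e" "z \<in> H V (on_obj G p)" "nt_at q p \<odot> z = x \<odot> e"
      using epic_pullback[OF q qp x(1)] by metis
    have Gz: "on_le G p r \<odot> z \<in> H V (on_obj G r)" and mz: "nt_at m p \<odot> z \<in> H V (on_obj F p)"
      using comp_homs z(3) Gpr mp by blast+
    have "nt_at q r \<odot> on_le G p r \<odot> z = on_le Q p r \<odot> nt_at q p \<odot> z"
      using assoc[OF z(3) Gpr qp] assoc[OF z(3) qp Qpr] qG by simp
    also have "\<dots> = (on_le Q p r \<odot> x) \<odot> e" using z(4) assoc[OF z(1) x(1) Qpr] by simp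
    also have "\<dots> = nul V (on_obj Q r)" using x(2) nul_comp[OF z(1) Qo] by simp
    finally have "on_le G p r \<odot> z \<in> pull (nt_at m r) (A r)"
      unfolding mq mem_pull[OF qp Gz] mem_bt[OF comp_homs[OF Gz qp]] .
    then have "nt_at m r \<odot> on_le G p r \<odot> z \<in> A r" unfolding mem_pull[OF mp Gz] .
    moreover have "nt_at m r \<odot> on_le G p r \<odot> z = on_le F p r \<odot> nt_at m p \<odot> z"
      using assoc[OF z(3) Gpr mp] assoc[OF z(3) mp Fpr] mG by simp
    ultimately have "nt_at m p \<odot> z \<in> pull (on_le F p r) (A r)" unfolding mem_pull[OF Fpr mz] by simp
    moreover have "nt_at m p \<odot> z \<in> B p" using el_comp[OF mp z(3)] m(2) by simp
    ultimately have "nt_at m p \<odot> z \<in> A p" using k by blast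
    then have "z \<in> pull (nt_at q p) (bt (on_obj Q p))" unfolding mq[symmetric] mem_pull[OF mp z(3)] .
    then have "nt_at q p \<odot> z = nul V (on_obj Q p)"
      unfolding mem_pull[OF qp z(3)] mem_bt[OF comp_homs[OF z(3) qp]] .
    then have "x \<odot> e = nul V (on_obj Q p)" using z(4) by simp
    then show "x = nul W (on_obj Q p)" using epic_iff[OF z(1)] z(2) x(1) by blast
  qed
  then show "iso_arr C (on_le Q p r)" using monic_epic_iso[OF _ e Qpr] by blast
qed

end

section \<open>Intervals\<close>

text \<open>\<open>lo J\<close> and \<open>hi J\<close> are the two sets of the pair representing
  \<open>J\<close>, given by formulas so that conditions on representing pairs become
  inclusions.\<close>

definition lo :: "real set \<Rightarrow> real set" where
  "lo J = {x. \<forall>y \<in> J. x < y}"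

definition hi :: "real set \<Rightarrow> real set" where
  "hi J = {x. \<exists>y \<in> J. x \<le> y}"

text \<open>Being down-closed and disjoint from the nonempty \<open>J\<close>, the set
  \<open>S\<close> consists of the points strictly below all of \<open>J\<close>, and
  \<open>T\<close> of those at or below some point of \<open>J\<close>.\<close>

lemma represents_unique:
  assumes "represents J S T" shows "S = lo J" "T = hi J"
proof -
  have S: "\<And>x y. x \<in> S \<Longrightarrow> y \<le> x \<Longrightarrow> y \<in> S" and T: "\<And>x y. x \<in> T \<Longrightarrow> y \<le> x \<Longrightarrow> y \<in> T"
    and ST: "S \<subset> T" "J = T - S"
    using assms by (auto simp: represents_def downsets_def)
  obtain y0 where y0: "y0 \<in> J" using ST by blast
  have lt: "x < y" if "x \<in> S" "y \<in> J" for x y using S[OF that(1), of y] that(2) ST by force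
  show "S = lo J"
  proof
    show "S \<subseteq> lo J" using lt by (auto simp: lo_def)
    show "lo J \<subseteq> S"
    proof
      fix x assume x: "x \<in> lo J"
      then have "x < y0" using y0 by (auto simp: lo_def)
      then have "x \<in> T" using T y0 ST by force
      then show "x \<in> S" using x ST by (force simp: lo_def)
    qed
  qed
  show "T = hi J"
  proof
    show "T \<subseteq> hi J"
    proof
      fix x assume "x \<in> T"
      then have "x \<in> S \<or> x \<in> J" using ST by blast
      then show "x \<in> hi J" unfolding hi_def using lt[OF _ y0, of x] y0 less_imp_le order.refl[of x] by blast
    qed
    show "hi J \<subseteq> T" using T ST by (auto simp: hi_def)
  qed
qed

lemma represents_lo_hi:
  assumes "J \<in> real_intervals" shows "represents J (lo J) (hi J)"
proof -
  have J: "is_interval J" "J \<noteq> {}" using assms by (auto simp: real_intervals_def)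
  then obtain y0 where y0: "y0 \<in> J" by blast
  have "J = hi J - lo J"
  proof
    show "J \<subseteq> hi J - lo J" by (force simp: hi_def lo_def)
    show "hi J - lo J \<subseteq> J"
    proof
      fix x assume "x \<in> hi J - lo J"
      then obtain y z where "y \<in> J" "x \<le> y" "z \<in> J" "z \<le> x" by (force simp: hi_def lo_def)
      then show "x \<in> J" using J(1) unfolding is_interval_1 by blast
    qed
  qed
  moreover have "lo J \<subseteq> hi J" unfolding lo_def hi_def using y0 less_imp_le by blast
  moreover have "lo J \<in> downsets UNIV (\<le>)" "hi J \<in> downsets UNIV (\<le>)"
    by (auto simp: downsets_def lo_def hi_def intro: le_less_trans order_trans)
  ultimately show ?thesis using y0 unfolding represents_def by blast
qed

lemma real_interval_eq: "J \<in> real_intervals \<Longrightarrow> J = hi J - lo J"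
  using represents_lo_hi by (simp add: represents_def)

lemma interval_le_iff:
  assumes "J \<in> real_intervals" "J' \<in> real_intervals"
  shows "interval_le J J' \<longleftrightarrow> lo J \<subseteq> lo J' \<and> hi J \<subseteq> hi J'"
  unfolding interval_le_def using represents_lo_hi[OF assms(1)] represents_lo_hi[OF assms(2)] represents_unique
  by metis

lemma not_mem_lo_iff: "J \<in> real_intervals \<Longrightarrow> (\<exists>S T. represents J S T \<and> c \<notin> S) \<longleftrightarrow> c \<notin> lo J"
  using represents_lo_hi represents_unique by metis

lemma not_mem_hi_iff: "J \<in> real_intervals \<Longrightarrow> (\<exists>S T. represents J S T \<and> c \<notin> T) \<longleftrightarrow> c \<notin> hi J"
  using represents_lo_hi represents_unique by metis

lemma mem_downsets_iff:
  "D \<in> downsets real_intervals interval_le \<longleftrightarrow> D \<subseteq> real_intervals \<and>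
    (\<forall>J \<in> D. \<forall>L \<in> real_intervals. lo L \<subseteq> lo J \<longrightarrow> hi L \<subseteq> hi J \<longrightarrow> L \<in> D)"
  unfolding downsets_def using interval_le_iff by blast

lemma mem_principal_down:
  "J \<in> real_intervals \<Longrightarrow> L \<in> principal_down J \<longleftrightarrow> L \<in> real_intervals \<and> lo L \<subseteq> lo J \<and> hi L \<subseteq> hi J"
  unfolding principal_down_def using interval_le_iff by blast

lemma mem_strict_down: "L \<in> strict_down J \<longleftrightarrow> L \<in> principal_down J \<and> L \<noteq> J"
  unfolding strict_down_def principal_down_def by blast

lemma real_intervals_antisym:
  "J \<in> real_intervals \<Longrightarrow> L \<in> real_intervals \<Longrightarrow> lo J = lo L \<Longrightarrow> hi J = hi L \<Longrightarrow> J = L"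
  using real_interval_eq by metis

lemma principal_down_downset: "J \<in> real_intervals \<Longrightarrow> principal_down J \<in> downsets real_intervals interval_le"
  unfolding mem_downsets_iff using mem_principal_down by blast

lemma strict_down_downset:
  assumes "J \<in> real_intervals" shows "strict_down J \<in> downsets real_intervals interval_le"
  unfolding mem_downsets_iff
proof (intro conjI ballI impI)
  show "strict_down J \<subseteq> real_intervals" unfolding strict_down_def by blast
  fix M L assume M: "M \<in> strict_down J" and L: "L \<in> real_intervals" "lo L \<subseteq> lo M" "hi L \<subseteq> hi M"
  have M': "M \<in> real_intervals" "lo M \<subseteq> lo J" "hi M \<subseteq> hi J" "M \<noteq> J"
    using M mem_strict_down mem_principal_down[OF assms] by auto
  have "L \<noteq> J"
  proof
    assume "L = J"
    then have "lo J = lo M" "hi J = hi M" using L M' by auto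
    then show False using real_intervals_antisym[OF assms M'(1)] M'(4) by simp
  qed
  then show "L \<in> strict_down J" using mem_strict_down mem_principal_down[OF assms] L M' by auto
qed

text \<open>\<open>lo_avoid c\<close> and \<open>hi_avoid c\<close> are the down-closed sets on
  which the saecular homomorphism is prescribed, with values K_hat(c) and K(c).\<close>

definition lo_avoid :: "real \<Rightarrow> real set set" where
  "lo_avoid c = {J \<in> real_intervals. c \<notin> lo J}"

definition hi_avoid :: "real \<Rightarrow> real set set" where
  "hi_avoid c = {J \<in> real_intervals. c \<notin> hi J}"

lemma lo_avoid_eq: "{J \<in> real_intervals. \<exists>S T. represents J S T \<and> c \<notin> S} = lo_avoid c"
  unfolding lo_avoid_def using not_mem_lo_iff by blast

lemma hi_avoid_eq: "{J \<in> real_intervals. \<exists>S T. represents J S T \<and> c \<notin> T} = hi_avoid c"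
  unfolding hi_avoid_def using not_mem_hi_iff by blast

lemma avoid_downsets:
  "lo_avoid c \<in> downsets real_intervals interval_le" "hi_avoid c \<in> downsets real_intervals interval_le"
  unfolding mem_downsets_iff lo_avoid_def hi_avoid_def by blast+

text \<open>Exhibits a principal down-set as a meet of sets with prescribed values; together with
  \<open>downset_eq_Union\<close> this makes the saecular homomorphism unique.\<close>

lemma principal_down_eq_Inter:
  assumes "J \<in> real_intervals"
  shows "principal_down J = real_intervals \<inter> \<Inter>(lo_avoid ` (- lo J) \<union> hi_avoid ` (- hi J))"
  using mem_principal_down[OF assms] by (auto simp: lo_avoid_def hi_avoid_def)

lemma downset_eq_Union:
  assumes "D \<in> downsets real_intervals interval_le" shows "D = \<Union>(principal_down ` D)"
  using assms mem_principal_down unfolding mem_downsets_iff by blast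

section \<open>Half-open intervals\<close>

lemma half_open_interval: "ereal a < b \<Longrightarrow> half_open a b \<in> real_intervals"
  unfolding real_intervals_def half_open_def is_interval_1
  by (auto intro: le_less_trans[OF ereal_less_eq(3)[THEN iffD2]])

lemma lo_half_open: "ereal a < b \<Longrightarrow> lo (half_open a b) = {x. x < a}"
  unfolding lo_def half_open_def by (auto intro: less_le_trans)

lemma hi_half_open:
  assumes "ereal a < b" shows "hi (half_open a b) = {x. ereal x < b}"
proof -
  have "\<exists>y. a \<le> y \<and> ereal y < b \<and> x \<le> y" if "ereal x < b" for x
    using that assms by (intro exI[of _ "max a x"]) (auto simp: max_def)
  then show ?thesis unfolding hi_def half_open_def by (auto intro: le_less_trans[OF ereal_less_eq(3)[THEN iffD2]])
qed

section \<open>The saecular filtration of a constructible diagram\<close>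

locale constructible_diagram = abcat C add nul
  for C :: "('o, 'm) cat" (structure) and add (infixl \<open>\<boxplus>\<close> 65) and nul +
  fixes f :: "(real, 'o, 'm) diagram" and n :: nat and s :: "nat \<Rightarrow> ereal"
  assumes F: "is_functor C f"
    and s_real: "s ` {1..n} \<subseteq> range ereal" and s_top: "s (n + 1) = \<infinity>"
    and s_mono: "strict_mono_on {1..n + 1} s"
    and zero_before: "ereal a < s 1 \<Longrightarrow> zero_object C (on_obj f a)"
    and iso_between: "\<lbrakk>i \<in> {1..n}; s i \<le> ereal a; a \<le> b; ereal b < s (i + 1)\<rbrakk> \<Longrightarrow> iso_arr C (on_le f a b)"
    and finite_len: "finite_length C (on_obj f a)"
begin

text \<open>\<open>Kh c\<close> and \<open>Kk c\<close> are the pointwise descriptions of the subobjects \<open>K_hat(c)\<close> and \<open>K(c)\<close>.\<close>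

definition Kh :: "real \<Rightarrow> real \<Rightarrow> 'm set" where
  "Kh c a = (if c \<le> a then push (on_le f c a) (tp (on_obj f c)) else tp (on_obj f a))"

definition Kk :: "real \<Rightarrow> real \<Rightarrow> 'm set" where
  "Kk c a = (if a \<le> c then pull (on_le f a c) (bt (on_obj f c)) else bt (on_obj f a))"

text \<open>\<open>sr (n + 1)\<close> is a junk value; \<open>Rk (n + 1)\<close> plays the role of the kernel of a map to \<open>f(\<infinity>) = 0\<close>.\<close>

definition sr :: "nat \<Rightarrow> real" where "sr i = real_of_ereal (s i)"

definition Rk :: "nat \<Rightarrow> real \<Rightarrow> 'm set" where
  "Rk j a = (if j = n + 1 then tp (on_obj f a) else Kk (sr j) a)"

text \<open>\<open>Ix a\<close> indexes the critical values up to \<open>a\<close> and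
  \<open>Jx a\<close> those after it, so the pairs in \<open>Ix a \<times> Jx a\<close> are the
  cells containing \<open>a\<close>.\<close>

definition Ix :: "real \<Rightarrow> nat set" where "Ix a = {i \<in> {1..n}. s i \<le> ereal a}"

definition Jx :: "real \<Rightarrow> nat set" where "Jx a = {j \<in> {1..n + 1}. ereal a < s j}"

text \<open>The right end stays an extended real, so that \<open>j = n + 1\<close> gives an
  unbounded cell; only the left end goes through \<open>sr\<close>.\<close>

definition cell :: "nat \<Rightarrow> nat \<Rightarrow> real set" where "cell i j = half_open (sr i) (s j)"

definition idx :: "real set set \<Rightarrow> real \<Rightarrow> (nat \<times> nat) set" where
  "idx D a = {(i, j). i \<in> Ix a \<and> j \<in> Jx a \<and> cell i j \<in> D}"

definition Om :: "real set set \<Rightarrow> real \<Rightarrow> 'm set" where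
  "Om D a = Jn (on_obj f a) ((\<lambda>(i, j). Kh (sr i) a \<inter> Rk j a) ` idx D a)"

abbreviation fo where "fo \<equiv> on_obj f"
abbreviation fl where "fl \<equiv> on_le f"

lemma fo_obj: "fo a \<in> cobj C" using functor_obj[OF F] .

lemma fl_homs: "a \<le> b \<Longrightarrow> fl a b \<in> H (fo a) (fo b)" using functor_le[OF F] .

lemma fl_id: "fl a a = cid C (fo a)" using F by (simp add: is_functor_def)

lemmas tps = tp_subs[OF fo_obj] and bts = bt_subs[OF fo_obj]

lemma pull_id: assumes "A \<in> subs X" shows "pull (cid C X) A = A"
  using pull_push_monic[OF id_homs[OF subs_obj[OF assms]] id_monic[OF subs_obj[OF assms]] assms] push_id[OF assms]
  by simp

lemma s_sr: "i \<in> {1..n} \<Longrightarrow> s i = ereal (sr i)"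
  using s_real unfolding sr_def by (metis image_subset_iff imageE real_of_ereal.simps(1))

lemma s_less_iff: "i \<in> {1..n + 1} \<Longrightarrow> j \<in> {1..n + 1} \<Longrightarrow> s i < s j \<longleftrightarrow> i < j"
  using s_mono by (metis linorder_less_linear order_less_imp_not_less strict_mono_onD order_less_irrefl)

lemma s_le_iff: "i \<in> {1..n + 1} \<Longrightarrow> j \<in> {1..n + 1} \<Longrightarrow> s i \<le> s j \<longleftrightarrow> i \<le> j"
  using s_less_iff by (metis linorder_not_less)

lemma Kh_subs: "Kh c a \<in> subs (fo a)"
  unfolding Kh_def using push_subs[OF fl_homs tps] tps by simp

lemma Kk_subs: "Kk c a \<in> subs (fo a)"
  unfolding Kk_def using pull_subs[OF fl_homs bts] bts by simp

lemma Rk_subs: "Rk j a \<in> subs (fo a)"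
  unfolding Rk_def using tps Kk_subs by simp

lemma Kh_mono: assumes "c \<le> c'" shows "Kh c a \<subseteq> Kh c' a"
proof (cases "c' \<le> a")
  case True
  have "push (fl c a) (tp (fo c)) = push (fl c' a) (push (fl c c') (tp (fo c)))"
    using functor_comp[OF F assms True] push_comp[OF fl_homs[OF assms] fl_homs[OF True] tps] by simp
  also have "\<dots> \<subseteq> push (fl c' a) (tp (fo c'))"
    by (rule push_mono[OF subset_tp[OF push_subs[OF fl_homs[OF assms] tps]]])
  finally show ?thesis using True assms by (simp add: Kh_def)
qed (use subset_tp[OF Kh_subs] in \<open>simp add: Kh_def\<close>)

lemma Kk_mono: assumes "c \<le> c'" shows "Kk c a \<subseteq> Kk c' a"
proof (cases "a \<le> c")
  case True
  have "pull (fl a c) (bt (fo c)) \<subseteq> pull (fl a c) (pull (fl c c') (bt (fo c')))"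
    by (rule pull_mono[OF bt_subset[OF pull_subs[OF fl_homs[OF assms] bts]]])
  also have "\<dots> = pull (fl a c') (bt (fo c'))"
    using functor_comp[OF F True assms] pull_comp[OF fl_homs[OF True] fl_homs[OF assms]] by simp
  finally show ?thesis using True assms by (simp add: Kk_def)
next
  case False
  then show ?thesis using bt_subset[OF Kk_subs[of c' a]] by (simp add: Kk_def[of c a])
qed

lemma push_Kh: assumes "c \<le> a" "a \<le> b" shows "push (fl a b) (Kh c a) = Kh c b"
  using assms functor_comp[OF F assms] push_comp[OF fl_homs[OF assms(1)] fl_homs[OF assms(2)] tps]
  by (simp add: Kh_def)

lemma pull_Kk: assumes "a \<le> b" "b \<le> c" shows "pull (fl a b) (Kk c b) = Kk c a"
  using assms functor_comp[OF F assms] pull_comp[OF fl_homs[OF assms(1)] fl_homs[OF assms(2)]]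
  by (simp add: Kk_def)

lemma Kh_full: "a \<le> c \<Longrightarrow> Kh c a = tp (fo a)"
  unfolding Kh_def using fl_id push_id[OF tps] by (cases "a = c") auto

lemma Kk_vanish: "c \<le> a \<Longrightarrow> Kk c a = bt (fo a)"
  unfolding Kk_def using fl_id pull_id[OF bts] by (cases "a = c") auto

lemma Ix_mono: "a \<le> b \<Longrightarrow> Ix a \<subseteq> Ix b"
  unfolding Ix_def by (auto intro: order_trans)

lemma Jx_anti: assumes "a \<le> b" shows "Jx b \<subseteq> Jx a"
proof -
  have "ereal a \<le> ereal b" using assms by simp
  from le_less_trans[OF this] show ?thesis unfolding Jx_def by auto
qed

lemma Ix_le: "i \<in> Ix a \<Longrightarrow> sr i \<le> a"
  unfolding Ix_def using s_sr by fastforce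

lemma Jx_less: "j \<in> Jx a \<Longrightarrow> j \<noteq> n + 1 \<Longrightarrow> a < sr j"
  unfolding Jx_def using s_sr[of j] by fastforce

lemma Rk_mono: assumes "j \<in> Jx a" "j' \<in> Jx a" "j \<le> j'" shows "Rk j a \<subseteq> Rk j' a"
proof (cases "j' = n + 1")
  case True
  then have "Rk j' a = tp (fo a)" by (simp add: Rk_def)
  then show ?thesis using subset_tp[OF Rk_subs] by simp
next
  case False
  have j: "j \<in> {1..n}" "j' \<in> {1..n}" using assms False by (auto simp: Jx_def)
  then have "sr j \<le> sr j'" using s_le_iff[of j j'] assms s_sr[of j] s_sr[of j'] by simp
  then show ?thesis using Kk_mono False j by (simp add: Rk_def)
qed

lemma Kh_sr_mono: assumes "i \<in> Ix a" "i' \<in> Ix a" "i \<le> i'" shows "Kh (sr i) a \<subseteq> Kh (sr i') a"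
proof -
  have j: "i \<in> {1..n}" "i' \<in> {1..n}" using assms by (auto simp: Ix_def)
  then have "sr i \<le> sr i'" using s_le_iff[of i i'] assms s_sr[of i] s_sr[of i'] by simp
  then show ?thesis using Kh_mono by blast
qed

lemma finite_idx: "finite (idx D a)" "idx D a \<subseteq> Ix a \<times> Jx a"
proof -
  show s: "idx D a \<subseteq> Ix a \<times> Jx a" by (auto simp: idx_def)
  show "finite (idx D a)" by (rule finite_subset[OF s]) (simp add: Ix_def Jx_def)
qed

lemma gen_subs: "(\<lambda>(i, j). Kh (sr i) a \<inter> Rk j a) ` I \<subseteq> subs (fo a)"
  using inter_subs[OF Kh_subs Rk_subs] by auto

lemma Om_subs: "Om D a \<in> subs (fo a)"
  unfolding Om_def using Jn_subs[OF fo_obj finite_imageI[OF finite_idx(1)] gen_subs] .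

lemma Om_mono: "idx D a \<subseteq> idx D' a \<Longrightarrow> Om D a \<subseteq> Om D' a"
  unfolding Om_def by (intro Jn_mono image_mono)

lemma idx_mono: "D \<subseteq> D' \<Longrightarrow> idx D a \<subseteq> idx D' a"
  unfolding idx_def by blast

lemma Om_upper: "(i, j) \<in> idx D a \<Longrightarrow> Kh (sr i) a \<inter> Rk j a \<subseteq> Om D a"
  unfolding Om_def by (rule Jn_upper) force

lemma Om_least:
  "B \<in> subs (fo a) \<Longrightarrow> (\<And>i j. (i, j) \<in> idx D a \<Longrightarrow> Kh (sr i) a \<inter> Rk j a \<subseteq> B) \<Longrightarrow> Om D a \<subseteq> B"
  unfolding Om_def by (rule Jn_least) auto

text \<open>While \<open>s j\<close> lies beyond \<open>b\<close>, \<open>Rk j a\<close> is the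
  preimage of \<open>Rk j b\<close>, and Frobenius reciprocity moves the generator along. Once
  \<open>s j\<close> is at most \<open>b\<close>, the generator lies in the kernel.\<close>

lemma push_gen:
  assumes ab: "a \<le> b" and i: "i \<in> Ix a" and j: "j \<in> Jx a"
  shows "push (fl a b) (Kh (sr i) a \<inter> Rk j a) = (if j \<in> Jx b then Kh (sr i) b \<inter> Rk j b else bt (fo b))"
proof (cases "j \<in> Jx b")
  case True
  have "Rk j a = pull (fl a b) (Rk j b)"
  proof (cases "j = n + 1")
    case True
    then show ?thesis using pull_tp[OF fl_homs[OF ab]] by (simp add: Rk_def)
  next
    case False
    then show ?thesis using pull_Kk[OF ab, of "sr j"] Jx_less[OF True False] by (simp add: Rk_def)
  qed
  then show ?thesis
    using True push_pull_inter[OF fl_homs[OF ab] Kh_subs Rk_subs] push_Kh[OF Ix_le[OF i] ab] by simp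
next
  case False
  then have jb: "s j \<le> ereal b" "j \<in> {1..n + 1}" using j by (auto simp: Jx_def)
  then have jn: "j \<in> {1..n}" "j \<noteq> n + 1" using s_top by (auto simp: le_Suc_eq)
  have "sr j \<le> b" using jb s_sr[OF jn(1)] by simp
  then have "Rk j a \<subseteq> Kk b a" using Kk_mono jn by (simp add: Rk_def)
  also have "Kk b a = pull (fl a b) (bt (fo b))" using ab by (simp add: Kk_def)
  finally have "Kh (sr i) a \<inter> Rk j a \<subseteq> pull (fl a b) (bt (fo b))" by blast
  then have "push (fl a b) (Kh (sr i) a \<inter> Rk j a) \<subseteq> bt (fo b)"
    using push_subset_iff[OF fl_homs[OF ab] inter_subs[OF Kh_subs Rk_subs] bts] by simp
  then show ?thesis
    using False bt_subset[OF push_subs[OF fl_homs[OF ab] inter_subs[OF Kh_subs Rk_subs]]] by auto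
qed

lemma push_Om_subset: assumes ab: "a \<le> b" shows "push (fl a b) (Om D a) \<subseteq> Om D b"
proof -
  have "push (fl a b) (Kh (sr i) a \<inter> Rk j a) \<subseteq> Om D b" if ij: "(i, j) \<in> idx D a" for i j
  proof -
    have i: "i \<in> Ix a" "j \<in> Jx a" "cell i j \<in> D" using ij by (auto simp: idx_def)
    show ?thesis
    proof (cases "j \<in> Jx b")
      case True
      then have "(i, j) \<in> idx D b" using i Ix_mono[OF ab] by (auto simp: idx_def)
      then show ?thesis using push_gen[OF ab i(1,2)] True Om_upper by simp
    next
      case False
      then show ?thesis using push_gen[OF ab i(1,2)] bt_subset[OF Om_subs] by simp
    qed
  qed
  then have "Om D a \<subseteq> pull (fl a b) (Om D b)"
    using push_subset_iff[OF fl_homs[OF ab] inter_subs[OF Kh_subs Rk_subs] Om_subs]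
    by (intro Om_least pull_subs[OF fl_homs[OF ab] Om_subs]) blast
  then show ?thesis using push_subset_iff[OF fl_homs[OF ab] Om_subs Om_subs] by blast
qed

text \<open>The assumption says that no cell of \<open>D\<close> around \<open>b\<close> starts
  after \<open>a\<close>, so every generator at \<open>b\<close> is the image of one at
  \<open>a\<close>.\<close>

lemma push_Om:
  assumes ab: "a \<le> b" and D: "\<And>i j. (i, j) \<in> idx D b \<Longrightarrow> i \<in> Ix a"
  shows "push (fl a b) (Om D a) = Om D b"
proof
  show "push (fl a b) (Om D a) \<subseteq> Om D b" using push_Om_subset[OF ab] .
  show "Om D b \<subseteq> push (fl a b) (Om D a)"
  proof (rule Om_least[OF push_subs[OF fl_homs[OF ab] Om_subs]])
    fix i j assume ij: "(i, j) \<in> idx D b"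
    then have i: "i \<in> Ix a" "j \<in> Jx a" "j \<in> Jx b" "cell i j \<in> D"
      using D Jx_anti[OF ab] by (auto simp: idx_def)
    then have "(i, j) \<in> idx D a" by (simp add: idx_def)
    then have "push (fl a b) (Kh (sr i) a \<inter> Rk j a) \<subseteq> push (fl a b) (Om D a)"
      using push_mono[OF Om_upper] by blast
    then show "Kh (sr i) b \<inter> Rk j b \<subseteq> push (fl a b) (Om D a)" using push_gen[OF ab i(1,2)] i(3) by simp
  qed
qed

lemma subf_Om: "subf f (Om D)"
  unfolding subf_def using Om_subs push_Om_subset push_subset_iff[OF fl_homs Om_subs Om_subs] by blast

section \<open>Cells and their order\<close>

lemma cell_props:
  assumes "i \<in> {1..n}" "j \<in> {1..n + 1}" "i < j"
  shows "cell i j \<in> real_intervals" "lo (cell i j) = {x. ereal x < s i}" "hi (cell i j) = {x. ereal x < s j}"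
    "cell i j = {x. s i \<le> ereal x \<and> ereal x < s j}"
proof -
  have l: "ereal (sr i) < s j" using s_less_iff[of i j] assms s_sr[OF assms(1)] by simp
  show "cell i j \<in> real_intervals" unfolding cell_def by (rule half_open_interval[OF l])
  show "lo (cell i j) = {x. ereal x < s i}" unfolding cell_def lo_half_open[OF l] s_sr[OF assms(1)] by simp
  show "hi (cell i j) = {x. ereal x < s j}" unfolding cell_def by (rule hi_half_open[OF l])
  show "cell i j = {x. s i \<le> ereal x \<and> ereal x < s j}" unfolding cell_def half_open_def s_sr[OF assms(1)] by simp
qed

lemma Ix_Jx_less: assumes "i \<in> Ix a" "j \<in> Jx a" shows "i \<in> {1..n}" "j \<in> {1..n + 1}" "i < j"
proof -
  show i: "i \<in> {1..n}" "j \<in> {1..n + 1}" using assms by (auto simp: Ix_def Jx_def)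
  have "s i < s j" using assms by (auto simp: Ix_def Jx_def intro: le_less_trans)
  then show "i < j" using s_less_iff i by simp
qed

lemma mem_idx: "(i, j) \<in> idx D a \<Longrightarrow> i \<in> {1..n} \<and> j \<in> {1..n + 1} \<and> i < j \<and> i \<in> Ix a \<and> j \<in> Jx a \<and> cell i j \<in> D \<and> a \<in> cell i j"
proof -
  assume a: "(i, j) \<in> idx D a"
  then have "i \<in> Ix a" "j \<in> Jx a" "cell i j \<in> D" by (auto simp: idx_def)
  moreover from this have "a \<in> cell i j" using cell_props(4)[OF Ix_Jx_less] by (auto simp: Ix_def Jx_def)
  ultimately show ?thesis using Ix_Jx_less by simp
qed

lemma cell_le_iff:
  assumes "i \<in> {1..n}" "j \<in> {1..n + 1}" "i < j" "i' \<in> {1..n}" "j' \<in> {1..n + 1}" "i' < j'"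
  shows "lo (cell i j) \<subseteq> lo (cell i' j') \<and> hi (cell i j) \<subseteq> hi (cell i' j') \<longleftrightarrow> i \<le> i' \<and> j \<le> j'"
proof -
  have sub: "{x. ereal x < s k} \<subseteq> {x. ereal x < s l} \<longleftrightarrow> k \<le> l" if kl: "k \<in> {1..n + 1}" "l \<in> {1..n + 1}" for k l
  proof
    assume a: "{x. ereal x < s k} \<subseteq> {x. ereal x < s l}"
    show "k \<le> l"
    proof (rule ccontr)
      assume "\<not> k \<le> l"
      then have l: "l \<in> {1..n}" "s l < s k" using kl s_less_iff by auto
      \<comment> \<open>The critical value \<open>s l\<close> itself separates the two sets; it is
        real because \<open>l < k \<le> n + 1\<close>.\<close>
      then have "sr l \<in> {x. ereal x < s k}" using s_sr[OF l(1)] by simp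
      then have "ereal (sr l) < s l" using a by blast
      then show False using s_sr[OF l(1)] by simp
    qed
  next
    assume "k \<le> l"
    then have "s k \<le> s l" using s_le_iff kl by simp
    then show "{x. ereal x < s k} \<subseteq> {x. ereal x < s l}" by (auto intro: less_le_trans)
  qed
  have "i \<in> {1..n + 1}" "i' \<in> {1..n + 1}" using assms by auto
  then show ?thesis
    unfolding cell_props(2,3)[OF assms(1-3)] cell_props(2,3)[OF assms(4-6)] using sub assms by blast
qed

lemma idx_downset:
  assumes D: "D \<in> downsets real_intervals interval_le" and ij: "(i, j) \<in> idx D a"
    and "i' \<in> Ix a" "j' \<in> Jx a" "i' \<le> i" "j' \<le> j"
  shows "(i', j') \<in> idx D a"
proof -
  note m = mem_idx[OF ij] and m' = Ix_Jx_less[OF assms(3,4)]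
  have "lo (cell i' j') \<subseteq> lo (cell i j) \<and> hi (cell i' j') \<subseteq> hi (cell i j)"
    using cell_le_iff[OF m', of i j] m assms(5,6) by simp
  then have "cell i' j' \<in> D" using D cell_props(1)[OF m'] m unfolding mem_downsets_iff by blast
  then show ?thesis using assms by (simp add: idx_def)
qed

section \<open>Values on the prescribed down-closed sets\<close>

lemma locate: "ereal c < s 1 \<or> (\<exists>i \<in> {1..n}. s i \<le> ereal c \<and> ereal c < s (i + 1))"
proof (cases "Ix c = {}")
  case True
  show ?thesis
  \<comment> \<open>For \<open>n = 0\<close> the value \<open>s 1\<close> is
    \<open>s (n + 1)\<close>, which is infinite.\<close>
  proof (cases "n = 0")
    case True
    then show ?thesis using s_top by simp
  next
    case False
    then have "1 \<in> {1..n}" by simp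
    then have "\<not> s 1 \<le> ereal c" using True unfolding Ix_def by blast
    then show ?thesis by (simp add: not_le)
  qed
next
  case False
  have fin: "finite (Ix c)" by (simp add: Ix_def)
  define i where "i = Max (Ix c)"
  have i: "i \<in> Ix c" using Max_in[OF fin False] by (simp add: i_def)
  have "ereal c < s (i + 1)"
  proof (cases "i = n")
    case True
    then show ?thesis using s_top by simp
  next
    case False
    have "i + 1 \<notin> Ix c" using Max_ge[OF fin, of "i + 1"] by (auto simp: i_def)
    then show ?thesis using i False by (auto simp: Ix_def)
  qed
  then show ?thesis using i by (auto simp: Ix_def)
qed

lemma zero_subs: assumes "ereal a < s 1" "A \<in> subs (fo a)" shows "A = bt (fo a)"
  using zero_before[OF assms(1)] zero_object_tp subset_tp[OF assms(2)] bt_subset[OF assms(2)] by blast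

text \<open>From \<open>s i\<close> to \<open>c\<close> the diagram is an isomorphism, so the two
  objects have the same image at \<open>a\<close>.\<close>

lemma Kh_cover:
  assumes i: "i \<in> {1..n}" "s i \<le> ereal c" "ereal c < s (i + 1)" and ca: "c \<le> a"
  shows "i \<in> Ix a" "Kh (sr i) a = Kh c a"
proof -
  have ic: "sr i \<le> c" using i s_sr[OF i(1)] by simp
  show "i \<in> Ix a" using i ca by (auto simp: Ix_def intro: order_trans)
  have "push (fl (sr i) c) (tp (fo (sr i))) = tp (fo c)"
    using push_tp_epic[OF fl_homs[OF ic]] iso_epic[OF _ fl_homs[OF ic]] iso_between[OF i(1) _ ic i(3)] s_sr[OF i(1)]
    by simp
  then have "Kh (sr i) c = Kh c c" using ic fl_id push_id[OF tps] by (simp add: Kh_def)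
  then show "Kh (sr i) a = Kh c a" using push_Kh[OF ic ca] push_Kh[OF order.refl ca] by simp
qed

lemma Rk_top: "n + 1 \<in> Jx a" "Rk (n + 1) a = tp (fo a)"
  using s_top by (simp_all add: Jx_def Rk_def)

lemma Om_lo_avoid: "Om (lo_avoid c) a = Kh c a"
proof
  show "Om (lo_avoid c) a \<subseteq> Kh c a"
  proof (rule Om_least[OF Kh_subs])
    fix i j assume "(i, j) \<in> idx (lo_avoid c) a"
    note m = mem_idx[OF this]
    then have "c \<notin> lo (cell i j)" by (simp add: lo_avoid_def)
    then have "sr i \<le> c" using cell_props(2)[of i j] m s_sr[of i] by simp
    then show "Kh (sr i) a \<inter> Rk j a \<subseteq> Kh c a" using Kh_mono by blast
  qed
  \<comment> \<open>\<open>Kh c a\<close> is everything as soon as \<open>c \<ge> a\<close>, so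
    \<open>c\<close> may be replaced by \<open>min c a\<close>.\<close>
  define m where "m = min c a"
  have ma: "m \<le> a" and km: "Kh c a = Kh m a" unfolding m_def using Kh_full[of a c] Kh_full[of a a] by (auto simp: min_def)
  show "Kh c a \<subseteq> Om (lo_avoid c) a"
  proof (cases "ereal m < s 1")
    case True
    have "Kh m a = bt (fo a)"
      using zero_subs[OF True tps] ma push_bt[OF fl_homs[OF ma]] by (simp add: Kh_def)
    then show ?thesis using km bt_subset[OF Om_subs] by simp
  next
    case False
    then obtain i where i: "i \<in> {1..n}" "s i \<le> ereal m" "ereal m < s (i + 1)" using locate by blast
    note c = Kh_cover[OF i ma]
    \<comment> \<open>The unbounded cell imposes no kernel condition, as \<open>Rk (n + 1) a\<close>
      is everything.\<close>
    note m = Ix_Jx_less[OF c(1) Rk_top(1)]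
    have "s i \<le> ereal c" using i(2) by (auto simp: m_def intro: order_trans)
    then have "cell i (n + 1) \<in> lo_avoid c" using cell_props(1,2)[OF m] by (auto simp: lo_avoid_def)
    then have "(i, n + 1) \<in> idx (lo_avoid c) a" using c(1) Rk_top(1) by (simp add: idx_def)
    then have "Kh (sr i) a \<inter> Rk (n + 1) a \<subseteq> Om (lo_avoid c) a" by (rule Om_upper)
    moreover have "Kh (sr i) a \<inter> Rk (n + 1) a = Kh (sr i) a"
      unfolding Rk_top(2) using subset_tp[OF Kh_subs] by blast
    ultimately show ?thesis unfolding km c(2)[symmetric] by blast
  qed
qed

lemma Om_all: "Om real_intervals a = tp (fo a)"
proof -
  have "Om (lo_avoid a) a \<subseteq> Om real_intervals a" by (intro Om_mono idx_mono) (auto simp: lo_avoid_def)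
  then have "tp (fo a) \<subseteq> Om real_intervals a" using Om_lo_avoid[of a a] Kh_full[of a a] by simp
  then show ?thesis by (rule equalityI[OF subset_tp[OF Om_subs]])
qed

lemma Om_hi_avoid: "Om (hi_avoid c) a = Kk c a"
proof
  show "Om (hi_avoid c) a \<subseteq> Kk c a"
  proof (rule Om_least[OF Kk_subs])
    fix i j assume "(i, j) \<in> idx (hi_avoid c) a"
    note m = mem_idx[OF this]
    then have "c \<notin> hi (cell i j)" by (simp add: hi_avoid_def)
    then have sj: "s j \<le> ereal c" using cell_props(3)[of i j] m by simp
    then have j: "j \<in> {1..n}" "j \<noteq> n + 1" using m s_top by (auto simp: le_Suc_eq)
    then have "sr j \<le> c" using s_sr[OF j(1)] sj by simp
    then show "Kh (sr i) a \<inter> Rk j a \<subseteq> Kk c a" using Kk_mono j by (auto simp: Rk_def)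
  qed
  show "Kk c a \<subseteq> Om (hi_avoid c) a"
  proof (cases "c \<le> a \<or> ereal a < s 1")
    case True
    then have "Kk c a = bt (fo a)" using Kk_vanish zero_subs[OF _ Kk_subs] by blast
    then show ?thesis using bt_subset[OF Om_subs] by simp
  next
    case False
    then have ac: "a \<le> c" and a1: "\<not> ereal a < s 1" by auto
    have "ereal a \<le> ereal c" using ac by simp
    then have "\<not> ereal c < s 1" using a1 le_less_trans by blast
    then obtain j where j: "j \<in> {1..n}" "s j \<le> ereal c" "ereal c < s (j + 1)" using locate by blast
    obtain i where i: "i \<in> {1..n}" "s i \<le> ereal a" "ereal a < s (i + 1)" using locate a1 by blast
    have jc: "sr j \<le> c" using j s_sr[OF j(1)] by simp
    show ?thesis
    proof (cases "s j \<le> ereal a")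
      case True
      \<comment> \<open>Here \<open>a\<close> and \<open>c\<close> both lie between
        \<open>s j\<close> and \<open>s (j + 1)\<close>, so nothing dies on the way.\<close>
      have "monic C (fl a c)" using iso_monic[OF iso_between[OF j(1) True ac j(3)] fl_homs[OF ac]] .
      then have "Kk c a = bt (fo a)" using pull_bt_monic[OF fl_homs[OF ac]] ac by (simp add: Kk_def)
      then show ?thesis using bt_subset[OF Om_subs] by simp
    next
      case False
      then have aj: "a \<le> sr j" and jx: "j \<in> Jx a" using s_sr[OF j(1)] j(1) by (auto simp: Jx_def)
      \<comment> \<open>What dies up to \<open>c\<close> has already died at \<open>s j\<close>, the
        last critical value up to \<open>c\<close>. The index \<open>i\<close> with \<open>a\<close>
        between \<open>s i\<close> and \<open>s (i + 1)\<close> imposes no image condition.\<close>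
      have "monic C (fl (sr j) c)"
        using iso_monic[OF iso_between[OF j(1) _ jc j(3)] fl_homs[OF jc]] s_sr[OF j(1)] by simp
      then have "Kk c (sr j) = Kk (sr j) (sr j)"
        using pull_bt_monic[OF fl_homs[OF jc]] jc Kk_vanish[of "sr j" "sr j"] by (simp add: Kk_def[of c])
      then have e: "Kk c a = Rk j a" using pull_Kk[OF aj jc] pull_Kk[OF aj order.refl] j(1) by (simp add: Rk_def)
      note c = Kh_cover[OF i order.refl]
      note m = Ix_Jx_less[OF c(1) jx]
      have "cell i j \<in> hi_avoid c" using cell_props(1,3)[OF m] j(2) by (auto simp: hi_avoid_def)
      then have "(i, j) \<in> idx (hi_avoid c) a" using c(1) jx by (simp add: idx_def)
      then have "Kh (sr i) a \<inter> Rk j a \<subseteq> Om (hi_avoid c) a" by (rule Om_upper)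
      moreover have "Kh (sr i) a \<inter> Rk j a = Rk j a"
        unfolding c(2) Kh_full[OF order.refl] using subset_tp[OF Rk_subs] by blast
      ultimately show ?thesis unfolding e by blast
    qed
  qed
qed

text \<open>At a fixed point only the cells in the finite grid \<open>Ix a \<times> Jx a\<close>
  matter, and \<open>idx\<close> commutes with nonempty intersections, so
  \<open>bifiltration_Inter\<close> applies to arbitrary families.\<close>

lemma Om_Inter:
  assumes ne: "\<D> \<noteq> {}" and D: "\<D> \<subseteq> downsets real_intervals interval_le"
  shows "(\<Inter>D \<in> \<D>. Om D a) = Om (\<Inter>\<D>) a"
proof
  have i: "(\<Inter>D \<in> \<D>. idx D a) = idx (\<Inter>\<D>) a" 
  proof (rule Set.set_eqI)
    fix q :: "nat \<times> nat"
    obtain i j where "q = (i, j)" by (cases q)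
    then show "q \<in> (\<Inter>D \<in> \<D>. idx D a) \<longleftrightarrow> q \<in> idx (\<Inter>\<D>) a"
      unfolding idx_def using ne by (simp add: Inter_iff) blast
  qed
  have "(\<Inter>E \<in> (\<lambda>D. idx D a) ` \<D>. Jn (fo a) ((\<lambda>(i, j). Kh (sr i) a \<inter> Rk j a) ` E))
      \<subseteq> Jn (fo a) ((\<lambda>(i, j). Kh (sr i) a \<inter> Rk j a) ` \<Inter>((\<lambda>D. idx D a) ` \<D>))"
  proof (rule bifiltration_Inter[where I = "Ix a" and J = "Jx a"])
    show "finite (Ix a)" "finite (Jx a)" by (simp_all add: Ix_def Jx_def)
    fix E i j i' j'
    assume "E \<in> (\<lambda>D. idx D a) ` \<D>" "(i, j) \<in> E" "i' \<in> Ix a" "j' \<in> Jx a" "i' \<le> i" "j' \<le> j"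
    then show "(i', j') \<in> E" using idx_downset D by blast
  next
    show "(\<lambda>D. idx D a) ` \<D> \<noteq> {}" using ne by simp
    show "E \<subseteq> Ix a \<times> Jx a" if "E \<in> (\<lambda>D. idx D a) ` \<D>" for E using that finite_idx(2) by blast
  qed (rule fo_obj Kh_subs Rk_subs Kh_sr_mono Rk_mono; assumption)+
  then show "(\<Inter>D \<in> \<D>. Om D a) \<subseteq> Om (\<Inter>\<D>) a" unfolding i by (simp add: Om_def)
  show "Om (\<Inter>\<D>) a \<subseteq> (\<Inter>D \<in> \<D>. Om D a)" using Om_mono[OF idx_mono] by blast
qed

lemma Om_Int:
  assumes "D \<in> downsets real_intervals interval_le" "D' \<in> downsets real_intervals interval_le"
  shows "Om D a \<inter> Om D' a = Om (D \<inter> D') a"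
  using Om_Inter[of "{D, D'}" a] assms by simp

text \<open>The contribution of \<open>J\<close> at \<open>a\<close>; \<open>pd_JH\<close>
  identifies it with the vector of the saecular diagram of \<open>J\<close> at
  \<open>a\<close>.\<close>

definition gr :: "real set \<Rightarrow> real \<Rightarrow> 'o set \<Rightarrow> int" where
  "gr J a K = mu K (fo a) (Om (strict_down J) a) (Om (principal_down J) a)"

lemma strict_subset_principal: "Om (strict_down J) a \<subseteq> Om (principal_down J) a"
  by (intro Om_mono idx_mono) (auto simp: mem_strict_down)

text \<open>A maximal cell is removed. \<open>Om D a\<close> is the join of the values at its
  principal down-set and at the remaining set \<open>D'\<close>, and these meet in the value at the
  strict down-set, so \<open>mu_modular\<close> identifies the increment with the contribution of
  the cell.\<close>

lemma Om_measure:
  assumes "D \<in> downsets real_intervals interval_le"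
  shows "mu K (fo a) (bt (fo a)) (Om D a) = (\<Sum>(i, j) \<in> idx D a. gr (cell i j) a K)"
  using assms
proof (induction "card (idx D a)" arbitrary: D rule: less_induct)
  case less
  show ?case
  proof (cases "idx D a = {}")
    case True
    then show ?thesis using Jn_empty[OF fo_obj] mu_self[OF bts] by (simp add: Om_def)
  next
    case False
    \<comment> \<open>Maximality of \<open>i + j\<close> ensures that no other cell of
      \<open>D\<close> around \<open>a\<close> lies above \<open>cell i j\<close>.\<close>
    let ?g = "\<lambda>(i, j). i + j"
    have "Max (?g ` idx D a) \<in> ?g ` idx D a" using finite_idx(1) False by (intro Max_in) auto
    then obtain i j where ij: "(i, j) \<in> idx D a" and e: "Max (?g ` idx D a) = i + j" by auto
    have mx: "i' + j' \<le> i + j" if "(i', j') \<in> idx D a" for i' j'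
      unfolding e[symmetric] using finite_idx(1) that by (intro Max_ge) force+
    note m = mem_idx[OF ij]
    have J: "cell i j \<in> real_intervals" using cell_props(1)[of i j] m by blast
    \<comment> \<open>Everything above the cell is deleted, not just the cell, so that
      \<open>D'\<close> stays down-closed; among the cells around \<open>a\<close> only
      \<open>(i, j)\<close> is lost.\<close>
    define D' where "D' = {L \<in> D. \<not> (lo (cell i j) \<subseteq> lo L \<and> hi (cell i j) \<subseteq> hi L)}"
    have Ds: "D \<subseteq> real_intervals" "\<And>L M. M \<in> D \<Longrightarrow> L \<in> real_intervals \<Longrightarrow> lo L \<subseteq> lo M \<Longrightarrow> hi L \<subseteq> hi M \<Longrightarrow> L \<in> D"
      using less(2) unfolding mem_downsets_iff by blast+
    have D': "D' \<in> downsets real_intervals interval_le"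
      unfolding mem_downsets_iff D'_def using Ds by blast
    have pd: "principal_down (cell i j) \<subseteq> D" using mem_principal_down[OF J] Ds m by blast
    have sd: "principal_down (cell i j) \<inter> D' = strict_down (cell i j)"
    proof (rule Set.set_eqI)
      fix L
      show "L \<in> principal_down (cell i j) \<inter> D' \<longleftrightarrow> L \<in> strict_down (cell i j)"
        using mem_principal_down[OF J, of L] mem_strict_down[of L "cell i j"] real_intervals_antisym[OF J, of L] pd
        unfolding D'_def by blast
    qed
    have iD': "idx D' a = idx D a - {(i, j)}"
    proof (rule Set.set_eqI)
      fix q :: "nat \<times> nat"
      obtain i' j' where q: "q = (i', j')" by (cases q)
      show "q \<in> idx D' a \<longleftrightarrow> q \<in> idx D a - {(i, j)}"
      proof (cases "q \<in> idx D a")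
        case True
        note m' = mem_idx[OF True[unfolded q]]
        have "lo (cell i j) \<subseteq> lo (cell i' j') \<and> hi (cell i j) \<subseteq> hi (cell i' j') \<longleftrightarrow> i \<le> i' \<and> j \<le> j'"
          using cell_le_iff[of i j i' j'] m m' by blast
        also have "\<dots> \<longleftrightarrow> q = (i, j)" using mx[of i' j'] True q by auto
        finally show ?thesis using True m' q unfolding idx_def D'_def by auto
      next
        case False
        then show ?thesis unfolding idx_def D'_def by auto
      qed
    qed
    have un: "idx D a = idx D' a \<union> idx (principal_down (cell i j)) a"
    proof -
      have "(i, j) \<in> idx (principal_down (cell i j)) a"
        using m mem_principal_down[OF J] J by (simp add: idx_def)
      then show ?thesis using iD' idx_mono[OF pd, of a] ij by blast
    qed
    have "Om D a = join (fo a) (Om D' a) (Om (principal_down (cell i j)) a)"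
      unfolding Om_def un image_Un
      by (rule Jn_Un[OF fo_obj finite_imageI[OF finite_idx(1)] gen_subs finite_imageI[OF finite_idx(1)] gen_subs])
    then have j: "Om D a = join (fo a) (Om (principal_down (cell i j)) a) (Om D' a)"
      using join_comm[OF Om_subs Om_subs] by simp
    have md: "gr (cell i j) a K = mu K (fo a) (Om D' a) (Om D a)"
      unfolding gr_def j using mu_modular[OF finite_len Om_subs Om_subs]
        Om_Int[OF principal_down_downset[OF J] D'] sd by metis
    have sub: "Om D' a \<subseteq> Om D a" using iD' by (intro Om_mono) blast
    have "mu K (fo a) (bt (fo a)) (Om D a) = mu K (fo a) (bt (fo a)) (Om D' a) + gr (cell i j) a K"
      using mu_add[OF finite_len bts Om_subs Om_subs bt_subset[OF Om_subs] sub] md by simp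
    also have "mu K (fo a) (bt (fo a)) (Om D' a) = (\<Sum>(i, j) \<in> idx D' a. gr (cell i j) a K)"
      using less(1)[OF _ D'] iD' ij finite_idx(1)[of D a] by (simp add: card_gt_0_iff False)
    finally show ?thesis unfolding iD' using sum.remove[OF finite_idx(1) ij, of "\<lambda>(i, j). gr (cell i j) a K"] by simp
  qed
qed

text \<open>Supplies the assumption of \<open>push_Om\<close>: a cell below \<open>J\<close> starts
  no later than any point of \<open>J\<close>, also when it is observed at a different point
  \<open>b\<close>.\<close>

lemma idx_down_left:
  assumes J: "J \<in> real_intervals" and a: "a \<in> J" and ij: "(i, j) \<in> idx (principal_down J) b"
  shows "i \<in> Ix a"
proof -
  note m = mem_idx[OF ij]
  have "lo (cell i j) \<subseteq> lo J" using m mem_principal_down[OF J] by blast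
  moreover have "a \<notin> lo J" using a real_interval_eq[OF J] by blast
  ultimately have "a \<notin> lo (cell i j)" by blast
  then show ?thesis using cell_props(2)[of i j] m by (simp add: Ix_def)
qed

end

section \<open>Down-closed sets and uniqueness of the inversion\<close>

lemma downsets_Union: "\<D> \<subseteq> downsets P leq \<Longrightarrow> \<Union>\<D> \<in> downsets P leq"
  unfolding downsets_def by blast

lemma downsets_Inter: "\<D> \<subseteq> downsets P leq \<Longrightarrow> P \<inter> \<Inter>\<D> \<in> downsets P leq"
  unfolding downsets_def by blast

lemma downsets_all: "P \<in> downsets P leq"
  unfolding downsets_def by blast

lemma half_open_Dgm: "ereal a < b \<Longrightarrow> half_open a b \<in> Dgm"
  unfolding Dgm_def by blast

text \<open>Compare the two inversion formulas at a maximal interval where the inversions differ.\<close>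

lemma moebius_inversion_unique:
  assumes X: "is_moebius_inversion C f S X" and Y: "is_moebius_inversion C f S' Y"
  shows "X = Y"
proof (rule ccontr)
  assume "X \<noteq> Y"
  define U where "U = {L. X L \<noteq> Y L}"
  have fX: "finite {L. X L \<noteq> (\<lambda>_. 0)}" and fY: "finite {L. Y L \<noteq> (\<lambda>_. 0)}"
    using X Y unfolding is_moebius_inversion_def by blast+
  have "U \<subseteq> {L. X L \<noteq> (\<lambda>_. 0)} \<union> {L. Y L \<noteq> (\<lambda>_. 0)}" unfolding U_def by auto
  then have "finite U" using fX fY by (meson finite_UnI finite_subset)
  moreover have "U \<noteq> {}" using \<open>X \<noteq> Y\<close> unfolding U_def by auto
  ultimately obtain L where L: "L \<in> U" "\<And>L'. L' \<in> U \<Longrightarrow> L \<subseteq> L' \<Longrightarrow> L' = L"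
    using finite_has_maximal[of U] by metis
  obtain K where K: "X L K \<noteq> Y L K" using L(1) unfolding U_def by auto
  have "X L \<noteq> (\<lambda>_. 0) \<or> Y L \<noteq> (\<lambda>_. 0)" using K by metis
  then obtain a b where ab: "ereal a < b" "L = half_open a b"
    using X Y unfolding is_moebius_inversion_def by metis
  \<comment> \<open>A common finite support above \<open>L\<close>, so that both sums run over the
    same index set and agree away from \<open>L\<close>.\<close>
  define T where "T = {L' \<in> Dgm. L \<subseteq> L' \<and> (X L' \<noteq> (\<lambda>_. 0) \<or> Y L' \<noteq> (\<lambda>_. 0))}"
  have fT: "finite T" by (rule finite_subset[OF _ finite_UnI[OF fX fY]]) (auto simp: T_def)
  have LT: "L \<in> T" unfolding T_def using half_open_Dgm ab K by fastforce
  have "rank_vector C f a b K = (\<Sum>L' | L' \<in> Dgm \<and> L \<subseteq> L' \<and> X L' \<noteq> (\<lambda>_. 0). X L' K)"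
    using X ab unfolding is_moebius_inversion_def by blast
  also have "\<dots> = (\<Sum>L' \<in> T. X L' K)"
    by (rule sum.mono_neutral_left[OF fT]) (auto simp: T_def)
  finally have x: "rank_vector C f a b K = X L K + (\<Sum>L' \<in> T - {L}. X L' K)"
    using sum.remove[OF fT LT] by simp
  have "rank_vector C f a b K = (\<Sum>L' | L' \<in> Dgm \<and> L \<subseteq> L' \<and> Y L' \<noteq> (\<lambda>_. 0). Y L' K)"
    using Y ab unfolding is_moebius_inversion_def by blast
  also have "\<dots> = (\<Sum>L' \<in> T. Y L' K)"
    by (rule sum.mono_neutral_left[OF fT]) (auto simp: T_def)
  finally have y: "rank_vector C f a b K = Y L K + (\<Sum>L' \<in> T - {L}. Y L' K)"
    using sum.remove[OF fT LT] by simp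
  have "(\<Sum>L' \<in> T - {L}. X L' K) = (\<Sum>L' \<in> T - {L}. Y L' K)"
  proof (rule sum.cong[OF refl])
    fix L' assume "L' \<in> T - {L}"
    then have "L' \<notin> U" using L(2)[of L'] unfolding T_def by blast
    then show "X L' K = Y L' K" unfolding U_def by simp
  qed
  then show False using x y K by simp
qed

context abcat
begin

lemma iso_JH:
  assumes "finite_length C X" "g \<in> H X Y" "iso_arr C g" shows "JH C X = JH C Y"
proof -
  have X: "X \<in> cobj C" using homs_obj assms by blast
  have "pull g (bt Y) = bt X" using pull_bt_monic[OF assms(2) iso_monic[OF assms(3,2)]] .
  then show ?thesis
    using phi_JH[OF id_homs[OF X] id_monic[OF X] assms(2) iso_epic[OF assms(3,2)] assms(1)]
      JH_eq_mu[OF assms(1)] pull_tp[OF assms(2)] push_id[OF tp_subs[OF X]] push_id[OF bt_subs[OF X]] by simp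
qed

lemma subq_zero:
  assumes A: "A \<in> subs X" and Q: "subq X A A Q" shows "zero_object C Q"
proof -
  obtain W u e where u: "u \<in> H W X" "e \<in> H W Q" "epic C e" "pull u A = pull e (bt Q)"
    "join X A (push u (tp W)) = A" using Q unfolding subq_def by blast
  have o: "W \<in> cobj C" "Q \<in> cobj C" using homs_obj u(2) by blast+
  have "push u (tp W) \<subseteq> A" using join_ub2[OF A push_subs[OF u(1) tp_subs[OF o(1)]]] u(5) by simp
  then have "tp W \<subseteq> pull e (bt Q)" using push_subset_iff[OF u(1) tp_subs[OF o(1)] A] u(4) by simp
  then have "push e (tp W) \<subseteq> bt Q" using push_subset_iff[OF u(2) tp_subs[OF o(1)] bt_subs[OF o(2)]] by simp
  then have "tp Q = bt Q" using push_tp_epic[OF u(2,3)] subset_tp[OF bt_subs[OF o(2)]] by auto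
  then show ?thesis using zero_object_tp o(2) by blast
qed

end

context constructible_diagram
begin

section \<open>The saecular homomorphism\<close>

abbreviation \<AA> where "\<AA> \<equiv> downsets real_intervals interval_le"
abbreviation SF where "SF \<equiv> Sub (functor_cat C) f"

text \<open>Restricted to the down-closed sets because \<open>saecular_hom\<close> asks for an
  extensional function, which makes uniqueness an equality of functions.\<close>

definition sae :: "real set set \<Rightarrow> (real, 'o, 'm) nattrans set" where
  "sae = restrict (\<lambda>D. fcls f (Om D)) \<AA>"

section \<open>The lattice of subobjects of \<open>f\<close>\<close>

lemma carrier_SF: "carrier SF = fcls f ` {A. subf f A}"
  using carrier_Sub_functor[OF F] .

lemma le_SF: "subf f A \<Longrightarrow> subf f B \<Longrightarrow> le SF (fcls f A) (fcls f B) \<longleftrightarrow> (\<forall>p. A p \<subseteq> B p)"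
  using le_Sub_functor[OF F] .

lemma SF_antisym:
  assumes "M \<in> carrier SF" "N \<in> carrier SF" "le SF M N" "le SF N M" shows "M = N"
proof -
  obtain A B where A: "subf f A" "M = fcls f A" and B: "subf f B" "N = fcls f B"
    using assms(1,2) unfolding carrier_SF by blast
  have "A p = B p" for p
    using assms(3,4) le_SF[OF A(1) B(1)] le_SF[OF B(1) A(1)] unfolding A(2) B(2) by blast
  then have "A = B" by (rule ext)
  then show ?thesis using A(2) B(2) by simp
qed

lemma least_unique_SF: "least SF M X \<Longrightarrow> least SF N X \<Longrightarrow> M = N"
  unfolding least_def using SF_antisym by blast

lemma greatest_unique_SF: "greatest SF M X \<Longrightarrow> greatest SF N X \<Longrightarrow> M = N"
  unfolding greatest_def using SF_antisym by blast

lemma least_SFI: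
  assumes "subf f A" "X \<subseteq> carrier SF" "fcls f A \<in> X"
    "\<And>B p. subf f B \<Longrightarrow> fcls f B \<in> X \<Longrightarrow> A p \<subseteq> B p"
  shows "least SF (fcls f A) X"
  unfolding least_def
proof (intro conjI ballI)
  fix N assume N: "N \<in> X"
  then obtain B where B: "subf f B" "N = fcls f B" using assms(2) unfolding carrier_SF by blast
  then show "le SF (fcls f A) N" using le_SF[OF assms(1) B(1)] assms(4)[OF B(1)] N by simp
qed (use assms in auto)

lemma greatest_SFI:
  assumes "subf f A" "X \<subseteq> carrier SF" "fcls f A \<in> X"
    "\<And>B p. subf f B \<Longrightarrow> fcls f B \<in> X \<Longrightarrow> B p \<subseteq> A p"
  shows "greatest SF (fcls f A) X"
  unfolding greatest_def
proof (intro conjI ballI)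
  fix N assume N: "N \<in> X"
  then obtain B where B: "subf f B" "N = fcls f B" using assms(2) unfolding carrier_SF by blast
  then show "le SF N (fcls f A)" using le_SF[OF B(1) assms(1)] assms(4)[OF B(1)] N by simp
qed (use assms in auto)

lemma sae_eq: "D \<in> \<AA> \<Longrightarrow> sae D = fcls f (Om D)"
  unfolding sae_def by simp

lemma sae_carrier: "D \<in> \<AA> \<Longrightarrow> sae D \<in> carrier SF"
  unfolding carrier_SF using sae_eq subf_Om by auto

text \<open>A cell in a union lies in one of the members, so the generators of \<open>Om\<close> at
  the union are those at the members.\<close>

lemma sae_join:
  assumes D: "\<D> \<subseteq> \<AA>" shows "least SF (sae (\<Union>\<D>)) (Upper SF (sae ` \<D>))"
  unfolding sae_eq[OF downsets_Union[OF D]]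
proof (rule least_SFI[OF subf_Om])
  show "Upper SF (sae ` \<D>) \<subseteq> carrier SF" unfolding Upper_def by blast
  have c: "fcls f (Om (\<Union>\<D>)) \<in> carrier SF" unfolding carrier_SF using subf_Om by blast
  have "le SF (sae E) (fcls f (Om (\<Union>\<D>)))" if E: "E \<in> \<D>" for E
  proof -
    have "Om E p \<subseteq> Om (\<Union>\<D>) p" for p by (intro Om_mono idx_mono) (use E in blast)
    then show ?thesis using sae_eq[OF subsetD[OF D E]] le_SF[OF subf_Om subf_Om] by simp
  qed
  then show "fcls f (Om (\<Union>\<D>)) \<in> Upper SF (sae ` \<D>)" unfolding Upper_def using c by blast
  fix B a assume B: "subf f B" "fcls f B \<in> Upper SF (sae ` \<D>)"
  have le: "Om E a \<subseteq> B a" if E: "E \<in> \<D>" for E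
  proof -
    have "sae E \<in> sae ` \<D> \<inter> carrier SF" using sae_carrier[OF subsetD[OF D E]] E by blast
    then have "le SF (sae E) (fcls f B)" using B(2) unfolding Upper_def by blast
    then show ?thesis using sae_eq[OF subsetD[OF D E]] le_SF[OF subf_Om B(1)] by simp
  qed
  show "Om (\<Union>\<D>) a \<subseteq> B a"
  proof (rule Om_least[OF subf_subs[OF B(1)]])
    fix i j assume "(i, j) \<in> idx (\<Union>\<D>) a"
    then obtain E where E: "E \<in> \<D>" "(i, j) \<in> idx E a" unfolding idx_def by blast
    then show "Kh (sr i) a \<inter> Rk j a \<subseteq> B a" using Om_upper[OF E(2)] le[OF E(1)] by blast
  qed
qed

lemma sae_meet:
  assumes D: "\<D> \<subseteq> \<AA>" shows "greatest SF (sae (real_intervals \<inter> \<Inter>\<D>)) (Lower SF (sae ` \<D>))"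
  unfolding sae_eq[OF downsets_Inter[OF D]]
proof (rule greatest_SFI[OF subf_Om])
  show "Lower SF (sae ` \<D>) \<subseteq> carrier SF" unfolding Lower_def by blast
  let ?I = "real_intervals \<inter> \<Inter>\<D>"
  have c: "fcls f (Om ?I) \<in> carrier SF" unfolding carrier_SF using subf_Om by blast
  have "le SF (fcls f (Om ?I)) (sae E)" if E: "E \<in> \<D>" for E
  proof -
    have "Om ?I p \<subseteq> Om E p" for p by (intro Om_mono idx_mono) (use E in blast)
    then show ?thesis using sae_eq[OF subsetD[OF D E]] le_SF[OF subf_Om subf_Om] by simp
  qed
  then show "fcls f (Om ?I) \<in> Lower SF (sae ` \<D>)" unfolding Lower_def using c by blast
  fix B a assume B: "subf f B" "fcls f B \<in> Lower SF (sae ` \<D>)"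
  have le: "B a \<subseteq> Om E a" if E: "E \<in> \<D>" for E
  proof -
    have "sae E \<in> sae ` \<D> \<inter> carrier SF" using sae_carrier[OF subsetD[OF D E]] E by blast
    then have "le SF (fcls f B) (sae E)" using B(2) unfolding Lower_def by blast
    then show ?thesis using sae_eq[OF subsetD[OF D E]] le_SF[OF B(1) subf_Om] by simp
  qed
  \<comment> \<open>Inserting \<open>real_intervals\<close> makes the family nonempty and supplies
    the intersection with \<open>real_intervals\<close> in the definition; its value is the whole of
    \<open>f\<close>.\<close>
  have "B a \<subseteq> Om real_intervals a" unfolding Om_all using subset_tp[OF subf_subs[OF B(1)]] .
  then have "B a \<subseteq> (\<Inter>E \<in> insert real_intervals \<D>. Om E a)" using le by blast
  also have "\<dots> = Om (\<Inter>(insert real_intervals \<D>)) a"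
    by (rule Om_Inter) (use D downsets_all in auto)
  finally show "B a \<subseteq> Om ?I a" by simp
qed

text \<open>A subobject that is full at \<open>c\<close> contains the image of \<open>f c\<close> at
  every later point, and \<open>Kh c\<close> consists of just these images there.\<close>

lemma sae_K_hat: "is_K_hat C f c (sae (lo_avoid c))"
  unfolding is_K_hat_def sae_eq[OF avoid_downsets(1)]
proof (rule least_SFI[OF subf_Om])
  have "\<forall>b \<le> c. full_at C (fcls f (Om (lo_avoid c))) b"
    using full_at_fcls[OF F subf_Om] Om_lo_avoid Kh_full by simp
  then show "fcls f (Om (lo_avoid c)) \<in> {N \<in> carrier SF. \<forall>b \<le> c. full_at C N b}"
    unfolding carrier_SF using subf_Om by blast
  fix B a assume B: "subf f B" "fcls f B \<in> {N \<in> carrier SF. \<forall>b \<le> c. full_at C N b}"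
  then have full: "B b = tp (fo b)" if "b \<le> c" for b using full_at_fcls[OF F B(1)] that by blast
  show "Om (lo_avoid c) a \<subseteq> B a"
  proof (cases "c \<le> a")
    case True
    have "B c \<subseteq> pull (fl c a) (B a)" using B(1) True unfolding subf_def by blast
    then have "tp (fo c) \<subseteq> pull (fl c a) (B a)" unfolding full[OF order.refl] .
    then have "push (fl c a) (tp (fo c)) \<subseteq> B a"
      using push_subset_iff[OF fl_homs[OF True] tps subf_subs[OF B(1)]] by simp
    then show ?thesis using True by (simp add: Om_lo_avoid Kh_def)
  next
    case False
    then show ?thesis using full[of a] subset_tp[OF Om_subs] by simp
  qed
qed blast

text \<open>A subobject that vanishes at \<open>c\<close> lies, at each earlier point, in the kernel
  of the map to \<open>f c\<close>.\<close>

lemma sae_K: "is_K C f c (sae (hi_avoid c))"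
  unfolding is_K_def sae_eq[OF avoid_downsets(2)]
proof (rule greatest_SFI[OF subf_Om])
  have "\<forall>b \<ge> c. vanishes_at C (fcls f (Om (hi_avoid c))) b"
    using vanishes_at_fcls[OF F subf_Om] Om_hi_avoid Kk_vanish by simp
  then show "fcls f (Om (hi_avoid c)) \<in> {N \<in> carrier SF. \<forall>b \<ge> c. vanishes_at C N b}"
    unfolding carrier_SF using subf_Om by blast
  fix B a assume B: "subf f B" "fcls f B \<in> {N \<in> carrier SF. \<forall>b \<ge> c. vanishes_at C N b}"
  then have van: "B b = bt (fo b)" if "c \<le> b" for b using vanishes_at_fcls[OF F B(1)] that by blast
  show "B a \<subseteq> Om (hi_avoid c) a"
  proof (cases "a \<le> c")
    case True
    have "B a \<subseteq> pull (fl a c) (B c)" using B(1) True unfolding subf_def by blast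
    then show ?thesis using van[of c] True by (simp add: Om_hi_avoid Kk_def)
  next
    case False
    then show ?thesis using van[of a] bt_subset[OF Om_subs] by simp
  qed
qed blast

lemma saecular_hom_sae: "saecular_hom C f sae"
  unfolding saecular_hom_def Let_def lo_avoid_eq hi_avoid_eq
  using sae_join sae_meet sae_K_hat sae_K sae_carrier by (auto simp: sae_def)

text \<open>The prescribed values are unique as least and greatest elements. They determine the
  principal down-sets as meets, and these determine all down-closed sets as joins.\<close>

lemma saecular_hom_unique:
  assumes "saecular_hom C f \<Omega>" "saecular_hom C f \<Omega>'" shows "\<Omega> = \<Omega>'"
proof -
  note h = assms[unfolded saecular_hom_def Let_def lo_avoid_eq hi_avoid_eq]
  have lo: "\<Omega> (lo_avoid c) = \<Omega>' (lo_avoid c)" for c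
  proof -
    have "is_K_hat C f c (\<Omega> (lo_avoid c))" "is_K_hat C f c (\<Omega>' (lo_avoid c))"
      using conjunct1[OF conjunct2[OF conjunct2[OF conjunct2[OF h(1)]]]]
        conjunct1[OF conjunct2[OF conjunct2[OF conjunct2[OF h(2)]]]] by (simp_all only: simp_thms)
    then show ?thesis unfolding is_K_hat_def by (rule least_unique_SF)
  qed
  have hi: "\<Omega> (hi_avoid c) = \<Omega>' (hi_avoid c)" for c
  proof -
    have "is_K C f c (\<Omega> (hi_avoid c))" "is_K C f c (\<Omega>' (hi_avoid c))"
      using conjunct2[OF conjunct2[OF conjunct2[OF conjunct2[OF h(1)]]]]
        conjunct2[OF conjunct2[OF conjunct2[OF conjunct2[OF h(2)]]]] by (simp_all only: simp_thms)
    then show ?thesis unfolding is_K_def by (rule greatest_unique_SF)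
  qed
  have pr: "\<Omega> (principal_down J) = \<Omega>' (principal_down J)" if J: "J \<in> real_intervals" for J
  proof -
    let ?D = "lo_avoid ` (- lo J) \<union> hi_avoid ` (- hi J)"
    have D: "?D \<subseteq> \<AA>" using avoid_downsets by blast
    have "\<Omega> ` ?D = \<Omega>' ` ?D" using lo hi by (intro image_cong) auto
    moreover have "greatest SF (\<Omega> (principal_down J)) (Lower SF (\<Omega> ` ?D))"
      using h(1) D principal_down_eq_Inter[OF J] by metis
    moreover have "greatest SF (\<Omega>' (principal_down J)) (Lower SF (\<Omega>' ` ?D))"
      using h(2) D principal_down_eq_Inter[OF J] by metis
    ultimately show ?thesis using greatest_unique_SF by simp
  qed
  have eq: "\<Omega> D = \<Omega>' D" if D: "D \<in> \<AA>" for D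
  proof -
    have DJ: "D \<subseteq> real_intervals" using D unfolding mem_downsets_iff by blast
    have P: "principal_down ` D \<subseteq> \<AA>" using principal_down_downset DJ by blast
    have "\<Omega> ` principal_down ` D = \<Omega>' ` principal_down ` D"
      using pr DJ by (intro image_cong) auto
    moreover have "least SF (\<Omega> D) (Upper SF (\<Omega> ` principal_down ` D))"
      using h(1) P downset_eq_Union[OF D] by metis
    moreover have "least SF (\<Omega>' D) (Upper SF (\<Omega>' ` principal_down ` D))"
      using h(2) P downset_eq_Union[OF D] by metis
    ultimately show ?thesis using least_unique_SF by simp
  qed
  show ?thesis
    by (rule PiE_ext[OF conjunct1[OF h(1)] conjunct1[OF h(2)] eq])
qed

lemma saecular_hom_ex1: "\<exists>!\<Omega>. saecular_hom C f \<Omega>"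
  using saecular_hom_sae saecular_hom_unique by blast

lemma saecular_CDI_eq: "saecular_CDI C f = sae"
  unfolding saecular_CDI_def
  by (rule the_equality[where P = "saecular_hom C f", OF saecular_hom_sae])
    (rule saecular_hom_unique[OF _ saecular_hom_sae])

section \<open>The saecular persistence diagram\<close>

abbreviation pd where "pd \<equiv> PD_sae C f"

context
  fixes J assumes J: "J \<in> real_intervals"
begin

lemma saecular_CDI_down:
  "saecular_CDI C f (principal_down J) = fcls f (Om (principal_down J))"
  "saecular_CDI C f (strict_down J) = fcls f (Om (strict_down J))"
  unfolding saecular_CDI_eq
  using sae_eq[OF principal_down_downset[OF J]] sae_eq[OF strict_down_downset[OF J]] by simp_all

lemma pd_quotient_exists:
  "\<exists>Q. is_quotient (functor_cat C) (fcls f (Om (principal_down J))) (fcls f (Om (strict_down J))) Q"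
  by (rule is_quotient_functor_exists[OF F subf_Om subf_Om strict_subset_principal])

text \<open>The saecular diagram is selected by Hilbert choice; its properties are all derived from
  its being a quotient of this pair.\<close>

lemma pd_quotient:
  "is_quotient (functor_cat C) (fcls f (Om (principal_down J))) (fcls f (Om (strict_down J))) (pd J)"
  unfolding PD_sae_def quotient_obj_def saecular_CDI_down using someI_ex[OF pd_quotient_exists] .

lemmas pd_facts = quotient_functor[OF F subf_Om subf_Om strict_subset_principal pd_quotient]

lemma pd_JH: "finite_length C (on_obj (pd J) a)" "JH C (on_obj (pd J) a) = gr J a"
  using subq_JH[OF finite_len Om_subs Om_subs strict_subset_principal pd_facts(2)]
  unfolding gr_def by auto

text \<open>\<open>strict_down J\<close> lacks only \<open>J\<close> itself, so the two steps of the
  filtration can differ at \<open>a\<close> only if \<open>J\<close> is a cell containing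
  \<open>a\<close>.\<close>

lemma idx_strict_eq: "(\<And>i j. (i, j) \<in> idx (principal_down J) a \<Longrightarrow> cell i j \<noteq> J) \<Longrightarrow> Om (strict_down J) a = Om (principal_down J) a"
proof -
  assume "\<And>i j. (i, j) \<in> idx (principal_down J) a \<Longrightarrow> cell i j \<noteq> J"
  then have "idx (strict_down J) a = idx (principal_down J) a"
    unfolding idx_def by (auto simp: mem_strict_down)
  then show ?thesis unfolding Om_def by simp
qed

lemma pd_zero: assumes "a \<notin> J" shows "zero_object C (on_obj (pd J) a)"
proof -
  have "Om (strict_down J) a = Om (principal_down J) a"
    using mem_idx assms by (intro idx_strict_eq) blast
  then show ?thesis using subq_zero[OF Om_subs] pd_facts(2)[of a] by simp
qed

text \<open>On \<open>J\<close> the kernel of \<open>f(a \<le> b)\<close> is the value of \<open>Om\<close> at the intervals ending before \<open>b\<close>, none of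
  which lies above \<open>J\<close>; hence it meets \<open>Om (principal_down J)\<close> inside \<open>Om (strict_down J)\<close>.\<close>

lemma pd_iso:
  assumes a: "a \<in> J" and b: "b \<in> J" and ab: "a \<le> b"
  shows "iso_arr C (on_le (pd J) a b)"
proof (rule pd_facts(3)[OF ab])
  show "push (fl a b) (Om (principal_down J) a) = Om (principal_down J) b"
    by (rule push_Om[OF ab]) (rule idx_down_left[OF J a])
  have "idx (strict_down J) b \<subseteq> idx (principal_down J) b"
    by (rule idx_mono) (auto simp: mem_strict_down)
  then have "push (fl a b) (Om (strict_down J) a) = Om (strict_down J) b"
    using idx_down_left[OF J a] by (intro push_Om[OF ab]) blast
  then have "pull (fl a b) (Om (strict_down J) b) = join (fo a) (Om (strict_down J) a) (pull (fl a b) (bt (fo b)))"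
    using pull_push[OF fl_homs[OF ab] Om_subs] by metis
  also have "pull (fl a b) (bt (fo b)) = Om (hi_avoid b) a"
    using ab by (simp add: Om_hi_avoid Kk_def)
  finally have "Om (principal_down J) a \<inter> pull (fl a b) (Om (strict_down J) b)
      = join (fo a) (Om (strict_down J) a) (Om (hi_avoid b) a \<inter> Om (principal_down J) a)"
    using modular[OF Om_subs Om_subs Om_subs strict_subset_principal] by (simp add: Int_commute)
  also have "Om (hi_avoid b) a \<inter> Om (principal_down J) a = Om (hi_avoid b \<inter> principal_down J) a"
    by (rule Om_Int[OF avoid_downsets(2) principal_down_downset[OF J]])
  also have "join (fo a) (Om (strict_down J) a) \<dots> \<subseteq> Om (strict_down J) a"
  proof (rule join_least[OF Om_subs order.refl])
    have "b \<in> hi J" using b real_interval_eq[OF J] by blast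
    then have "hi_avoid b \<inter> principal_down J \<subseteq> strict_down J"
      by (auto simp: mem_strict_down hi_avoid_def)
    then show "Om (hi_avoid b \<inter> principal_down J) a \<subseteq> Om (strict_down J) a"
      by (intro Om_mono idx_mono)
  qed
  finally show "Om (principal_down J) a \<inter> pull (fl a b) (Om (strict_down J) b) \<subseteq> Om (strict_down J) a" .
qed

lemma pd_interval_diagram: "interval_diagram C J (pd J)"
  unfolding interval_diagram_def using pd_facts(1) pd_zero pd_iso by blast

text \<open>The transition maps on \<open>J\<close> are isomorphisms, so the vector is the same at
  all points of \<open>J\<close>; this justifies the definite description in
  \<open>JH_diagram\<close>.\<close>

lemma pd_JH_diagram: assumes a: "a \<in> J" shows "JH_diagram C J (pd J) = gr J a"
proof -
  have "gr J x = gr J y" if "x \<in> J" "y \<in> J" "x \<le> y" for x y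
    using iso_JH[OF pd_JH(1) functor_le[OF pd_facts(1) that(3)] pd_iso[OF that]] pd_JH(2) by simp
  then have c: "gr J x = gr J a" if "x \<in> J" for x using that a by (metis linear)
  show ?thesis unfolding JH_diagram_def pd_JH(2)
  proof (rule the_equality)
    show "\<forall>x \<in> J. gr J x = gr J a" using c by blast
    show "v = gr J a" if "\<forall>x \<in> J. gr J x = v" for v using that a by simp
  qed
qed

lemma interval_point_obtain: obtains a where "a \<in> J"
  using J unfolding real_intervals_def by blast

lemma pd_JH_diagram_simple: "JH_diagram C J (pd J) \<in> simple_vectors C"
  using interval_point_obtain pd_JH_diagram pd_JH JH_simple_vectors by metis

lemma pd_JH_diagram_zero:
  assumes "\<And>i j. i \<in> {1..n} \<Longrightarrow> j \<in> {1..n + 1} \<Longrightarrow> i < j \<Longrightarrow> J \<noteq> cell i j"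
  shows "JH_diagram C J (pd J) = (\<lambda>_. 0)"
proof -
  obtain a where a: "a \<in> J" using interval_point_obtain .
  have "Om (strict_down J) a = Om (principal_down J) a"
    using mem_idx assms by (intro idx_strict_eq) blast
  then have "gr J a = (\<lambda>_. 0)" unfolding gr_def using mu_self[OF Om_subs] by auto
  then show ?thesis using pd_JH_diagram[OF a] by simp
qed

end

section \<open>Comparison with the rank function\<close>

text \<open>The saecular side as a function on all sets of reals, extended by zero; once it is known
  to be a Moebius inversion, uniqueness identifies it with \<open>PD_B\<close>.\<close>

definition XB :: "real set \<Rightarrow> 'o set \<Rightarrow> int" where
  "XB J = (if J \<in> real_intervals then JH_diagram C J (pd J) else (\<lambda>_. 0))"

lemma XB_support: assumes "XB L \<noteq> (\<lambda>_. 0)" obtains i j where "i \<in> {1..n}" "j \<in> {1..n + 1}" "i < j" "L = cell i j"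
  using assms pd_JH_diagram_zero unfolding XB_def by metis

text \<open>A difference of two instances of \<open>Om_measure\<close>, one for all intervals and
  one for \<open>hi_avoid c\<close>; the cells around \<open>a\<close> that survive are those
  reaching beyond \<open>c\<close>.\<close>

lemma image_rank:
  assumes ac: "a \<le> c"
  shows "JH C (image_obj C (fl a c)) K =
    (\<Sum>(i, j) \<in> {(i, j). i \<in> Ix a \<and> j \<in> Jx a \<and> ereal c < s j}. XB (cell i j) K)"
proof -
  have "Om (hi_avoid c) a = pull (fl a c) (bt (fo c))" using ac by (simp add: Om_hi_avoid Kk_def)
  then have "JH C (image_obj C (fl a c)) K = mu K (fo a) (Om (hi_avoid c) a) (Om real_intervals a)"
    using image_JH(2)[OF finite_len fl_homs[OF ac]] Om_all by simp
  also have "\<dots> = mu K (fo a) (bt (fo a)) (Om real_intervals a) - mu K (fo a) (bt (fo a)) (Om (hi_avoid c) a)"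
    using mu_add[OF finite_len bts Om_subs Om_subs bt_subset[OF Om_subs],
        of "hi_avoid c" a real_intervals K] subset_tp[OF Om_subs] by (simp add: Om_all)
  also have "\<dots> = (\<Sum>(i, j) \<in> idx real_intervals a. gr (cell i j) a K) - (\<Sum>(i, j) \<in> idx (hi_avoid c) a. gr (cell i j) a K)"
    using Om_measure[OF downsets_all] Om_measure[OF avoid_downsets(2)] by simp
  also have "\<dots> = (\<Sum>(i, j) \<in> idx real_intervals a - idx (hi_avoid c) a. gr (cell i j) a K)"
    by (rule sum_diff[symmetric, OF finite_idx(1) idx_mono]) (auto simp: hi_avoid_def)
  also have "\<dots> = (\<Sum>(i, j) \<in> {(i, j). i \<in> Ix a \<and> j \<in> Jx a \<and> ereal c < s j}. XB (cell i j) K)"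
  proof (rule sum.cong)
    show "idx real_intervals a - idx (hi_avoid c) a = {(i, j). i \<in> Ix a \<and> j \<in> Jx a \<and> ereal c < s j}"
      using cell_props(1,3)[OF Ix_Jx_less] by (auto simp: idx_def hi_avoid_def not_less)
    fix p assume "p \<in> {(i, j). i \<in> Ix a \<and> j \<in> Jx a \<and> ereal c < s j}"
    then obtain i j where p: "p = (i, j)" "i \<in> Ix a" "j \<in> Jx a" by auto
    note c = cell_props[OF Ix_Jx_less[OF p(2,3)]]
    have "a \<in> cell i j" using p c(4) by (auto simp: Ix_def Jx_def)
    then show "(case p of (i, j) \<Rightarrow> gr (cell i j) a K) = (case p of (i, j) \<Rightarrow> XB (cell i j) K)"
      using p pd_JH_diagram[OF c(1)] c(1) by (simp add: XB_def)
  qed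
  finally show ?thesis .
qed

text \<open>The index pairs of the cells containing \<open>half_open a b\<close>, by
  \<open>half_open_subset_cell\<close>.\<close>

definition rset :: "real \<Rightarrow> ereal \<Rightarrow> (nat \<times> nat) set" where
  "rset a b = {(i, j). i \<in> {1..n} \<and> j \<in> {1..n + 1} \<and> s i \<le> ereal a \<and> b \<le> s j}"

lemma is_rank_unique: assumes "is_rank C f a b v" "is_rank C f a b w" shows "v = w"
proof -
  obtain c where c: "c \<in> half_open a b" "\<forall>x \<in> half_open a b. c \<le> x \<longrightarrow> JH C (image_obj C (fl a x)) = v"
    using assms(1) unfolding is_rank_def by blast
  obtain d where d: "d \<in> half_open a b" "\<forall>x \<in> half_open a b. d \<le> x \<longrightarrow> JH C (image_obj C (fl a x)) = w"
    using assms(2) unfolding is_rank_def by blast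
  have "max c d \<in> half_open a b" using c(1) d(1) by (simp add: max_def)
  then show ?thesis using c(2) d(2) by (metis max.cobounded1 max.cobounded2)
qed

lemma is_rank_XB:
  assumes ab: "ereal a < b"
  shows "is_rank C f a b (\<lambda>K. \<Sum>(i, j) \<in> rset a b. XB (cell i j) K)"
proof -
  \<comment> \<open>\<open>c0\<close> is the largest critical value below \<open>b\<close>, or
    \<open>a\<close> if that is larger. For \<open>c\<close> from \<open>c0\<close> on and before
    \<open>b\<close>, lying before \<open>s j\<close> no longer depends on \<open>c\<close>: it
    means \<open>b \<le> s j\<close>.\<close>
  define T where "T = insert a (sr ` {j \<in> {1..n}. s j < b})"
  define c0 where "c0 = Max T"
  have fT: "finite T" unfolding T_def by simp
  have c0T: "c0 \<in> T" unfolding c0_def using fT by (intro Max_in) (auto simp: T_def)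
  have "a \<le> c0" unfolding c0_def using fT by (intro Max_ge) (auto simp: T_def)
  moreover have "ereal c0 < b" using c0T ab s_sr unfolding T_def by auto
  ultimately have c0: "c0 \<in> half_open a b" by (simp add: half_open_def)
  have iff: "ereal c < s j \<longleftrightarrow> b \<le> s j" if c: "c \<in> half_open a b" "c0 \<le> c" and j: "j \<in> {1..n + 1}" for c j
  proof
    assume l: "ereal c < s j"
    show "b \<le> s j"
    proof (rule ccontr)
      assume "\<not> b \<le> s j"
      then have sj: "s j < b" by simp
      then have j': "j \<in> {1..n}" using j s_top by (cases "j = n + 1") auto
      then have "sr j \<in> T" using sj unfolding T_def by blast
      then have "sr j \<le> c" using c(2) Max_ge[OF fT] unfolding c0_def by force
      then show False using l s_sr[OF j'] by simp
    qed
  next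
    assume "b \<le> s j"
    then show "ereal c < s j" using c(1) by (auto simp: half_open_def intro: less_le_trans)
  qed
  have "JH C (image_obj C (fl a c)) = (\<lambda>K. \<Sum>(i, j) \<in> rset a b. XB (cell i j) K)"
    if c: "c \<in> half_open a b" "c0 \<le> c" for c
  proof
    fix K
    have ac: "a \<le> c" using c by (simp add: half_open_def)
    have "ereal a \<le> ereal c" using ac by simp
    from le_less_trans[OF this] have "{(i, j). i \<in> Ix a \<and> j \<in> Jx a \<and> ereal c < s j} = rset a b"
      using iff[OF c] unfolding rset_def Ix_def Jx_def by auto
    then show "JH C (image_obj C (fl a c)) K = (\<Sum>(i, j) \<in> rset a b. XB (cell i j) K)"
      using image_rank[OF ac] by simp
  qed
  then show ?thesis unfolding is_rank_def using c0 by blast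
qed

lemma is_rank_ex1: "ereal a < b \<Longrightarrow> \<exists>!v. is_rank C f a b v"
  using is_rank_XB is_rank_unique by blast

lemma rank_vector_eq: "ereal a < b \<Longrightarrow> rank_vector C f a b = (\<lambda>K. \<Sum>(i, j) \<in> rset a b. XB (cell i j) K)"
  unfolding rank_vector_def
  by (rule the_equality[where P = "is_rank C f a b", OF is_rank_XB]) (auto intro: is_rank_unique is_rank_XB)

lemma half_open_subset_cell:
  assumes ab: "ereal a < b" and i: "i \<in> {1..n}" "j \<in> {1..n + 1}" "i < j"
  shows "half_open a b \<subseteq> cell i j \<longleftrightarrow> s i \<le> ereal a \<and> b \<le> s j"
proof
  assume s: "half_open a b \<subseteq> cell i j"
  have "a \<in> half_open a b" using ab by (simp add: half_open_def)
  then have "s i \<le> ereal a" using s cell_props(4)[OF i] by blast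
  moreover have "b \<le> s j"
  proof (rule ccontr)
    assume "\<not> b \<le> s j"
    then have sj: "s j < b" by simp
    then have j': "j \<in> {1..n}" using i s_top by (cases "j = n + 1") auto
    have "hi (half_open a b) \<subseteq> hi (cell i j)" using s unfolding hi_def by blast
    \<comment> \<open>The critical value \<open>s j\<close> lies before the end of
      \<open>half_open a b\<close> but not before the end of \<open>cell i j\<close>.\<close>
    moreover have "sr j \<in> hi (half_open a b)" unfolding hi_half_open[OF ab] using sj s_sr[OF j'] by simp
    ultimately show False using cell_props(3)[OF i] s_sr[OF j'] by auto
  qed
  ultimately show "s i \<le> ereal a \<and> b \<le> s j" by simp
next
  assume "s i \<le> ereal a \<and> b \<le> s j"
  then show "half_open a b \<subseteq> cell i j" unfolding cell_props(4)[OF i] half_open_def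
    by (auto intro: order_trans less_le_trans)
qed

lemma rset_less: assumes "ereal a < b" "(i, j) \<in> rset a b" shows "i \<in> {1..n}" "j \<in> {1..n + 1}" "i < j"
proof -
  show i: "i \<in> {1..n}" "j \<in> {1..n + 1}" using assms by (auto simp: rset_def)
  have "s i < s j" using assms by (auto simp: rset_def intro: le_less_trans less_le_trans)
  then show "i < j" using s_less_iff i by simp
qed

lemma cell_inj:
  assumes "i \<in> {1..n}" "j \<in> {1..n + 1}" "i < j" "i' \<in> {1..n}" "j' \<in> {1..n + 1}" "i' < j'" "cell i j = cell i' j'"
  shows "i = i' \<and> j = j'"
  using cell_le_iff[OF assms(1-6)] cell_le_iff[OF assms(4-6) assms(1-3)] assms(7) by auto

text \<open>\<open>rank_vector_eq\<close> is already a sum over the cells containing the interval.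
  Since cells determine their indices, it becomes a sum over intervals, and restricting to nonzero
  values drops only zero terms.\<close>

lemma moebius_XB: "is_moebius_inversion C f (s ` {1..n + 1}) XB"
  unfolding is_moebius_inversion_def
proof (intro conjI allI impI)
  show "XB L \<in> simple_vectors C" for L
  proof (cases "L \<in> real_intervals")
    case True
    then show ?thesis using pd_JH_diagram_simple by (simp add: XB_def)
  qed (simp add: XB_def simple_vectors_def)
  have "{L. XB L \<noteq> (\<lambda>_. 0)} \<subseteq> (\<lambda>(i, j). cell i j) ` ({1..n} \<times> {1..n + 1})"
  proof
    fix L assume "L \<in> {L. XB L \<noteq> (\<lambda>_. 0)}"
    then obtain i j where "i \<in> {1..n}" "j \<in> {1..n + 1}" "L = cell i j" using XB_support by blast
    then show "L \<in> (\<lambda>(i, j). cell i j) ` ({1..n} \<times> {1..n + 1})" by (intro image_eqI[of _ _ "(i, j)"]) auto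
  qed
  then show fin: "finite {L. XB L \<noteq> (\<lambda>_. 0)}" by (rule finite_subset) simp
  show "\<exists>a b. ereal a \<in> s ` {1..n + 1} \<and> b \<in> s ` {1..n + 1} \<and> ereal a < b \<and> L = half_open a b"
    if "XB L \<noteq> (\<lambda>_. 0)" for L
  proof -
    obtain i j where i: "i \<in> {1..n}" "j \<in> {1..n + 1}" "i < j" "L = cell i j" using XB_support[OF \<open>XB L \<noteq> (\<lambda>_. 0)\<close>] .
    have "ereal (sr i) = s i" using s_sr[OF i(1)] by simp
    moreover have "s i < s j" using s_less_iff i by simp
    moreover have "i \<in> {1..n + 1}" using i(1) by simp
    ultimately show ?thesis using i unfolding cell_def by (intro exI[of _ "sr i"] exI[of _ "s j"]) simp
  qed
  fix a b K assume ab: "ereal a < b"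
  let ?c = "\<lambda>(i, j). cell i j"
  have inj: "inj_on ?c (rset a b)"
  proof (rule inj_onI)
    fix p q assume pq: "p \<in> rset a b" "q \<in> rset a b" "?c p = ?c q"
    obtain i j i' j' where e: "p = (i, j)" "q = (i', j')" by (cases p, cases q)
    show "p = q"
      using cell_inj[OF rset_less[OF ab pq(1)[unfolded e]] rset_less[OF ab pq(2)[unfolded e]]] pq(3) e by simp
  qed
  have fr: "finite (rset a b)"
    by (rule finite_subset[of _ "{1..n} \<times> {1..n + 1}"]) (auto simp: rset_def)
  have "rank_vector C f a b K = (\<Sum>p \<in> rset a b. XB (?c p) K)"
    unfolding rank_vector_eq[OF ab] by (simp add: case_prod_unfold)
  also have "\<dots> = (\<Sum>L \<in> ?c ` rset a b. XB L K)" by (simp only: sum.reindex[OF inj] o_def)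
  also have "\<dots> = (\<Sum>L | L \<in> Dgm \<and> half_open a b \<subseteq> L \<and> XB L \<noteq> (\<lambda>_. 0). XB L K)"
  proof (rule sum.mono_neutral_right)
    show "finite (?c ` rset a b)" using fr by simp
    show "{L \<in> Dgm. half_open a b \<subseteq> L \<and> XB L \<noteq> (\<lambda>_. 0)} \<subseteq> ?c ` rset a b"
    proof
      fix L assume L: "L \<in> {L \<in> Dgm. half_open a b \<subseteq> L \<and> XB L \<noteq> (\<lambda>_. 0)}"
      then obtain i j where i: "i \<in> {1..n}" "j \<in> {1..n + 1}" "i < j" "L = cell i j" using XB_support by blast
      then have "(i, j) \<in> rset a b" using half_open_subset_cell[OF ab i(1-3)] L by (simp add: rset_def)
      then show "L \<in> ?c ` rset a b" using i(4) by force
    qed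
    show "\<forall>L \<in> ?c ` rset a b - {L \<in> Dgm. half_open a b \<subseteq> L \<and> XB L \<noteq> (\<lambda>_. 0)}. XB L K = 0"
    proof
      fix L assume L: "L \<in> ?c ` rset a b - {L \<in> Dgm. half_open a b \<subseteq> L \<and> XB L \<noteq> (\<lambda>_. 0)}"
      then obtain i j where ij: "(i, j) \<in> rset a b" "L = cell i j" by auto
      note r = rset_less[OF ab ij(1)]
      have "half_open a b \<subseteq> L" using half_open_subset_cell[OF ab r] ij by (simp add: rset_def)
      moreover have "L \<in> Dgm" unfolding ij(2) cell_def
        using half_open_Dgm s_less_iff[of i j] r s_sr[OF r(1)] by simp
      ultimately have "XB L = (\<lambda>_. 0)" using L by blast
      then show "XB L K = 0" by simp
    qed
  qed
  finally show "rank_vector C f a b K = (\<Sum>L | L \<in> Dgm \<and> half_open a b \<subseteq> L \<and> XB L \<noteq> (\<lambda>_. 0). XB L K)" .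
qed

end

lemma constructible_diagram_obtain:
  fixes C :: "('o, 'm) cat"
  assumes "abcat C add nul" and F: "is_functor C f" and c: "constructible_wrt C f S"
    and fin: "\<forall>a. finite_length C (on_obj f a)"
  obtains n :: nat and s where "constructible_diagram C add nul f n s" "S = s ` {1..n + 1}"
proof -
  interpret abcat C add nul by fact
  obtain n :: nat and s Z where ns: "s ` {1..n} \<subseteq> range ereal" "s (n + 1) = \<infinity>" "strict_mono_on {1..n + 1} s"
    "S = s ` {1..n + 1}" "zero_object C Z" and z: "\<And>p q. p \<le> q \<Longrightarrow> ereal q < s 1 \<Longrightarrow> on_le f p q = cid C Z"
    and i: "\<And>i p q. i \<in> {1..n} \<Longrightarrow> s i \<le> ereal p \<Longrightarrow> p \<le> q \<Longrightarrow> ereal q < s (i + 1) \<Longrightarrow> iso_arr C (on_le f p q)"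
    using c unfolding constructible_wrt_def by metis
  have "zero_object C (on_obj f a)" if "ereal a < s 1" for a
  proof -
    \<comment> \<open>The domain of this identity arrow is both \<open>f a\<close> and
      \<open>Z\<close>, so the two objects are equal and not merely isomorphic.\<close>
    have "cid C (on_obj f a) = cid C Z" using z[OF order.refl that] F by (simp add: is_functor_def)
    moreover have "cid C (on_obj f a) \<in> H (on_obj f a) (on_obj f a)" "cid C Z \<in> H Z Z"
      using id_homs functor_obj[OF F] ns(5) by (auto simp: zero_object_def)
    ultimately have "on_obj f a = Z" using homs_dom by metis
    then show ?thesis using ns(5) by simp
  qed
  then have "constructible_diagram C add nul f n s"
    using F ns i fin by unfold_locales blast+
  then show ?thesis using that ns(4) by blast
qed

theorem theorem5:
  fixes E :: "('o, 'm) cat" and f :: "(real, 'o, 'm) diagram"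
  assumes "abelian_category E"
    and "is_functor E f"
    and "constructible E f"
    and "\<forall>a. finite_length E (on_obj f a)"
  shows "PD_B_well_defined E f \<and>
         PD_sae_well_defined E f \<and>
         (\<forall>J \<in> real_intervals.
            interval_diagram E J (PD_sae E f J) \<and>
            (\<forall>a \<in> J. finite_length E (on_obj (PD_sae E f J) a)) \<and>
            PD_B E f J = JH_diagram E J (PD_sae E f J))"
proof -
  interpret abelian_category E by fact
  obtain add nul where "abcat E add nul"
    using additive abcat.intro[OF assms(1)] abcat_axioms.intro[of E] by metis
  note obt = constructible_diagram_obtain[OF this assms(2) _ assms(4)]
  obtain S where S: "constructible_wrt E f S" using assms(3) unfolding constructible_def by blast
  obtain n s where ns: "constructible_diagram E add nul f n s" "S = s ` {1..n + 1}" using obt[OF S] by blast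
  interpret constructible_diagram E add nul f n s by fact
  \<comment> \<open>Another set of critical values gives another instance of the locale for the same
    diagram; \<open>moebius_inversion_unique\<close> compares inversions across such
    choices.\<close>
  have mex: "\<exists>X. is_moebius_inversion E f S' X" if "constructible_wrt E f S'" for S'
    using obt[OF that] constructible_diagram.moebius_XB by metis
  have ex1: "\<exists>!X. \<exists>S. constructible_wrt E f S \<and> is_moebius_inversion E f S X"
    using S mex moebius_inversion_unique[of E f] by blast
  have B: "PD_B_well_defined E f"
    unfolding PD_B_well_defined_def
    using image_JH(1)[OF finite_len fl_homs] is_rank_ex1 mex moebius_inversion_unique[of E f] ex1 by blast
  have sae: "PD_sae_well_defined E f"
    unfolding PD_sae_well_defined_def
    using saecular_hom_ex1 pd_quotient_exists saecular_CDI_down by simp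
  have "PD_B E f = XB"
    unfolding PD_B_def using S moebius_XB ns(2) by (intro the1_equality[OF ex1]) blast
  then have "PD_B E f J = JH_diagram E J (PD_sae E f J)" if "J \<in> real_intervals" for J
    using that by (simp add: XB_def)
  then show ?thesis using B sae pd_interval_diagram pd_JH(1) by blast
qed

end
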